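(* Let $d\ge 1$ and let $\alpha=(\alpha_1,\dots,\alpha_{\ell(\alpha)})\vdash d$ be a partition. The genus one monotone single Hurwitz number $\vec{H}_1(\alpha)$ is given by $$\vec{H}_1(\alpha)=\frac{1}{24}\,\frac{d!}{|\operatorname{Aut}\alpha|}\prod_{j=1}^{\ell(\alpha)}\binom{2\alpha_j}{\alpha_j}\times\left((2d+1)^{\overline{\ell(\alpha)}}-3(2d+1)^{\overline{\ell(\alpha)-1}}-\sum_{k=2}^{\ell(\alpha)}(k-2)!\,(2d+1)^{\overline{\ell(\alpha)-k}}\,e_k(2\alpha+1)\right),$$ where $e_k(2\alpha+1)$ is the $k$th elementary symmetric polynomial of the values $2\alpha_i+1$, $i=1,\dots,\ell(\alpha)$.
   Context: Monotone single Hurwitz numbers: for $g\ge 0$, $d\ge1$ and a partition $\alpha\vdash d$ with $\ell(\alpha)$ parts, $\vec{H}_g(\alpha)$ is the number of tuples $(\rho,\sigma,\tau_1,\dots,\tau_r)$ of permutations in the symmetric group $S_d$ such that: (1) $\rho$ has cycle type $\alpha$, $\sigma$ has cycle type $(1^d)$ (so $\sigma$ is the identity), and the $\tau_i$ are transpositions; (2) the product $\rho\sigma\tau_1\cdots\tau_r$ is the identity; (3) the subgroup $\langle\rho,\sigma,\tau_1,\dots,\tau_r\rangle\subseteq S_d$ is transitive on $\{1,\dots,d\}$; (4) $r=2g-2+\ell(\alpha)+d$; (5) writing $\tau_i=(a_i\,b_i)$ with $a_i<b_i$, one has $b_1\le\cdots\le b_r$. Notation: $|\operatorname{Aut}\alpha|=\prod_{i\ge1}m_i!$,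 where $m_i$ is the number of parts of $\alpha$ equal to $i$. For $k\ge0$, $(2d+1)^{\overline{k}}=(2d+1)(2d+2)\cdots(2d+k)$ is the rising product with $k$ factors (equal to $1$ for $k=0$). *)

theory Defs
  imports
    "HOL-Algebra.Sym_Groups"
    "HOL-Algebra.Generated_Groups"
    "HOL-Combinatorics.Orbits"
    "HOL-Library.Multiset"
    Complex_Main
begin

definition is_partition :: "nat list \<Rightarrow> nat \<Rightarrow> bool"  (infix "\<turnstile>\<^sub>p" 50)
  where "\<alpha> \<turnstile>\<^sub>p d \<longleftrightarrow> sorted_wrt (\<ge>) \<alpha> \<and> (\<forall>a\<in>set \<alpha>. a \<ge> 1) \<and> sum_list \<alpha> = d"

text \<open>Elements of the symmetric group on \<open>{1..d}\<close> are functions \<^typ>\<open>nat \<Rightarrow> nat\<close> permuting that set and fixing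
  every other number, as in \<^const>\<open>sym_group\<close>. Fixed points in \<open>{1..d}\<close> count as cycles of length 1.\<close>

definition cycle_type :: "nat \<Rightarrow> (nat \<Rightarrow> nat) \<Rightarrow> nat multiset"
  where "cycle_type d p = image_mset card (mset_set ((\<lambda>x. Orbits.orbit p x) ` {1..d}))"

definition is_transposition :: "nat \<Rightarrow> (nat \<Rightarrow> nat) \<Rightarrow> bool"
  where "is_transposition d t \<longleftrightarrow> (\<exists>a\<in>{1..d}. \<exists>b\<in>{1..d}. a < b \<and> t = transpose a b)"

definition monotone_transpositions :: "(nat \<Rightarrow> nat) list \<Rightarrow> bool"
  where "monotone_transpositions ts \<longleftrightarrow>
    (\<exists>a b :: nat \<Rightarrow> nat.
       (\<forall>i < length ts. a i < b i \<and> ts ! i = transpose (a i) (b i)) \<and>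
       (\<forall>i j. i \<le> j \<longrightarrow> j < length ts \<longrightarrow> b i \<le> b j))"

definition transitive_on :: "nat \<Rightarrow> (nat \<Rightarrow> nat) set \<Rightarrow> bool"
  where "transitive_on d G \<longleftrightarrow> (\<forall>x\<in>{1..d}. \<forall>y\<in>{1..d}. \<exists>g\<in>G. g x = y)"

definition monotone_factorizations ::
    "nat \<Rightarrow> nat list \<Rightarrow> ((nat \<Rightarrow> nat) \<times> (nat \<Rightarrow> nat) \<times> (nat \<Rightarrow> nat) list) set"
  where "monotone_factorizations g \<alpha> = (let d = sum_list \<alpha> in
    {(\<rho>, \<sigma>, ts).
       \<rho> \<in> carrier (sym_group d) \<and> cycle_type d \<rho> = mset \<alpha> \<and>
       \<sigma> \<in> carrier (sym_group d) \<and> cycle_type d \<sigma> = replicate_mset d 1 \<and>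
       (\<forall>t\<in>set ts. is_transposition d t) \<and>
       \<rho> \<circ> \<sigma> \<circ> foldr (\<circ>) ts id = id \<and>
       transitive_on d (generate (sym_group d) ({\<rho>, \<sigma>} \<union> set ts)) \<and>
       int (length ts) = 2 * int g - 2 + int (length \<alpha>) + int d \<and>
       monotone_transpositions ts})"

definition monotone_hurwitz :: "nat \<Rightarrow> nat list \<Rightarrow> nat"
  where "monotone_hurwitz g \<alpha> = card (monotone_factorizations g \<alpha>)"

definition aut_size :: "nat list \<Rightarrow> nat"
  where "aut_size \<alpha> = (\<Prod>i\<in>set \<alpha>. fact (count_list \<alpha> i))"

definition elem_sym :: "nat \<Rightarrow> 'a::comm_semiring_1 list \<Rightarrow> 'a"
  where "elem_sym k xs = (\<Sum>I | I \<subseteq> {..<length xs} \<and> card I = k. \<Prod>i\<in>I. xs ! i)"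

end

theory Submission
  imports Defs "HOL-Computational_Algebra.Formal_Power_Series"
begin

text \<open>
  Fix a permutation of a finite set \<open>A\<close> of numbers and count its transitive monotone factorizations by their
  last transposition, which is \<open>(a m)\<close> with \<open>m = Max A\<close>. Multiplication by it joins the cycle of \<open>m\<close> with
  another one or cuts it in two, and without it the action is still transitive or splits into two
  orbits. This gives a recursion for the number of factorizations of a permutation with cycle lengths
  \<open>k\<close> (the cycle of \<open>m\<close>) and \<open>a j\<close>, \<open>j \<in> S\<close>, and it remains to check that the closed formulas in genus 0 and
  genus 1 satisfy it.

  By Lagrange inversion the formulas are the multilinear coefficients of polynomials in \<open>p\<^sub>j s^a j\<close> of
  degree at most one, multiplied by \<open>s\<^sup>k\<close> in genus 0 and by \<open>s\<^sup>k / (1 - \<eta>)\<^sup>2\<close> in genus 1. Since products of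
  series are subset convolutions of coefficients, the recursion becomes an identity between
  polynomials of degree two, whose coefficients are identities between Catalan numbers in one or two
  additional parameters.
\<close>

unbundle fps_syntax

section \<open>Catalan identities\<close>

text \<open>Connectedness and monotonicity force \<open>Max A\<close> into the last transposition,
  so only its partner \<open>a\<close> is free. Joining two cycles keeps the genus; cutting one
  lowers the genus by one if the action stays transitive, and otherwise distributes the genus over
  the two orbits. Genus 1 thus needs genus 0 twice: as a factor, and with two distinguished cycles.
  Lengths below the minimum and between the two genera must give 0, and \<open>Psi\<close> carries
  these zeros through the induction. Cycles are labelled elements of a finite set, so each p_j
  occurs at most once and finite set functions replace generating functions in infinitely many
  variables. The points of a cycle give the join term a factor \<open>a j\<close>; division by
  \<open>nbinom (a j)\<close> turns it into \<open>1 / cbinom (a j)\<close>, and joining becomes a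
  shift of Catalan indices. In a product of two polynomials of degree one, the terms for (i, j) and
  (j, i) belong to the same monomial, which is why the quadratic Catalan identities are
  symmetrized.\<close>

definition cbinom :: "nat \<Rightarrow> real" where
  "cbinom k = real ((2 * k) choose k)"

definition nbinom :: "nat \<Rightarrow> real" where
  "nbinom k = real k * cbinom k"

text \<open>\<open>cat k\<close> is the Catalan number with index \<open>k - 1\<close>.\<close>

definition cat :: "nat \<Rightarrow> real" where
  "cat k = (if k = 0 then 0 else cbinom k / (2 * (2 * real k - 1)))"

text \<open>The coefficient of \<open>- p\<^sub>j s\<^sup>j\<close> in \<open>s\<^sup>-\<^sup>k k \<partial>H\<^sub>0/\<partial>p\<^sub>k\<close>, after division of \<open>p\<^sub>j\<close> by the central
  binomial coefficient; see \<open>N0_eq\<close>.\<close>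

definition attach :: "nat \<Rightarrow> nat \<Rightarrow> real" where
  "attach k j = (2 * real j + 1) * (real k * cat k / (real k + real j))"

lemma cbinom_pos: "cbinom k > 0"
  by (simp add: cbinom_def)

lemma cbinom_Suc: "(real k + 1) * cbinom (Suc k) = 2 * (2 * real k + 1) * cbinom k"
proof -
  have 1: "cbinom n = fact (2 * n) / (fact n * fact n)" for n
    unfolding cbinom_def by (subst binomial_fact) (auto simp: mult_2)
  have "fact (2 * Suc k) = (2 * real k + 2) * (2 * real k + 1) * fact (2 * k)"
    by (simp add: algebra_simps)
  then show ?thesis
    unfolding 1 by (simp add: divide_simps) (simp add: algebra_simps)
qed

lemma odd_nonzero: "2 * real k - 1 \<noteq> 0"
proof
  assume "2 * real k - 1 = 0"
  then have "real (2 * k) = real 1" by simp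
  then have "2 * k = 1" by (simp only: of_nat_eq_iff)
  then show False by presburger
qed

lemma cat_Suc: "cat (Suc k) = cbinom k / (real k + 1)"
  using cbinom_Suc[of k] by (simp add: cat_def field_simps)

lemma cat_0 [simp]: "cat 0 = 0"
  by (simp add: cat_def)

lemma nbinom_cat: "nbinom k = 2 * real k * (2 * real k - 1) * cat k"
  using odd_nonzero[of k] by (simp add: cat_def nbinom_def field_simps)

lemma cat_rec: "k \<ge> 1 \<Longrightarrow> (real k + 1) * cat (Suc k) = (4 * real k - 2) * cat k"
  using odd_nonzero[of k] by (simp add: cat_Suc) (simp add: cat_def field_simps)

lemma fps_numeral_mult_nth: "(numeral m * f :: real fps) $ n = numeral m * f $ n"
  by (simp add: numeral_fps_const)

text \<open>The coefficient of X^(n+1) reads (n + 1 + j) f_(n+1) = (4 (n + j) - c) f_n, and n + 1 +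
  j is never 0, so f is determined by f_0. The constant coefficient of the equation gives j f_0 = 0,
  which says nothing for j = 0; hence the second hypothesis.\<close>

lemma fps_ode_unique:
  fixes f :: "real fps"
  assumes "(1 - 4 * fps_X) * (fps_X * fps_deriv f + of_nat j * f) + of_nat c * fps_X * f = 0"
    and "j > 0 \<or> f $ 0 = 0"
  shows "f = 0"
proof (rule fps_ext)
  fix n
  let ?g = "fps_X * fps_deriv f + of_nat j * f"
  have g: "?g $ n = (real n + real j) * f $ n" for n
    by (cases n) (simp_all add: fps_mult_of_nat_nth algebra_simps)
  have eq: "?g $ Suc n = 4 * ?g $ n - real c * f $ n" for n
  proof -
    have "((1 - 4 * fps_X) * ?g + of_nat c * (fps_X * f)) $ Suc n = 0"
      using assms(1) by (simp only: mult.assoc fps_zero_nth)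
    moreover have "((1 - 4 * fps_X) * ?g) $ Suc n = ?g $ Suc n - 4 * ?g $ n"
      by (simp add: left_diff_distrib mult.assoc fps_numeral_mult_nth del: fps_add_nth)
    moreover have "(of_nat c * (fps_X * f)) $ Suc n = real c * f $ n"
      by (simp add: fps_mult_of_nat_nth)
    ultimately show ?thesis by (simp del: fps_mult_nth)
  qed
  show "f $ n = 0 $ n"
  proof (induction n)
    case 0
    have "((1 - 4 * fps_X) * ?g + of_nat c * (fps_X * f)) $ 0 = 0"
      using assms(1) by (simp only: mult.assoc fps_zero_nth)
    then have "real j * f $ 0 = 0" by (simp add: fps_mult_of_nat_nth)
    with assms(2) show ?case by auto
  next
    case (Suc n)
    have "(real (Suc n) + real j) * f $ Suc n = 0"
      using eq[of n] Suc unfolding g by simp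
    then show ?case by (simp add: add_nonneg_eq_0_iff)
  qed
qed

text \<open>All series below are algebraic over \<open>Yf\<close>, the square root of \<open>1 - 4X\<close>, up to the shifted series
  \<open>Sf j\<close>. The products involving \<open>Rf j\<close> are identified by the first-order differential equations which
  they satisfy; \<open>theta j\<close> acts on \<open>f\<close> as \<open>X d/dX\<close> acts on \<open>X\<^sup>j f\<close>. The factor \<open>4 j - 2\<close> makes the
  constant coefficient of \<open>Sf j\<close> equal to 1.\<close>

definition Cf :: "real fps" where "Cf = Abs_fps cat"
definition Yf :: "real fps" where "Yf = 1 - 2 * Cf"
definition Uf :: "real fps" where "Uf = Abs_fps cbinom"
definition Rf :: "nat \<Rightarrow> real fps" where
  "Rf j = Abs_fps (\<lambda>k. real k * cat k / (real k + real j))"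
definition Sf :: "nat \<Rightarrow> real fps" where
  "Sf j = Abs_fps (\<lambda>k. (4 * real j - 2) * cat (k + j) / cbinom j)"
definition theta :: "nat \<Rightarrow> real fps \<Rightarrow> real fps" where
  "theta j f = fps_X * fps_deriv f + of_nat j * f"

abbreviation (input) qq :: "real fps" where "qq \<equiv> 1 - 4 * fps_X"

lemma qq_nz: "qq \<noteq> 0"
proof
  assume "qq = 0"
  then have "qq $ 0 = 0" by (simp only: fps_zero_nth)
  then show False by simp
qed

lemma theta_nth: "theta j f $ n = (real n + real j) * f $ n"
  unfolding theta_def by (cases n) (simp_all add: fps_mult_of_nat_nth algebra_simps)

lemma deriv_Cf: "fps_deriv Cf = Uf"
  by (rule fps_ext) (simp add: Cf_def Uf_def cat_Suc add.commute)

lemma deriv_Yf: "fps_deriv Yf = - 2 * Uf"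
  by (simp add: Yf_def deriv_Cf)

lemma qq_nth_Suc: "(qq * f) $ Suc n = f $ Suc n - 4 * f $ n"
  by (simp add: left_diff_distrib mult.assoc fps_numeral_mult_nth)

lemma qq_Uf: "qq * Uf = Yf"
proof (rule fps_ext)
  fix n
  show "(qq * Uf) $ n = Yf $ n"
  proof (cases n)
    case 0
    then show ?thesis by (simp add: Uf_def Yf_def Cf_def fps_numeral_mult_nth cbinom_def)
  next
    case (Suc m)
    have "cbinom (Suc m) - 4 * cbinom m = - 2 * cat (Suc m)"
      using cbinom_Suc[of m] by (simp add: cat_Suc field_simps)
    then show ?thesis using Suc
      by (simp only: qq_nth_Suc) (simp add: Uf_def Yf_def Cf_def fps_numeral_mult_nth)
  qed
qed

lemma qq_deriv_Uf: "qq * fps_deriv Uf = 2 * Uf"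
proof (rule fps_ext)
  fix n
  show "(qq * fps_deriv Uf) $ n = (2 * Uf) $ n"
  proof (cases n)
    case 0
    then show ?thesis using cbinom_Suc[of 0] by (simp add: Uf_def fps_numeral_mult_nth)
  next
    case (Suc m)
    then show ?thesis using cbinom_Suc[of "Suc m"]
      by (simp only: qq_nth_Suc fps_deriv_nth fps_numeral_mult_nth Uf_def fps_nth_Abs_fps)
        (simp add: algebra_simps)
  qed
qed

text \<open>By \<open>qq_deriv_Uf\<close> and \<open>qq_Uf\<close> the two terms of the derivative
  of the product cancel, so the product is its constant coefficient. Together with
  \<open>qq_Uf\<close> this identifies \<open>Yf\<close> as the square root of 1 - 4X.\<close>

lemma Uf_Yf: "Uf * Yf = 1"
proof -
  have "Uf * Yf - 1 = 0"
  proof (rule fps_ode_unique[where j=0 and c=0])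
    have "qq * (fps_X * fps_deriv (Uf * Yf - 1)) = fps_X * (Yf * (qq * fps_deriv Uf) - 2 * Uf * (qq * Uf))"
      by (simp add: deriv_Yf algebra_simps)
    also have "\<dots> = 0" unfolding qq_deriv_Uf qq_Uf by simp
    finally show "qq * (fps_X * fps_deriv (Uf * Yf - 1) + of_nat 0 * (Uf * Yf - 1)) +
        of_nat 0 * fps_X * (Uf * Yf - 1) = 0" by simp
    show "0 < (0::nat) \<or> (Uf * Yf - 1) $ 0 = 0"
      by (simp add: Uf_def Yf_def Cf_def cbinom_def fps_numeral_mult_nth)
  qed
  then show ?thesis by simp
qed

lemma Yf_square: "Yf * Yf = qq"
  by (metis Uf_Yf mult.assoc mult.right_neutral qq_Uf)

lemma Uf_square: "qq * (Uf * Uf) = 1"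
  by (metis Uf_Yf mult.assoc mult.commute qq_Uf)

lemma Cf_eq: "Cf = fps_X + Cf * Cf"
proof -
  have "4 * (fps_X + Cf * Cf - Cf) = 0"
    using Yf_square unfolding Yf_def by (simp add: algebra_simps)
  then show ?thesis by (metis mult_eq_0_iff right_minus_eq zero_neq_numeral)
qed

section \<open>Products of the series in genus 0\<close>

lemma theta_Rf: "j > 0 \<Longrightarrow> theta j (Rf j) = fps_X * Uf"
  by (rule fps_ext, case_tac n)
     (simp_all only: theta_nth, simp_all add: Rf_def Uf_def cat_Suc add.commute add.left_commute)

text \<open>In positive degree this is the Catalan recursion \<open>cat_rec\<close> at the shifted
  index m + j; the right-hand side is the constant coefficient.\<close>

lemma theta_Sf:
  assumes "j > 0"
  shows "qq * theta j (Sf j) + 2 * fps_X * Sf j = of_nat j"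
proof (rule fps_ext)
  fix n
  have odd: "4 * real j - 2 \<noteq> 0" using odd_nonzero[of j] by simp
  have cbj: "cbinom j \<noteq> 0" using cbinom_pos[of j] by simp
  show "(qq * theta j (Sf j) + 2 * fps_X * Sf j) $ n = of_nat j $ n"
  proof (cases n)
    case 0
    then show ?thesis using assms odd cbj
      by (simp add: theta_nth mult.assoc) (simp add: Sf_def cat_def)
  next
    case (Suc m)
    have "(real (m + j) + 1) * cat (Suc (m + j)) = (4 * real (m + j) - 2) * cat (m + j)"
      using assms by (intro cat_rec) auto
    then have r: "(real m + real j + 1) * cat (Suc (m + j)) = (4 * (real m + real j) - 2) * cat (m + j)"
      by simp
    have "(qq * theta j (Sf j) + 2 * (fps_X * Sf j)) $ n
      = (4 * real j - 2) / cbinom j * ((real m + real j + 1) * cat (Suc (m + j)) - (4 * (real m + real j) - 2) * cat (m + j))"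
      unfolding Suc fps_add_nth qq_nth_Suc theta_nth fps_numeral_mult_nth
      using cbj by (simp add: Sf_def field_simps)
    then show ?thesis unfolding r using Suc assms by (simp add: mult.assoc fps_of_nat[symmetric])
  qed
qed

text \<open>Because theta j (Rf j) = X Uf and Uf Yf = 1, the product \<open>Yf * Rf j\<close>
  satisfies the differential equation of \<open>Sf j\<close> up to a polynomial right-hand side, and
  the polynomial 2 (4j - 2) X + 1 compensates the difference. The lemma serves to eliminate
  \<open>Rf j\<close> in favour of shifted Catalan numbers.\<close>

lemma Yf_Rf:
  assumes "j > 0"
  shows "(4 * of_nat j - 2) * (2 * of_nat j + 1) * (Yf * Rf j) = 2 * (4 * of_nat j - 2) * fps_X + 1 - Sf j"
proof -
  let ?j = "of_nat j :: real fps"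
  define f where "f = (4 * ?j - 2) * (2 * ?j + 1) * (Yf * Rf j) - (2 * (4 * ?j - 2) * fps_X + 1 - Sf j)"
  have R: "fps_X * fps_deriv (Rf j) = fps_X * Uf - ?j * Rf j"
    using theta_Rf[OF assms] by (simp add: theta_def algebra_simps)
  have S: "qq * (fps_X * fps_deriv (Sf j)) = ?j - 2 * fps_X * Sf j - qq * (?j * Sf j)"
    using theta_Sf[OF assms] by (simp add: theta_def algebra_simps)
  have "f = 0"
  proof (rule fps_ode_unique[where j=j and c=2])
    have "qq * (fps_X * fps_deriv f + ?j * f) + 2 * fps_X * f
      = (4 * ?j - 2) * (2 * ?j + 1) * (Yf * (qq * (fps_X * fps_deriv (Rf j))) - 2 * fps_X * (qq * Uf) * Rf j
          + qq * ?j * Yf * Rf j + 2 * fps_X * Yf * Rf j)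
        - qq * (2 * (4 * ?j - 2) * fps_X) + qq * (fps_X * fps_deriv (Sf j))
        - (qq * ?j + 2 * fps_X) * (2 * (4 * ?j - 2) * fps_X + 1 - Sf j)"
      unfolding f_def by (simp add: deriv_Yf algebra_simps)
    also have "\<dots> = (4 * ?j - 2) * (2 * ?j + 1) * (qq * fps_X * (Uf * Yf))
        - qq * (2 * (4 * ?j - 2) * fps_X) + (?j - 2 * fps_X * Sf j - qq * (?j * Sf j))
        - (qq * ?j + 2 * fps_X) * (2 * (4 * ?j - 2) * fps_X + 1 - Sf j)"
      unfolding S R qq_Uf by (simp add: algebra_simps)
    also have "\<dots> = 0"
      unfolding Uf_Yf by (simp add: algebra_simps)
    finally show "qq * (fps_X * fps_deriv f + ?j * f) + of_nat 2 * fps_X * f = 0" by simp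
  qed (use assms in auto)
  then show ?thesis by (simp add: f_def)
qed

text \<open>An integral of \<open>theta j (Sf j)\<close> with respect to
  \<open>theta (i + j)\<close>. Up to scalars its coefficients are the numbers
  \<open>attach (k + j) i / cbinom j\<close> that arise when a cycle of length j is joined to one of
  length k.\<close>

definition Wf :: "nat \<Rightarrow> nat \<Rightarrow> real fps" where
  "Wf i j = Abs_fps (\<lambda>k. (real k + real j) * (Sf j $ k) / (real k + real i + real j))"

lemma theta_Wf: "i > 0 \<Longrightarrow> theta (i + j) (Wf i j) = theta j (Sf j)"
  by (rule fps_ext) (simp add: theta_nth Wf_def add_nonneg_eq_0_iff add.assoc)

lemma theta_ode_unique:
  assumes "j > 0" "qq * theta j f + of_nat c * fps_X * f = qq * theta j g + of_nat c * fps_X * g"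
  shows "f = g"
proof -
  have "qq * (fps_X * fps_deriv (f - g) + of_nat j * (f - g)) + of_nat c * fps_X * (f - g)
    = (qq * theta j f + of_nat c * fps_X * f) - (qq * theta j g + of_nat c * fps_X * g)"
    unfolding theta_def fps_deriv_sub by (simp only: distrib_left right_diff_distrib) (simp only: algebra_simps)
  also have "\<dots> = 0"
    by (simp only: assms(2) diff_self)
  finally have "f - g = 0"
    by (rule fps_ode_unique) (use assms(1) in simp)
  then show ?thesis by simp
qed

lemma theta_add: "theta j (f + g) = theta j f + theta j g"
  and theta_diff: "theta j (f - g) = theta j f - theta j g"
  and theta_scale: "fps_deriv c = 0 \<Longrightarrow> theta j (c * f) = c * theta j f"
  and theta_X: "theta j fps_X = fps_X + of_nat j * fps_X"
  and theta_mult: "theta (i + j) (f * g) = theta i f * g + f * theta j g"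
  by (simp_all add: theta_def algebra_simps)

text \<open>The product rule turns the left product into X Uf (Rf i + Rf j). After multiplication by
  1 - 4X, \<open>Yf_Rf\<close> replaces the factors \<open>Yf * Rf\<close> by shifted series, which
  \<open>theta_Wf\<close> integrates. The subtracted constants are the constant coefficients of the
  two \<open>Wf\<close>, as the left-hand side has none.\<close>

lemma Rf_Rf:
  fixes i j :: nat
  assumes "i > 0" "j > 0"
  defines "I \<equiv> of_nat i :: real fps" and "J \<equiv> of_nat j :: real fps"
  shows "(4 * I - 2) * (4 * J - 2) * (2 * (2 * I + 1) * (2 * J + 1) * (Rf i * Rf j) + 2 * fps_X)
    = (4 * I - 2) * (2 * I + 1) * (Wf i j - fps_const (real j / (real i + real j)))
    + (4 * J - 2) * (2 * J + 1) * (Wf j i - fps_const (real i / (real i + real j)))"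
proof (rule theta_ode_unique[where j="i+j" and c=0])
  let ?hi = "4 * I - 2" and ?hj = "4 * J - 2" and ?yi = "2 * I + 1" and ?yj = "2 * J + 1"
  have S: "qq * theta (i + j) (Wf i j) = J - 2 * fps_X * Sf j" "qq * theta (i + j) (Wf j i) = I - 2 * fps_X * Sf i"
    using theta_Sf[of j] theta_Sf[of i] theta_Wf[of i j] theta_Wf[of j i] assms
    by (auto simp: algebra_simps)
  have c: "theta (i + j) (fps_const (real k / (real i + real j))) = of_nat k" for k
  proof -
    have "theta (i + j) (fps_const (real k / (real i + real j))) = fps_const (real (i + j) * (real k / (real i + real j)))"
      unfolding theta_def by (simp add: fps_of_nat[symmetric])
    also have "real (i + j) * (real k / (real i + real j)) = real k"
      using assms by (simp add: field_simps)
    finally show ?thesis by (simp add: fps_of_nat)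
  qed
  have R: "qq * theta (i + j) (Rf i * Rf j) = fps_X * (Yf * Rf i + Yf * Rf j)"
  proof -
    have "qq * theta (i + j) (Rf i * Rf j) = fps_X * ((qq * Uf) * Rf j + (qq * Uf) * Rf i)"
      unfolding theta_mult theta_Rf[OF assms(1)] theta_Rf[OF assms(2)] by (simp add: algebra_simps)
    then show ?thesis unfolding qq_Uf by (simp only: add.commute)
  qed
  have T: "?hi * ?yi * (Yf * Rf i) = 2 * ?hi * fps_X + 1 - Sf i"
          "?hj * ?yj * (Yf * Rf j) = 2 * ?hj * fps_X + 1 - Sf j"
    unfolding I_def J_def by (rule Yf_Rf[OF assms(1)], rule Yf_Rf[OF assms(2)])
  have [simp]: "fps_deriv I = 0" "fps_deriv J = 0" by (simp_all add: I_def J_def)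
  have l: "theta (i + j) (?hi * ?hj * (2 * ?yi * ?yj * (Rf i * Rf j) + 2 * fps_X))
     = ?hi * ?hj * (2 * ?yi * ?yj * theta (i + j) (Rf i * Rf j) + 2 * theta (i + j) fps_X)"
    by (simp add: theta_scale theta_add)
  have r: "theta (i + j) (?hi * ?yi * (Wf i j - fps_const (real j / (real i + real j)))
    + ?hj * ?yj * (Wf j i - fps_const (real i / (real i + real j))))
    = ?hi * ?yi * (theta (i + j) (Wf i j) - J) + ?hj * ?yj * (theta (i + j) (Wf j i) - I)"
    by (simp add: theta_scale theta_add theta_diff c I_def J_def)
  have "qq * theta (i + j) (?hi * ?hj * (2 * ?yi * ?yj * (Rf i * Rf j) + 2 * fps_X))
    = ?hi * ?hj * (2 * ?yi * ?yj * (qq * theta (i + j) (Rf i * Rf j)) + 2 * qq * theta (i + j) fps_X)"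
    unfolding l by (simp add: algebra_simps)
  also have "\<dots> = 2 * fps_X * (?hj * ?yj * (?hi * ?yi * (Yf * Rf i)) + ?hi * ?yi * (?hj * ?yj * (Yf * Rf j)))
       + ?hi * ?hj * 2 * qq * (fps_X + (I + J) * fps_X)"
    unfolding R theta_X by (simp add: algebra_simps I_def J_def)
  also have "\<dots> = ?hi * ?yi * ((J - 2 * fps_X * Sf j) - qq * J) + ?hj * ?yj * ((I - 2 * fps_X * Sf i) - qq * I)"
    unfolding T by (simp add: algebra_simps)
  also have "\<dots> = qq * theta (i + j) (?hi * ?yi * (Wf i j - fps_const (real j / (real i + real j)))
    + ?hj * ?yj * (Wf j i - fps_const (real i / (real i + real j))))"
    unfolding r S[symmetric] by (simp add: algebra_simps)
  finally show "qq * theta (i + j) (?hi * ?hj * (2 * ?yi * ?yj * (Rf i * Rf j) + 2 * fps_X)) +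
       of_nat 0 * fps_X * (?hi * ?hj * (2 * ?yi * ?yj * (Rf i * Rf j) + 2 * fps_X))
    = qq * theta (i + j) (?hi * ?yi * (Wf i j - fps_const (real j / (real i + real j)))
    + ?hj * ?yj * (Wf j i - fps_const (real i / (real i + real j)))) + of_nat 0 * fps_X * (?hi * ?yi * (Wf i j - fps_const (real j / (real i + real j)))
    + ?hj * ?yj * (Wf j i - fps_const (real i / (real i + real j))))" by simp
qed (use assms in auto)

section \<open>Series identities in genus 1\<close>

lemma qq_theta_Sf: "j > 0 \<Longrightarrow> qq * theta j (Sf j) = of_nat j - 2 * fps_X * Sf j"
  using theta_Sf[of j] by (simp add: algebra_simps)

lemma theta_qq: "theta j (qq * f) = qq * theta j f - 4 * (fps_X * f)"
  and theta_X_mult: "theta j (fps_X * f) = fps_X * theta j f + fps_X * f"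
  and theta_of_nat: "theta j (of_nat k) = of_nat j * of_nat k"
  and theta_numeral_mult: "theta j (numeral m * f) = numeral m * theta j f"
  and theta_of_nat_mult: "theta j (of_nat k * f) = of_nat k * theta j f"
  by (simp_all add: theta_def algebra_simps)

text \<open>Applying \<open>theta j\<close> to the first-order equation expresses the next
  derivative by lower ones; each derivative costs one more factor 1 - 4X. The powers of j arise
  because \<open>theta j\<close> multiplies constants by j.\<close>

lemma qq_theta2_Sf:
  assumes "j > 0"
  shows "qq ^ 2 * theta j (theta j (Sf j)) = 2 * fps_X * (of_nat j - 2 * fps_X * Sf j)
    + qq * (of_nat j ^ 2 - 2 * fps_X * Sf j)"
proof -
  let ?J = "of_nat j :: real fps"
  have "theta j (qq * theta j (Sf j)) = theta j (?J - 2 * (fps_X * Sf j))"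
    by (simp add: qq_theta_Sf[OF assms] mult.assoc)
  then have 1: "qq * theta j (theta j (Sf j)) = 2 * fps_X * theta j (Sf j) + ?J ^ 2 - 2 * fps_X * Sf j"
    by (simp add: theta_qq theta_X_mult theta_diff theta_numeral_mult theta_of_nat) (simp add: algebra_simps power2_eq_square)
  have "qq ^ 2 * theta j (theta j (Sf j)) = qq * (qq * theta j (theta j (Sf j)))"
    by (simp add: power2_eq_square mult.assoc)
  also have "\<dots> = 2 * fps_X * (qq * theta j (Sf j)) + qq * (?J ^ 2 - 2 * fps_X * Sf j)"
    unfolding 1 by (simp add: algebra_simps)
  finally show ?thesis unfolding qq_theta_Sf[OF assms] .
qed

lemma qq_theta3_Sf:
  assumes "j > 0"
  shows "qq ^ 3 * theta j (theta j (theta j (Sf j))) = 6 * fps_X * (qq ^ 2 * theta j (theta j (Sf j)))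
    + qq ^ 2 * (of_nat j ^ 3 - 2 * fps_X * Sf j)"
proof -
  let ?J = "of_nat j :: real fps"
  have "theta j (theta j (qq * theta j (Sf j))) = theta j (theta j (?J - 2 * (fps_X * Sf j)))"
    by (simp add: qq_theta_Sf[OF assms] mult.assoc)
  then have 1: "qq * theta j (theta j (theta j (Sf j))) = 6 * fps_X * theta j (theta j (Sf j)) + ?J ^ 3 - 2 * fps_X * Sf j"
    by (simp add: theta_qq theta_X_mult theta_diff theta_add theta_numeral_mult theta_of_nat theta_of_nat_mult) (simp add: algebra_simps power3_eq_cube)
  have "qq ^ 3 * theta j (theta j (theta j (Sf j))) = qq ^ 2 * (qq * theta j (theta j (theta j (Sf j))))"
    by (simp add: power2_eq_square power3_eq_cube mult.assoc)
  then show ?thesis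
    unfolding 1 by (simp add: algebra_simps)
qed

lemma qq_cancel: "qq ^ n * f = qq ^ n * g \<Longrightarrow> f = g"
  using qq_nz by simp

text \<open>Uf^2 is the inverse of 1 - 4X, so the cube clears even powers of \<open>Uf\<close> up to
  the sixth, the highest that occurs in the identities below.\<close>

lemma q_powers: "qq ^ 3 * (Uf ^ 2 * f) = qq ^ 2 * f" "qq ^ 3 * (Uf ^ 4 * f) = qq * f"
   "qq ^ 3 * (Uf ^ 6 * f) = f"
proof -
  have u: "qq * Uf ^ 2 = 1" using Uf_square by (simp add: power2_eq_square)
  have "qq ^ 3 * (Uf ^ 2 * f) = qq ^ 2 * (qq * Uf ^ 2) * f"
    by (simp only: power2_eq_square power3_eq_cube mult_ac)
  then show "qq ^ 3 * (Uf ^ 2 * f) = qq ^ 2 * f" unfolding u by simp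
  have "qq ^ 3 * (Uf ^ 4 * f) = qq * ((qq * Uf ^ 2) * (qq * Uf ^ 2)) * f"
    by (simp only: numeral_eq_Suc power_Suc pred_numeral_simps mult_ac arith_simps power_0 mult_1)
  then show "qq ^ 3 * (Uf ^ 4 * f) = qq * f" unfolding u by simp
  have "qq ^ 3 * (Uf ^ 6 * f) = (qq * Uf ^ 2) * ((qq * Uf ^ 2) * (qq * Uf ^ 2)) * f"
    by (simp only: numeral_eq_Suc power_Suc pred_numeral_simps mult_ac arith_simps power_0 mult_1)
  then show "qq ^ 3 * (Uf ^ 6 * f) = f" unfolding u by simp
qed

text \<open>On the coefficient of X^k the operator is multiplication by 4 n^3 - 6 n^2 + 2 n = 2n (2n
  - 1) (n - 1) with n = k + j, which turns \<open>cat n\<close> into \<open>nbinom n\<close> times n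
  - 1.\<close>

definition Vf :: "nat \<Rightarrow> real fps" where
  "Vf j = 4 * theta j (theta j (theta j (Sf j))) - 6 * theta j (theta j (Sf j)) + 2 * theta j (Sf j)"

text \<open>Here the multiplier is 2n (2n - 1) (i + 1 - n) with n = k + j, so that
  \<open>cat n\<close> becomes \<open>nbinom n\<close> times i + 1 - n.\<close>

definition V2f :: "nat \<Rightarrow> nat \<Rightarrow> real fps" where
  "V2f i j = (of_nat i + 1) * (4 * theta j (theta j (Sf j)) - 2 * theta j (Sf j))
     - 4 * theta j (theta j (theta j (Sf j))) + 2 * theta j (theta j (Sf j))"

definition Bf :: "real fps" where "Bf = Abs_fps nbinom"
definition Mf :: "real fps" where "Mf = Abs_fps (\<lambda>k. nbinom k * (real k - 1))"
text \<open>The series of the transitive cuts in genus 1: by \<open>Kf_eq\<close> its coefficient at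
  k > 0 is 6 / k times the convolution of \<open>nbinom\<close> with itself.\<close>

definition Kf :: "real fps" where "Kf = 12 * fps_X ^ 2 * Uf ^ 4"

lemma deriv_Uf: "fps_deriv Uf = 2 * Uf ^ 3"
proof (rule qq_cancel[of 1])
  have "qq * (2 * Uf ^ 3) = 2 * (qq * (Uf * Uf)) * Uf"
    by (simp only: power3_eq_cube mult_ac)
  then show "qq ^ 1 * fps_deriv Uf = qq ^ 1 * (2 * Uf ^ 3)"
    unfolding Uf_square using qq_deriv_Uf by simp
qed

lemma deriv_Uf_powers: "fps_deriv (Uf ^ 3) = 6 * Uf ^ 5" "fps_deriv (Uf ^ 4) = 8 * Uf ^ 6"
  by (simp_all add: numeral_eq_Suc deriv_Uf)

lemma Bf_eq: "Bf = 2 * fps_X * Uf ^ 3"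
proof -
  have "Bf = fps_X * fps_deriv Uf"
    by (rule fps_ext, case_tac n) (simp_all add: Bf_def Uf_def nbinom_def)
  then show ?thesis by (simp add: deriv_Uf mult_ac)
qed

lemma Mf_eq: "Mf = 12 * fps_X ^ 2 * Uf ^ 5"
proof -
  have "Mf = fps_X * fps_deriv Bf - Bf"
    by (rule fps_ext, case_tac n) (simp_all add: Bf_def Mf_def algebra_simps)
  also have "\<dots> = 12 * fps_X ^ 2 * Uf ^ 5"
    unfolding Bf_eq by (simp add: deriv_Uf_powers algebra_simps power2_eq_square flip: power_add)
  finally show ?thesis .
qed

lemma Kf_eq: "fps_X * fps_deriv Kf = 6 * (Bf * Bf)"
proof (rule qq_cancel[of 3])
  have 1: "fps_X * fps_deriv Kf = 24 * fps_X ^ 2 * Uf ^ 4 + 96 * fps_X ^ 3 * Uf ^ 6"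
    unfolding Kf_def by (simp add: deriv_Uf_powers algebra_simps power2_eq_square power3_eq_cube flip: power_add)
  have 2: "6 * (Bf * Bf) = 24 * fps_X ^ 2 * Uf ^ 6"
    unfolding Bf_eq by (simp add: algebra_simps power2_eq_square flip: power_add)
  have "qq ^ 3 * (fps_X * fps_deriv Kf) = qq ^ 3 * (Uf ^ 4 * (24 * fps_X ^ 2)) + qq ^ 3 * (Uf ^ 6 * (96 * fps_X ^ 3))"
    unfolding 1 by (simp only: distrib_left mult_ac)
  also have "\<dots> = 24 * fps_X ^ 2"
    unfolding q_powers by (simp add: algebra_simps power2_eq_square power3_eq_cube)
  also have "\<dots> = qq ^ 3 * (Uf ^ 6 * (24 * fps_X ^ 2))"
    unfolding q_powers ..
  finally show "qq ^ 3 * (fps_X * fps_deriv Kf) = qq ^ 3 * (6 * (Bf * Bf))"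
    unfolding 2 by (simp only: mult_ac)
qed

lemma Mf_rec: "Mf = Kf + 2 * (Cf * Mf)"
proof -
  have "Yf * Mf = 12 * fps_X ^ 2 * Uf ^ 4 * (Uf * Yf)"
    unfolding Mf_eq by (simp add: algebra_simps numeral_eq_Suc)
  then have "Yf * Mf = Kf" by (simp add: Kf_def Uf_Yf)
  then show ?thesis by (simp add: Yf_def algebra_simps)
qed

lemma Yf_Bf: "Yf * Bf = 2 * fps_X * Uf ^ 2"
proof -
  have "Yf * Bf = 2 * fps_X * Uf ^ 2 * (Uf * Yf)"
    unfolding Bf_eq by (simp only: power2_eq_square power3_eq_cube mult_ac)
  then show ?thesis by (simp add: Uf_Yf)
qed

lemma Yf_Mf: "Yf * Mf = 12 * fps_X ^ 2 * Uf ^ 4"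
  using Mf_rec unfolding Kf_def Yf_def by (simp add: algebra_simps)

text \<open>Inserting Uf Yf = 1 makes the exponent of \<open>Uf\<close> even and leaves
  \<open>Rf j\<close> only in the product \<open>Yf * Rf j\<close>, which \<open>Yf_Rf\<close>
  evaluates.\<close>

lemma Rf_Bf: "Rf j * Bf = 2 * fps_X * Uf ^ 4 * (Yf * Rf j)"
proof -
  have "Rf j * Bf = 2 * fps_X * Uf ^ 3 * Rf j * (Uf * Yf)"
    unfolding Uf_Yf Bf_eq by (simp add: mult_ac)
  then show ?thesis by (simp only: numeral_eq_Suc power_Suc pred_numeral_simps mult_ac arith_simps power_0 mult_1)
qed

lemma Rf_Mf: "Rf j * Mf = 12 * fps_X ^ 2 * Uf ^ 6 * (Yf * Rf j)"
proof -
  have "Rf j * Mf = 12 * fps_X ^ 2 * Uf ^ 5 * Rf j * (Uf * Yf)"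
    unfolding Uf_Yf Mf_eq by (simp add: mult_ac)
  then show ?thesis by (simp only: numeral_eq_Suc power_Suc pred_numeral_simps mult_ac arith_simps power_0 mult_1)
qed

lemma q3_simps:
  "qq ^ 3 * (Yf * Bf) = 2 * fps_X * qq ^ 2"
  "qq ^ 3 * (Yf * Mf) = 12 * fps_X ^ 2 * qq"
  "qq ^ 3 * Kf = 12 * fps_X ^ 2 * qq"
  "qq ^ 3 * (Rf j * Bf) = 2 * fps_X * qq * (Yf * Rf j)"
  "qq ^ 3 * (Rf j * Mf) = 12 * fps_X ^ 2 * (Yf * Rf j)"
proof -
  show "qq ^ 3 * (Yf * Bf) = 2 * fps_X * qq ^ 2"
    using q_powers(1)[of "2 * fps_X"] unfolding Yf_Bf by (simp only: mult_ac)
  show "qq ^ 3 * (Yf * Mf) = 12 * fps_X ^ 2 * qq" "qq ^ 3 * Kf = 12 * fps_X ^ 2 * qq"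
    using q_powers(2)[of "12 * fps_X ^ 2"] unfolding Yf_Mf Kf_def by (simp_all only: mult_ac)
  show "qq ^ 3 * (Rf j * Bf) = 2 * fps_X * qq * (Yf * Rf j)"
    using q_powers(2)[of "2 * fps_X * (Yf * Rf j)"] unfolding Rf_Bf by (simp only: mult_ac)
  show "qq ^ 3 * (Rf j * Mf) = 12 * fps_X ^ 2 * (Yf * Rf j)"
    using q_powers(3)[of "12 * fps_X ^ 2 * (Yf * Rf j)"] unfolding Rf_Mf by (simp only: mult_ac)
qed

lemma q3_derivs:
  assumes "j > 0"
  shows "qq ^ 3 * theta j (Sf j) = qq ^ 2 * (of_nat j - 2 * fps_X * Sf j)" (is ?D1)
   "qq ^ 3 * theta j (theta j (Sf j)) = qq * (2 * fps_X * (of_nat j - 2 * fps_X * Sf j)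
    + qq * (of_nat j ^ 2 - 2 * fps_X * Sf j))" (is ?D2)
   "qq ^ 3 * theta j (theta j (theta j (Sf j))) = 6 * fps_X * (2 * fps_X * (of_nat j - 2 * fps_X * Sf j)
    + qq * (of_nat j ^ 2 - 2 * fps_X * Sf j)) + qq ^ 2 * (of_nat j ^ 3 - 2 * fps_X * Sf j)" (is ?D3)
proof -
  have "qq ^ 3 * theta j (Sf j) = qq ^ 2 * (qq * theta j (Sf j))"
    by (simp only: power2_eq_square power3_eq_cube mult_ac)
  then show ?D1 unfolding qq_theta_Sf[OF assms] .
  have "qq ^ 3 * theta j (theta j (Sf j)) = qq * (qq ^ 2 * theta j (theta j (Sf j)))"
    by (simp only: power2_eq_square power3_eq_cube mult_ac)
  then show ?D2 unfolding qq_theta2_Sf[OF assms] .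
  show ?D3 unfolding qq_theta3_Sf[OF assms] qq_theta2_Sf[OF assms] ..
qed

text \<open>Multiplied by (1 - 4X)^3, everything becomes polynomial in X, j and \<open>Sf j\<close>:
  \<open>q3_simps\<close> removes \<open>Uf\<close>, \<open>Yf_Rf\<close> removes
  \<open>Rf j\<close> and \<open>q3_derivs\<close> removes the derivatives. The subtracted term is
  the constant coefficient of \<open>Vf j\<close>; all series on the left start in positive
  degree.\<close>

lemma Vf_eq:
  assumes "j > 0"
  defines "J \<equiv> of_nat j :: real fps"
  shows "(4 * J - 2) * (2 * J + 1) * (J * (Yf * Bf) - Yf * Mf + 2 * Kf + 2 * (Rf j * Mf))
     = Vf j - (4 * J - 2) * J * (J - 1)"
proof (rule qq_cancel[of 3])
  let ?h = "4 * J - 2" and ?y = "2 * J + 1" and ?S = "Sf j"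
  have T: "?h * ?y * (Yf * Rf j) = 2 * ?h * fps_X + 1 - ?S"
    using Yf_Rf[OF assms(1)] by (simp add: J_def)
  have "qq ^ 3 * (?h * ?y * (J * (Yf * Bf) - Yf * Mf + 2 * Kf + 2 * (Rf j * Mf)))
    = ?h * ?y * (J * (qq ^ 3 * (Yf * Bf)) - qq ^ 3 * (Yf * Mf) + 2 * (qq ^ 3 * Kf) + 2 * (qq ^ 3 * (Rf j * Mf)))"
  proof -
    have "q * (h * (J * a - b + 2 * k + 2 * r)) = h * (J * (q * a) - q * b + 2 * (q * k) + 2 * (q * r))"
      for q h a b k r :: "real fps"
      by (simp add: algebra_simps)
    then show ?thesis .
  qed
  also have "\<dots> = ?h * ?y * (J * (2 * fps_X * qq ^ 2) + 12 * fps_X ^ 2 * qq) + 24 * fps_X ^ 2 * (?h * ?y * (Yf * Rf j))"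
    unfolding q3_simps by (simp add: algebra_simps)
  finally have l: "qq ^ 3 * (?h * ?y * (J * (Yf * Bf) - Yf * Mf + 2 * Kf + 2 * (Rf j * Mf)))
     = ?h * ?y * (J * (2 * fps_X * qq ^ 2) + 12 * fps_X ^ 2 * qq) + 24 * fps_X ^ 2 * (2 * ?h * fps_X + 1 - ?S)"
    unfolding T .
  have "qq ^ 3 * (Vf j - ?h * J * (J - 1))
    = 4 * (qq ^ 3 * theta j (theta j (theta j ?S))) - 6 * (qq ^ 3 * theta j (theta j ?S)) + 2 * (qq ^ 3 * theta j ?S) - qq ^ 3 * (?h * J * (J - 1))"
    unfolding Vf_def by (simp only: distrib_left distrib_right right_diff_distrib left_diff_distrib mult_ac)
  then show "qq ^ 3 * (?h * ?y * (J * (Yf * Bf) - Yf * Mf + 2 * Kf + 2 * (Rf j * Mf))) = qq ^ 3 * (Vf j - ?h * J * (J - 1))"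
    unfolding l q3_derivs[OF assms(1)]
    by (simp add: J_def[symmetric]) (simp add: algebra_simps power2_eq_square power3_eq_cube)
qed

text \<open>The elimination of \<open>Vf_eq\<close> with two shifted series. The right-hand side
  collects the constant coefficients of \<open>V2f i j\<close> and \<open>V2f j i\<close>.\<close>

lemma V2f_eq:
  assumes "i > 0" "j > 0"
  defines "I \<equiv> of_nat i :: real fps" and "J \<equiv> of_nat j :: real fps"
  shows "(4 * I - 2) * (2 * I + 1) * V2f i j + (4 * J - 2) * (2 * J + 1) * V2f j i
     + 2 * (4 * I - 2) * (4 * J - 2) * (2 * I + 1) * (2 * J + 1) * (Kf - Rf j * (I * Bf - Mf) - Rf i * (J * Bf - Mf))
     = (4 * I - 2) * (4 * J - 2) * ((2 * I + 1) * (J * (I + 1 - J)) + (2 * J + 1) * (I * (J + 1 - I)))"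
proof (rule qq_cancel[of 3])
  let ?hi = "4 * I - 2" and ?hj = "4 * J - 2" and ?yi = "2 * I + 1" and ?yj = "2 * J + 1"
  have T: "?hi * ?yi * (Yf * Rf i) = 2 * ?hi * fps_X + 1 - Sf i"
          "?hj * ?yj * (Yf * Rf j) = 2 * ?hj * fps_X + 1 - Sf j"
    unfolding I_def J_def by (rule Yf_Rf[OF assms(1)], rule Yf_Rf[OF assms(2)])
  have V: "qq ^ 3 * V2f k l = (of_nat k + 1) * (4 * (qq ^ 3 * theta l (theta l (Sf l))) - 2 * (qq ^ 3 * theta l (Sf l)))
     - 4 * (qq ^ 3 * theta l (theta l (theta l (Sf l)))) + 2 * (qq ^ 3 * theta l (theta l (Sf l)))" for k l
    unfolding V2f_def by (simp only: distrib_left distrib_right right_diff_distrib left_diff_distrib mult_ac)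
  have "qq ^ 3 * (?hi * ?yi * V2f i j + ?hj * ?yj * V2f j i
     + 2 * ?hi * ?hj * ?yi * ?yj * (Kf - Rf j * (I * Bf - Mf) - Rf i * (J * Bf - Mf)))
    = ?hi * ?yi * (qq ^ 3 * V2f i j) + ?hj * ?yj * (qq ^ 3 * V2f j i)
     + 2 * ?hi * ?hj * ?yi * ?yj * (qq ^ 3 * Kf - I * (qq ^ 3 * (Rf j * Bf)) + qq ^ 3 * (Rf j * Mf)
         - J * (qq ^ 3 * (Rf i * Bf)) + qq ^ 3 * (Rf i * Mf))"
  proof -
    have "q * (a * v + b * w + h * (k - r * (I * c - m) - s * (J * c - m)))
      = a * (q * v) + b * (q * w) + h * (q * k - I * (q * (r * c)) + q * (r * m)
         - J * (q * (s * c)) + q * (s * m))"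
      for q a v b w h k r s c m :: "real fps"
      by (simp add: algebra_simps)
    then show ?thesis .
  qed
  also have "\<dots> = ?hi * ?yi * (qq ^ 3 * V2f i j) + ?hj * ?yj * (qq ^ 3 * V2f j i)
     + 2 * ?hi * ?hj * ?yi * ?yj * (12 * fps_X ^ 2 * qq)
     + 2 * (?hi * ?yi) * (12 * fps_X ^ 2 - I * 2 * fps_X * qq) * (?hj * ?yj * (Yf * Rf j))
     + 2 * (?hj * ?yj) * (12 * fps_X ^ 2 - J * 2 * fps_X * qq) * (?hi * ?yi * (Yf * Rf i))"
  proof -
    have g: "2 * h1 * h2 * y1 * y2 * (k - I * (a * b1) + c * b1 - J * (a * b2) + c * b2)
      = 2 * h1 * h2 * y1 * y2 * k + 2 * (h1 * y1) * (c - I * a) * (h2 * y2 * b1)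
        + 2 * (h2 * y2) * (c - J * a) * (h1 * y1 * b2)" for h1 h2 y1 y2 k a c b1 b2 :: "real fps"
      by (simp add: algebra_simps)
    show ?thesis unfolding q3_simps g by (simp only: mult.assoc add.assoc)
  qed
  finally show "qq ^ 3 * (?hi * ?yi * V2f i j + ?hj * ?yj * V2f j i
     + 2 * ?hi * ?hj * ?yi * ?yj * (Kf - Rf j * (I * Bf - Mf) - Rf i * (J * Bf - Mf)))
    = qq ^ 3 * (?hi * ?hj * (?yi * (J * (I + 1 - J)) + ?yj * (I * (J + 1 - I))))"
    unfolding T V q3_derivs[OF assms(1)] q3_derivs[OF assms(2)]
    unfolding I_def[symmetric] J_def[symmetric]
    by (simp add: algebra_simps power2_eq_square power3_eq_cube)
qed

section \<open>The series identities as identities between coefficients\<close>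

abbreviation (input) hh :: "nat \<Rightarrow> real" where "hh j \<equiv> 4 * real j - 2"
abbreviation (input) yy :: "nat \<Rightarrow> real" where "yy j \<equiv> 2 * real j + 1"

lemma fps_consts:
  "4 * of_nat j - 2 = fps_const (hh j)" "2 * of_nat j + 1 = fps_const (yy j)"
  "of_nat i + 1 = fps_const (real i + 1)"
  by (simp_all flip: fps_of_nat fps_const_add fps_const_sub fps_const_mult)
    (simp_all add: numeral_fps_const)

lemma hh_nz: "hh j \<noteq> 0"
  using odd_nonzero[of j] by simp

lemma attach_0 [simp]: "attach 0 j = 0"
  by (simp add: attach_def)

lemma nbinom_0 [simp]: "nbinom 0 = 0"
  by (simp add: nbinom_def)

lemma attach_nth: "attach k j = yy j * (Rf j $ k)"
  by (simp add: attach_def Rf_def)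

lemma Catalan_convolution:
  "k \<ge> 1 \<Longrightarrow> cat k = (if k = 1 then 1 else 0) + (\<Sum>i=0..k. cat i * cat (k - i))"
  using arg_cong[OF Cf_eq, of "\<lambda>f. f $ k"]
  unfolding fps_add_nth fps_mult_nth fps_X_nth Cf_def fps_nth_Abs_fps .

text \<open>Coefficient k of \<open>Yf_Rf\<close> with Yf = 1 - 2 Cf. It balances p_j in the genus 0
  recursion: the base case, the join with j, and the cuts, where j may lie in either part.\<close>

lemma linear_convolution:
  assumes "j \<ge> 1" "k \<ge> 1"
  shows "- attach k j = - 2 * (if k = 1 then 1 else 0) + cat (k + j) / cbinom j - 2 * (\<Sum>i=0..k. cat i * attach (k - i) j)"
proof -
  let ?d = "if k = 1 then 1 else 0 :: real"
  have "(fps_const (hh j) * (fps_const (yy j) * (Yf * Rf j))) $ k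
      = (2 * (fps_const (hh j) * fps_X) + 1 - Sf j) $ k"
    using arg_cong[OF Yf_Rf[of j], of "\<lambda>f. f $ k"] assms(1) unfolding fps_consts mult.assoc by simp
  then have 1: "hh j * (yy j * ((Yf * Rf j) $ k)) = 2 * (hh j * ?d) - hh j * (cat (k + j) / cbinom j)"
    unfolding fps_mult_left_const_nth fps_add_nth fps_sub_nth fps_numeral_mult_nth fps_X_nth
    using assms(2) by (simp add: Sf_def)
  have "Yf * Rf j = Rf j - 2 * (Cf * Rf j)"
    by (simp add: Yf_def algebra_simps)
  then have "(Yf * Rf j) $ k = Rf j $ k - 2 * ((Cf * Rf j) $ k)"
    by (simp only: fps_sub_nth fps_numeral_mult_nth)
  then have "yy j * ((Yf * Rf j) $ k) = attach k j - 2 * ((Cf * Rf j) $ k * yy j)"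
    unfolding attach_nth by (simp only: right_diff_distrib mult_ac)
  also have "(Cf * Rf j) $ k * yy j = (\<Sum>i=0..k. cat i * attach (k - i) j)"
    unfolding fps_mult_nth sum_distrib_right by (simp add: Cf_def attach_nth mult_ac)
  finally have "hh j * (attach k j - 2 * (\<Sum>i=0..k. cat i * attach (k - i) j)) = hh j * (2 * ?d - cat (k + j) / cbinom j)"
    using 1 by (simp only: right_diff_distrib mult_ac)
  then show ?thesis using hh_nz[of j] by (simp only: mult_cancel_left) simp
qed

text \<open>Coefficient k of \<open>Rf_Rf\<close>. The two terms with shifted index correspond to
  joining j first and to joining l first.\<close>

lemma quadratic_convolution:
  assumes "j \<ge> 1" "l \<ge> 1" "k \<ge> 1"
  shows "2 * (if k = 1 then 1 else 0) - attach (k + j) l / cbinom j - attach (k + l) j / cbinom l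
    + 2 * (\<Sum>i=0..k. attach i l * attach (k - i) j) = 0"
proof -
  have W: "hh i * (yy i * (Wf i m $ k)) = hh i * hh m * (attach (k + m) i / cbinom m)" for i m
    by (simp add: Wf_def Sf_def attach_def divide_inverse add_ac mult_ac)
  have R: "(\<Sum>i=0..k. attach i l * attach (k - i) j) = yy l * (yy j * (Rf l * Rf j) $ k)"
    unfolding fps_mult_nth sum_distrib_left by (simp add: attach_nth mult_ac)
  let ?d = "if k = 1 then 1 else 0 :: real"
  have "(fps_const (hh l) * (fps_const (hh j) * (2 * (fps_const (yy l) * (fps_const (yy j) * (Rf l * Rf j))) + 2 * fps_X))) $ k
    = (fps_const (hh l) * (fps_const (yy l) * (Wf l j - fps_const (real j / (real l + real j))))
    + fps_const (hh j) * (fps_const (yy j) * (Wf j l - fps_const (real l / (real l + real j))))) $ k"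
    using arg_cong[OF Rf_Rf[of l j], of "\<lambda>f. f $ k"] assms unfolding fps_consts mult.assoc by (simp add: add.commute)
  then have "hh l * (hh j * (2 * (\<Sum>i=0..k. attach i l * attach (k - i) j) + 2 * ?d))
    = hh l * (yy l * (Wf l j $ k)) + hh j * (yy j * (Wf j l $ k))"
    unfolding fps_mult_left_const_nth fps_add_nth fps_sub_nth fps_numeral_mult_nth fps_X_nth R
    using assms(3) by (simp only: fps_nth_fps_const) simp
  then have "hh l * hh j * (2 * ?d - attach (k + j) l / cbinom j - attach (k + l) j / cbinom l
    + 2 * (\<Sum>i=0..k. attach i l * attach (k - i) j)) = 0"
    unfolding W by (simp only: algebra_simps)
  then show ?thesis using hh_nz[of l] hh_nz[of j] by (simp only: mult_eq_0_iff) simp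
qed

definition KK :: "nat \<Rightarrow> real" where "KK k = Kf $ k"

lemma KK_eq: "real k * KK k = 6 * (\<Sum>i=0..k. nbinom i * nbinom (k - i))"
proof -
  have "(fps_X * fps_deriv Kf) $ k = real k * KK k"
    by (cases k) (simp_all add: KK_def)
  then show ?thesis
    unfolding Kf_eq fps_numeral_mult_nth unfolding fps_mult_nth Bf_def fps_nth_Abs_fps by (rule sym)
qed

lemma genus1_constant:
  "nbinom k * (real k - 1) = KK k + 2 * (\<Sum>i=0..k. cat i * (nbinom (k - i) * (real (k - i) - 1)))"
proof -
  have "Mf $ k = Kf $ k + 2 * (\<Sum>i=0..k. Cf $ i * Mf $ (k - i))"
    using arg_cong[OF Mf_rec, of "\<lambda>f. f $ k"] unfolding fps_add_nth fps_numeral_mult_nth unfolding fps_mult_nth .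
  then show ?thesis by (simp add: Mf_def KK_def Cf_def)
qed

text \<open>Coefficient k of \<open>Vf_eq\<close>, which balances p_j in genus 1: the join with j,
  the transitive cuts, whose -2 stems from (1 - \<eta>)^2, and the splitting cuts with j in the
  genus 1 part (\<open>cat\<close>) or in the genus 0 part (\<open>attach\<close>).\<close>

lemma genus1_linear:
  assumes "j \<ge> 1" "k \<ge> 1"
  shows "nbinom k * (real j - real k + 1) * yy j = nbinom (k + j) * (real (k + j) - 1) / cbinom j - 2 * yy j * KK k
    + 2 * (\<Sum>i=0..k. cat i * (nbinom (k - i) * (real j - real (k - i) + 1) * yy j) - attach i j * (nbinom (k - i) * (real (k - i) - 1)))"
proof -
  have V: "Vf j $ k = hh j * (nbinom (k + j) * (real (k + j) - 1) / cbinom j)"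
    unfolding Vf_def by (simp add: fps_numeral_mult_nth theta_nth Sf_def nbinom_cat) (simp add: divide_inverse algebra_simps power2_eq_square)
  have c: "fps_const (hh j) * of_nat j * (of_nat j - 1) = fps_const (hh j * real j * (real j - 1))"
    by (simp flip: fps_of_nat fps_const_mult fps_const_sub)
  have "(fps_const (hh j) * (fps_const (yy j) * (of_nat j * (Yf * Bf) - Yf * Mf + 2 * Kf + 2 * (Rf j * Mf)))) $ k
     = Vf j $ k"
    using arg_cong[OF Vf_eq[of j], of "\<lambda>f. f $ k"] assms unfolding fps_consts c unfolding mult.assoc by simp
  moreover have "of_nat j * (Yf * Bf) - Yf * Mf = (of_nat j * Bf - Mf) - 2 * (Cf * (of_nat j * Bf - Mf))"
    by (simp add: Yf_def algebra_simps)
  moreover have "(of_nat j * Bf - Mf) $ i = nbinom i * (real j - real i + 1)" for i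
    by (simp add: fps_mult_of_nat_nth Bf_def Mf_def algebra_simps)
  moreover have "(Cf * (of_nat j * Bf - Mf)) $ k = (\<Sum>i=0..k. cat i * (nbinom (k - i) * (real j - real (k - i) + 1)))"
    unfolding fps_mult_nth calculation(3) by (simp add: Cf_def)
  ultimately have "hh j * (yy j * (nbinom k * (real j - real k + 1) - 2 * (\<Sum>i=0..k. cat i * (nbinom (k - i) * (real j - real (k - i) + 1)))
      + 2 * KK k + 2 * ((Rf j * Mf) $ k))) = Vf j $ k"
    by (simp add: fps_numeral_mult_nth KK_def del: mult_cancel_left mult_cancel_left1 fps_const_mult fps_mult_nth)
  moreover have "yy j * ((Rf j * Mf) $ k) = (\<Sum>i=0..k. attach i j * (nbinom (k - i) * (real (k - i) - 1)))"
    by (simp add: fps_mult_nth attach_nth Mf_def sum_distrib_left mult_ac)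
  moreover have "yy j * (\<Sum>i=0..k. cat i * (nbinom (k - i) * (real j - real (k - i) + 1)))
     = (\<Sum>i=0..k. cat i * (nbinom (k - i) * (real j - real (k - i) + 1) * yy j))"
    by (simp add: sum_distrib_left mult_ac)
  ultimately show ?thesis
    using hh_nz[of j] unfolding V mult_cancel_left sum_subtractf
    by (simp only: distrib_left right_diff_distrib mult.left_commute[of "yy j" 2] mult_ac) simp
qed

text \<open>Coefficient k of \<open>V2f_eq\<close>. In \<open>f j l\<close> the element j is joined
  first or lies in the genus 0 factor, while l is marked in the genus 1 factor; both orders
  contribute to the same monomial.\<close>

lemma genus1_quadratic:
  fixes k :: nat
  assumes "j \<ge> 1" "l \<ge> 1" "k \<ge> 1"
  defines "f \<equiv> \<lambda>j l. nbinom (k + j) * (real l - real (k + j) + 1) * yy l / cbinom j + yy j * yy l * KK k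
     - 2 * (\<Sum>i=0..k. attach i j * (nbinom (k - i) * (real l - real (k - i) + 1) * yy l))"
  shows "f j l + f l j = 0"
proof -
  have V: "V2f l j $ k = hh j * (nbinom (k + j) * (real l - real (k + j) + 1) / cbinom j)" for j l
    unfolding V2f_def fps_consts
    by (simp add: fps_numeral_mult_nth theta_nth Sf_def nbinom_cat) (simp add: divide_inverse algebra_simps power2_eq_square)
  have c: "fps_const (hh l) * fps_const (hh j) * (fps_const (yy l) * (of_nat j * (fps_const (real l + 1) - of_nat j))
      + fps_const (yy j) * (of_nat l * (fps_const (real j + 1) - of_nat l)))
     = fps_const (hh l * hh j * (yy l * (real j * (real l + 1 - real j)) + yy j * (real l * (real j + 1 - real l))))"
    by (simp flip: fps_of_nat fps_const_mult fps_const_sub fps_const_add)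
  have nth: "(of_nat j * Bf - Mf) $ i = nbinom i * (real j - real i + 1)" for i j
    by (simp add: fps_mult_of_nat_nth Bf_def Mf_def algebra_simps)
  have R: "yy j * (yy l * ((Rf j * (of_nat l * Bf - Mf)) $ k)) = (\<Sum>i=0..k. attach i j * (nbinom (k - i) * (real l - real (k - i) + 1) * yy l))" for j l
    unfolding fps_mult_nth nth by (simp add: attach_nth sum_distrib_left mult_ac)
  have "(fps_const (hh l) * (fps_const (yy l) * V2f l j) + fps_const (hh j) * (fps_const (yy j) * V2f j l)
     + 2 * (fps_const (hh l) * (fps_const (hh j) * (fps_const (yy l) * (fps_const (yy j) *
       (Kf - Rf j * (of_nat l * Bf - Mf) - Rf l * (of_nat j * Bf - Mf))))))) $ k = 0"
    using arg_cong[OF V2f_eq[of l j], of "\<lambda>f. f $ k"] assms(1-3) unfolding fps_consts c unfolding mult.assoc by simp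
  then have e: "hh l * (yy l * (hh j * (nbinom (k + j) * (real l - real (k + j) + 1) / cbinom j)))
     + hh j * (yy j * (hh l * (nbinom (k + l) * (real j - real (k + l) + 1) / cbinom l)))
     + 2 * (hh l * (hh j * (yy l * (yy j * (KK k - (Rf j * (of_nat l * Bf - Mf)) $ k - (Rf l * (of_nat j * Bf - Mf)) $ k))))) = 0"
    unfolding fps_add_nth fps_numeral_mult_nth fps_mult_left_const_nth V fps_sub_nth KK_def .
  have g: "h * h' * ((w * y / c + y' * y * x - 2 * (y' * (y * r))) + (w' * y' / c' + y * y' * x - 2 * (y * (y' * r')))) = 0"
    if "h * (y * (h' * (w / c))) + h' * (y' * (h * (w' / c'))) + 2 * (h * (h' * (y * (y' * (x - r - r'))))) = 0"
    for h h' w y c y' x r w' c' r' :: real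
    using that by (simp add: algebra_simps)
  have "hh l * hh j * (f j l + f l j) = 0"
    using g[OF e] unfolding f_def R[symmetric] .
  then show ?thesis using hh_nz[of l] hh_nz[of j] by (simp only: mult_eq_0_iff) simp
qed

section \<open>Subset convolution\<close>

text \<open>Multiplication of multilinear generating functions, that is, in variables p_j of square
  zero; the value at S is the coefficient of the product of the p_j with j in S.\<close>

definition set_conv :: "('i set \<Rightarrow> real) \<Rightarrow> ('i set \<Rightarrow> real) \<Rightarrow> 'i set \<Rightarrow> real" where
  "set_conv f g S = (\<Sum>T\<in>Pow S. f T * g (S - T))"

text \<open>The Leibniz rule: inserting j is differentiation by p_j.\<close>

lemma set_conv_insert:
  assumes "finite S" "j \<notin> S"
  shows "set_conv f g (insert j S)
    = set_conv (\<lambda>T. f (insert j T)) g S + set_conv f (\<lambda>T. g (insert j T)) S"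
proof -
  have "set_conv f g (insert j S) = (\<Sum>T\<in>Pow S. f T * g (insert j S - T)) + (\<Sum>T\<in>insert j ` Pow S. f T * g (insert j S - T))"
    unfolding set_conv_def Pow_insert using assms by (intro sum.union_disjoint) auto
  also have "(\<Sum>T\<in>insert j ` Pow S. f T * g (insert j S - T)) = (\<Sum>T\<in>Pow S. f (insert j T) * g (S - T))"
    using assms by (subst sum.reindex) (auto simp: inj_on_def intro!: sum.cong arg_cong[where f=g], (blast+)?)
  also have "(\<Sum>T\<in>Pow S. f T * g (insert j S - T)) = (\<Sum>T\<in>Pow S. f T * g (insert j (S - T)))"
    using assms by (intro sum.cong refl arg_cong2[where f="(*)"] arg_cong[where f=g]) auto
  finally show ?thesis by (simp add: set_conv_def add.commute)
qed

lemma set_conv_commute: "set_conv f g S = set_conv g f S"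
  unfolding set_conv_def
  by (rule sum.reindex_bij_witness[of _ "\<lambda>T. S - T" "\<lambda>T. S - T"]) (auto simp: double_diff mult.commute)

lemma set_conv_empty [simp]: "set_conv f g {} = f {} * g {}"
  by (simp add: set_conv_def)

lemma set_conv_add_left: "set_conv (\<lambda>T. f T + f' T) g S = set_conv f g S + set_conv f' g S"
  and set_conv_diff_left: "set_conv (\<lambda>T. f T - f' T) g S = set_conv f g S - set_conv f' g S"
  and set_conv_scale_left: "set_conv (\<lambda>T. c * f T) g S = c * set_conv f g S"
  and set_conv_add_right: "set_conv g (\<lambda>T. f T + f' T) S = set_conv g f S + set_conv g f' S"
  and set_conv_scale_right: "set_conv g (\<lambda>T. c * f T) S = c * set_conv g f S"
  by (simp_all add: set_conv_def sum.distrib sum_subtractf sum_distrib_left algebra_simps)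

lemma set_conv_cong:
  "(\<And>T. T \<subseteq> S \<Longrightarrow> f T = f' T) \<Longrightarrow> (\<And>T. T \<subseteq> S \<Longrightarrow> g T = g' T) \<Longrightarrow> set_conv f g S = set_conv f' g' S"
  by (auto simp: set_conv_def intro!: sum.cong)

text \<open>The marked sum is the series \<Sum> p_j \<phi>_j, and p_j can be pulled out of the
  product.\<close>

lemma set_conv_marked:
  assumes "finite S"
  shows "set_conv (\<lambda>T. \<Sum>j\<in>T. \<phi> j (T - {j})) g S = (\<Sum>j\<in>S. set_conv (\<phi> j) g (S - {j}))"
proof -
  have "set_conv (\<lambda>T. \<Sum>j\<in>T. \<phi> j (T - {j})) g S = (\<Sum>T\<in>Pow S. \<Sum>j\<in>T. \<phi> j (T - {j}) * g (S - T))"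
    by (simp add: set_conv_def sum_distrib_right)
  also have "\<dots> = (\<Sum>(T, j)\<in>Sigma (Pow S) (\<lambda>T. T). \<phi> j (T - {j}) * g (S - T))"
    using assms by (subst sum.Sigma) (auto intro: finite_subset)
  also have "\<dots> = (\<Sum>(j, T)\<in>Sigma S (\<lambda>j. Pow (S - {j})). \<phi> j T * g (S - {j} - T))"
    by (rule sum.reindex_bij_witness[of _ "\<lambda>(j, T). (insert j T, j)" "\<lambda>(T, j). (j, T - {j})"])
      (auto simp: insert_absorb intro!: arg_cong2[where f="(*)"] arg_cong[where f=g])
  also have "\<dots> = (\<Sum>j\<in>S. set_conv (\<phi> j) g (S - {j}))"
    using assms by (subst sum.Sigma[symmetric]) (auto simp: set_conv_def)
  finally show ?thesis .
qed

lemma set_conv_marked_right: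
  assumes "finite S"
  shows "set_conv g (\<lambda>T. \<Sum>j\<in>T. \<phi> j (T - {j})) S = (\<Sum>j\<in>S. set_conv g (\<phi> j) (S - {j}))"
  using set_conv_marked[OF assms, of \<phi> g] by (simp add: set_conv_commute[of g])

section \<open>Elementary symmetric polynomials over a finite set\<close>

definition esym :: "('i \<Rightarrow> real) \<Rightarrow> nat \<Rightarrow> 'i set \<Rightarrow> real" where
  "esym y m S = (\<Sum>T | T \<subseteq> S \<and> card T = m. prod y T)"

lemma esym_0: "finite S \<Longrightarrow> esym y 0 S = 1"
proof -
  assume "finite S"
  then have "T \<subseteq> S \<and> card T = 0 \<longleftrightarrow> T = {}" for T
    by (metis card.empty card_0_eq empty_subsetI finite_subset)
  then have *: "{T. T \<subseteq> S \<and> card T = 0} = {{}}"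
    by (simp only: set_eq_iff mem_Collect_eq singleton_iff) simp
  show ?thesis unfolding esym_def * by simp
qed

lemma esym_eq_0: "finite S \<Longrightarrow> m > card S \<Longrightarrow> esym y m S = 0"
proof -
  assume "finite S" "m > card S"
  then have "\<not> (T \<subseteq> S \<and> card T = m)" for T
    using card_mono[of S T] by linarith
  then have *: "{T. T \<subseteq> S \<and> card T = m} = {}"
    by (simp only: set_eq_iff mem_Collect_eq empty_iff) simp
  show ?thesis unfolding esym_def * by simp
qed

lemma esym_insert:
  assumes "finite S" "x \<notin> S"
  shows "esym y (Suc m) (insert x S) = esym y (Suc m) S + y x * esym y m S"
proof -
  have *: "{T. T \<subseteq> insert x S \<and> card T = Suc m}
     = {T. T \<subseteq> S \<and> card T = Suc m} \<union> insert x ` {T. T \<subseteq> S \<and> card T = m}" (is "?L = ?R")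
  proof
    show "?L \<subseteq> ?R"
    proof
      fix T assume T: "T \<in> ?L"
      show "T \<in> ?R"
      proof (cases "x \<in> T")
        case True
        then have "T = insert x (T - {x})" "T - {x} \<subseteq> S" "card (T - {x}) = m"
          using T assms by (auto simp: card_Diff_singleton)
        then show ?thesis by blast
      next
        case False then show ?thesis using T by auto
      qed
    qed
    show "?R \<subseteq> ?L"
    proof
      fix T assume "T \<in> ?R"
      moreover have "card (insert x U) = Suc (card U)" if "U \<subseteq> S" for U
        using assms that by (metis card_insert_disjoint finite_subset subsetD)
      ultimately show "T \<in> ?L" by auto
    qed
  qed
  have f: "finite {T. T \<subseteq> S \<and> P T}" for P
    by (rule finite_subset[of _ "Pow S"]) (use assms(1) in auto)
  have "esym y (Suc m) (insert x S) = esym y (Suc m) S + (\<Sum>T\<in>insert x ` {T. T \<subseteq> S \<and> card T = m}. prod y T)"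
    unfolding esym_def * using assms f by (intro sum.union_disjoint) auto
  also have "(\<Sum>T\<in>insert x ` {T. T \<subseteq> S \<and> card T = m}. prod y T)
      = (\<Sum>T | T \<subseteq> S \<and> card T = m. prod y (insert x T))"
    using assms(2) by (subst sum.reindex) (auto simp: inj_on_def)
  also have "\<dots> = (\<Sum>T | T \<subseteq> S \<and> card T = m. y x * prod y T)"
  proof (rule sum.cong[OF refl])
    fix T assume "T \<in> {T. T \<subseteq> S \<and> card T = m}"
    then have "finite T" "x \<notin> T" using assms finite_subset by auto
    then show "prod y (insert x T) = y x * prod y T" by (rule prod.insert)
  qed
  finally show ?thesis by (simp add: esym_def sum_distrib_left)
qed

lemma esym_remove:
  assumes "finite S" "x \<in> S"
  shows "esym y (Suc m) S = esym y (Suc m) (S - {x}) + y x * esym y m (S - {x})"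
  using esym_insert[of "S - {x}" x y m] assms by (simp only: finite_Diff insert_Diff) simp

text \<open>Each subset with m + 1 elements arises once for every choice of one of its
  elements.\<close>

lemma sum_esym_remove:
  assumes "finite S"
  shows "(\<Sum>j\<in>S. y j * esym y m (S - {j})) = real (Suc m) * esym y (Suc m) S"
  using assms
proof (induction S arbitrary: m rule: finite_induct)
  case empty
  then show ?case by (simp add: esym_eq_0)
next
  case (insert x S)
  have d: "insert x S - {j} = insert x (S - {j})" if "j \<in> S" for j
    using that insert by auto
  have "(\<Sum>j\<in>insert x S. y j * esym y m (insert x S - {j}))
      = y x * esym y m S + (\<Sum>j\<in>S. y j * esym y m (insert x (S - {j})))"
    using insert by (simp add: d)
  also have "\<dots> = real (Suc m) * esym y (Suc m) (insert x S)"
  proof (cases m)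
    case 0
    have "(\<Sum>j\<in>S. y j * esym y m (insert x (S - {j}))) = (\<Sum>j\<in>S. y j * esym y 0 (S - {j}))"
      unfolding 0 using insert.hyps by (intro sum.cong) (simp_all add: esym_0)
    then show ?thesis unfolding insert.IH 0 using insert.hyps
      by (simp add: esym_insert esym_0)
  next
    case (Suc l)
    have "(\<Sum>j\<in>S. y j * esym y m (insert x (S - {j})))
       = (\<Sum>j\<in>S. y j * esym y (Suc l) (S - {j}) + y x * (y j * esym y l (S - {j})))"
      unfolding Suc using insert.hyps
      by (intro sum.cong refl) (simp add: esym_insert algebra_simps)
    also have "\<dots> = real (Suc (Suc l)) * esym y (Suc (Suc l)) S + y x * (real (Suc l) * esym y (Suc l) S)"
      unfolding sum.distrib sum_distrib_left[symmetric] insert.IH ..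
    finally show ?thesis unfolding Suc esym_insert[OF insert.hyps]
      by (simp add: algebra_simps)
  qed
  finally show ?case .
qed

lemma esym_1: "finite S \<Longrightarrow> esym y (Suc 0) S = sum y S"
  using sum_esym_remove[of S y 0] by (simp add: esym_0)

text \<open>One factor y_j is absorbed by \<open>esym_remove\<close>, which writes y_j e_m(S - j) as
  e_(m+1)(S) - e_(m+1)(S - j); the remaining sums are linear in y_j.\<close>

lemma sum_sq_esym_remove:
  assumes "finite S"
  shows "(\<Sum>j\<in>S. y j * (y j * esym y m (S - {j})))
    = sum y S * esym y (Suc m) S - real (m + 2) * esym y (m + 2) S"
proof -
  have "(\<Sum>j\<in>S. y j * (y j * esym y m (S - {j}))) = (\<Sum>j\<in>S. y j * (esym y (Suc m) S - esym y (Suc m) (S - {j})))"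
  proof (intro sum.cong refl arg_cong2[where f="(*)"])
    fix j assume "j \<in> S"
    from esym_remove[OF assms this, of y m]
    show "y j * esym y m (S - {j}) = esym y (Suc m) S - esym y (Suc m) (S - {j})" by linarith
  qed
  also have "\<dots> = sum y S * esym y (Suc m) S - (\<Sum>j\<in>S. y j * esym y (Suc m) (S - {j}))"
    by (simp add: sum_subtractf right_diff_distrib sum_distrib_right)
  finally show ?thesis using sum_esym_remove[OF assms, of y "Suc m"] by simp
qed

section \<open>Lagrange coefficients as set functions\<close>

context
  fixes a :: "'i \<Rightarrow> nat"
begin

definition wt :: "'i \<Rightarrow> real" where "wt j = 2 * real (a j) + 1"
definition total :: "'i set \<Rightarrow> real" where "total S = (\<Sum>j\<in>S. real (a j))"
text \<open>Let \<open>s\<close> solve \<open>s = z (1 - \<gamma>)\<^sup>-\<^sup>2\<close>, where \<open>\<gamma> = (\<Sum>j. p\<^sub>j s^a j)\<close>, and let \<open>\<eta> = (\<Sum>j. wt j p\<^sub>j s^a j)\<close>. Then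
  \<open>Fs x\<close>, \<open>Vs x\<close> and \<open>Ws x\<close> are the coefficients, multilinear in the \<open>p\<^sub>j\<close>, of \<open>s^(x/2)\<close>,
  \<open>s^(x/2) / (1 - \<eta>)\<close> and \<open>s^(x/2) / (1 - \<eta>)\<^sup>2\<close>, obtained by Lagrange inversion.\<close>

definition Fs :: "real \<Rightarrow> 'i set \<Rightarrow> real" where
  "Fs x S = (if S = {} then 1 else x * pochhammer (x + 2 * total S + 1) (card S - 1))"
definition Vs :: "real \<Rightarrow> 'i set \<Rightarrow> real" where
  "Vs x S = pochhammer (x + 2 * total S + 1) (card S)"
definition Ws :: "real \<Rightarrow> 'i set \<Rightarrow> real" where
  "Ws x S = (\<Sum>m\<le>card S. fact m * esym wt m S * pochhammer (x + 2 * total S + 1) (card S - m))"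

lemma total_insert: "finite S \<Longrightarrow> j \<notin> S \<Longrightarrow> total (insert j S) = real (a j) + total S"
  by (simp add: total_def)

lemma total_remove: "finite S \<Longrightarrow> j \<in> S \<Longrightarrow> total S = real (a j) + total (S - {j})"
  by (simp add: total_def sum.remove)

lemma sum_wt: "sum wt S = 2 * total S + real (card S)"
  by (simp add: wt_def total_def sum.distrib sum_distrib_left)

lemma total_remove_arg: "finite S \<Longrightarrow> j \<in> S \<Longrightarrow> x + 2 * real (a j) + 2 * total (S - {j}) + 1 = x + 2 * total S + 1"
  using total_remove[of S j] by simp

text \<open>Implicit differentiation of s = z (1 - \<gamma>)^(-2) gives 2 s^(a j) / (1 - \<eta>) as
  the logarithmic derivative of s by p_j.\<close>

lemma Fs_insert: "finite S \<Longrightarrow> j \<notin> S \<Longrightarrow> Fs x (insert j S) = x * Vs (x + 2 * real (a j)) S"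
  by (simp add: Fs_def Vs_def total_insert algebra_simps)

text \<open>The identity 1 / (1 - \<eta>) = 1 + \<eta> / (1 - \<eta>) in coefficients. Removing j
  while raising x by 2 a_j leaves the base of the rising product unchanged, so only the weights have
  to be summed.\<close>

lemma Vs_rec:
  assumes "finite S"
  shows "Vs x S = Fs x S + (\<Sum>j\<in>S. wt j * Vs (x + 2 * real (a j)) (S - {j}))"
proof (cases "S = {}")
  case True
  then show ?thesis by (simp add: Vs_def Fs_def)
next
  case False
  then obtain n where n: "card S = Suc n" using assms by (metis card_eq_0_iff not0_implies_Suc)
  have "(\<Sum>j\<in>S. wt j * Vs (x + 2 * real (a j)) (S - {j})) = (\<Sum>j\<in>S. wt j * pochhammer (x + 2 * total S + 1) n)"
    using assms n by (intro sum.cong) (simp_all add: Vs_def total_remove_arg card_Diff_singleton)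
  also have "\<dots> = (2 * total S + real (Suc n)) * pochhammer (x + 2 * total S + 1) n"
    by (simp add: sum_distrib_right[symmetric] sum_wt n)
  finally show ?thesis
    using False by (simp add: Vs_def Fs_def n pochhammer_Suc algebra_simps)
qed

text \<open>The identity 1 / (1 - \<eta>)^2 = 1 / (1 - \<eta>) + \<eta> / (1 - \<eta>)^2. Its
  iteration explains the factorials in \<open>Ws\<close>: \<eta>^m marks m elements in m!
  orders.\<close>

lemma Ws_rec:
  assumes "finite S"
  shows "Ws x S = Vs x S + (\<Sum>j\<in>S. wt j * Ws (x + 2 * real (a j)) (S - {j}))"
proof (cases "S = {}")
  case True
  then show ?thesis by (simp add: Vs_def Ws_def esym_0)
next
  case False
  then obtain n where n: "card S = Suc n" using assms by (metis card_eq_0_iff not0_implies_Suc)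
  let ?P = "pochhammer (x + 2 * total S + 1)"
  have r: "Ws (x + 2 * real (a j)) (S - {j}) = (\<Sum>m\<le>n. fact m * esym wt m (S - {j}) * ?P (n - m))"
    if "j \<in> S" for j
    using assms that by (simp only: Ws_def total_remove_arg card_Diff_singleton n diff_Suc_1)
  have "(\<Sum>j\<in>S. wt j * Ws (x + 2 * real (a j)) (S - {j}))
      = (\<Sum>j\<in>S. \<Sum>m\<le>n. fact m * ?P (n - m) * (wt j * esym wt m (S - {j})))"
    by (intro sum.cong refl, subst r, assumption) (simp add: sum_distrib_left mult_ac)
  also have "\<dots> = (\<Sum>m\<le>n. fact m * ?P (n - m) * (\<Sum>j\<in>S. wt j * esym wt m (S - {j})))"
    by (subst sum.swap) (simp add: sum_distrib_left)
  also have "\<dots> = (\<Sum>m\<le>n. fact (Suc m) * esym wt (Suc m) S * ?P (n - m))"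
    unfolding sum_esym_remove[OF assms] by (intro sum.cong) (simp_all add: mult_ac)
  finally show ?thesis
    using assms unfolding Ws_def n sum.atMost_Suc_shift by (simp add: Vs_def n esym_0)
qed

text \<open>Adding an element to the set differentiates \<open>Fs x\<close> into a multiple of \<open>Vs\<close>, and \<open>Vs\<close> is a sum of
  \<open>Fs\<close> and of \<open>Vs\<close> on smaller sets; this makes a simultaneous induction work.\<close>

lemma set_conv_Fs_Vs:
  assumes "finite S"
  shows "\<forall>x y. set_conv (Fs x) (Fs y) S = Fs (x + y) S \<and> set_conv (Vs x) (Fs y) S = Vs (x + y) S"
  using assms
proof (induction S rule: finite_psubset_induct)
  case (psubset S)
  have F: "set_conv (Fs x) (Fs y) S = Fs (x + y) S" for x y
  proof (cases "S = {}")
    case True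
    then show ?thesis by (simp add: Fs_def)
  next
    case False
    then obtain j S' where S: "S = insert j S'" "j \<notin> S'" by (metis Set.set_insert equals0I)
    then have fin: "finite S'" using psubset by simp
    have IH: "set_conv (Vs x) (Fs y) S' = Vs (x + y) S'" for x y
      using psubset.IH[of S'] S by auto
    have 1: "set_conv (\<lambda>T. Fs x (insert j T)) g S' = x * set_conv (Vs (x + 2 * real (a j))) g S'" for x g
      unfolding set_conv_scale_left[symmetric]
      using S fin by (intro set_conv_cong) (auto intro!: Fs_insert dest: finite_subset)
    have "set_conv (Fs x) (Fs y) S = x * Vs (x + y + 2 * real (a j)) S' + y * Vs (x + y + 2 * real (a j)) S'"
      unfolding S(1) set_conv_insert[OF fin S(2)] 1 set_conv_commute[of "Fs x"] IH by (simp add: add_ac)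
    also have "\<dots> = Fs (x + y) S"
      unfolding S(1) Fs_insert[OF fin S(2)] by (simp add: algebra_simps)
    finally show ?thesis .
  qed
  have "set_conv (Vs x) (Fs y) S = Vs (x + y) S" for x y
  proof -
    have "set_conv (Vs x) (Fs y) S = set_conv (\<lambda>T. Fs x T + (\<Sum>j\<in>T. wt j * Vs (x + 2 * real (a j)) (T - {j}))) (Fs y) S"
      using psubset.hyps by (intro set_conv_cong Vs_rec) (auto dest: finite_subset)
    also have "\<dots> = Fs (x + y) S + (\<Sum>j\<in>S. wt j * set_conv (Vs (x + 2 * real (a j))) (Fs y) (S - {j}))"
      unfolding set_conv_add_left F
      by (subst set_conv_marked[OF psubset.hyps, where \<phi>="\<lambda>j T. wt j * Vs (x + 2 * real (a j)) T"])
         (simp add: set_conv_scale_left)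
    also have "(\<Sum>j\<in>S. wt j * set_conv (Vs (x + 2 * real (a j))) (Fs y) (S - {j}))
       = (\<Sum>j\<in>S. wt j * Vs (x + y + 2 * real (a j)) (S - {j}))"
    proof (intro sum.cong refl arg_cong2[where f="(*)"])
      fix j assume "j \<in> S"
      then have "S - {j} \<subset> S" by auto
      from psubset.IH[OF this]
      have "set_conv (Vs (x + 2 * real (a j))) (Fs y) (S - {j}) = Vs (x + 2 * real (a j) + y) (S - {j})" by blast
      then show "set_conv (Vs (x + 2 * real (a j))) (Fs y) (S - {j}) = Vs (x + y + 2 * real (a j)) (S - {j})"
        by (simp only: add_ac)
    qed
    finally show ?thesis unfolding Vs_rec[OF psubset.hyps, of "x + y"] .
  qed
  with F show ?case by blast
qed

lemma set_conv_Fs_Fs: "finite S \<Longrightarrow> set_conv (Fs x) (Fs y) S = Fs (x + y) S"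
  and set_conv_Vs_Fs: "finite S \<Longrightarrow> set_conv (Vs x) (Fs y) S = Vs (x + y) S"
  using set_conv_Fs_Vs by blast+

text \<open>Now \<open>Ws_rec\<close> alone drives the induction, because its inhomogeneous term
  \<open>Vs\<close> is already covered.\<close>

lemma set_conv_Ws_Fs: "finite S \<Longrightarrow> set_conv (Ws x) (Fs y) S = Ws (x + y) S"
proof (induction S arbitrary: x rule: finite_psubset_induct)
  case (psubset S)
  have "set_conv (Ws x) (Fs y) S = set_conv (\<lambda>T. Vs x T + (\<Sum>j\<in>T. wt j * Ws (x + 2 * real (a j)) (T - {j}))) (Fs y) S"
    using psubset.hyps by (intro set_conv_cong Ws_rec) (auto dest: finite_subset)
  also have "\<dots> = Vs (x + y) S + (\<Sum>j\<in>S. wt j * set_conv (Ws (x + 2 * real (a j))) (Fs y) (S - {j}))"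
    unfolding set_conv_add_left set_conv_Vs_Fs[OF psubset.hyps]
    by (subst set_conv_marked[OF psubset.hyps, where \<phi>="\<lambda>j T. wt j * Ws (x + 2 * real (a j)) T"])
       (simp add: set_conv_scale_left)
  also have "(\<Sum>j\<in>S. wt j * set_conv (Ws (x + 2 * real (a j))) (Fs y) (S - {j}))
     = (\<Sum>j\<in>S. wt j * Ws (x + y + 2 * real (a j)) (S - {j}))"
  proof (intro sum.cong refl arg_cong2[where f="(*)"])
    fix j assume "j \<in> S"
    then have "S - {j} \<subset> S" by auto
    from psubset.IH[OF this, of "x + 2 * real (a j)"]
    show "set_conv (Ws (x + 2 * real (a j))) (Fs y) (S - {j}) = Ws (x + y + 2 * real (a j)) (S - {j})"
      by (simp only: add_ac)
  qed
  finally show ?case unfolding Ws_rec[OF psubset.hyps, of "x + y"] .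
qed

lemma set_conv_Fs_Ws: "finite S \<Longrightarrow> set_conv (Fs x) (Ws y) S = Ws (x + y) S"
  using set_conv_Ws_Fs[of S y x] by (simp add: set_conv_commute[of "Fs x"] add.commute)

text \<open>This is multiplication by 1 - \<gamma>, which equals (z/s)^(1/2) and therefore lowers x
  by one.\<close>

lemma Fs_shift:
  assumes "finite S"
  shows "Fs x S - (\<Sum>j\<in>S. Fs (x + 2 * real (a j)) (S - {j})) = Fs (x - 1) S"
proof (cases "S = {}")
  case True
  then show ?thesis by (simp add: Fs_def)
next
  case False
  then obtain n where n: "card S = Suc n" using assms by (metis card_eq_0_iff not0_implies_Suc)
  \<comment> \<open>Singletons are separate because removing their element leads to the exceptional
    value of \<open>Fs\<close> at the empty set.\<close>
  show ?thesis
  proof (cases n)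
    case 0
    then obtain i where "S = {i}" using n by (metis One_nat_def card_1_singletonE)
    then show ?thesis by (simp add: Fs_def)
  next
    case (Suc l)
    let ?Z = "x + 2 * total S + 1"
    have ne: "S - {j} \<noteq> {}" for j
    proof
      assume "S - {j} = {}"
      then have "S \<subseteq> {j}" by auto
      then have "card S \<le> 1" using card_mono[of "{j}" S] by simp
      then show False using n Suc by simp
    qed
    have r: "Fs (x + 2 * real (a j)) (S - {j}) = (x + 2 * real (a j)) * pochhammer ?Z l" if "j \<in> S" for j
      using assms that ne[of j]
      by (simp only: Fs_def if_False total_remove_arg card_Diff_singleton n Suc diff_Suc_1)
    have "(\<Sum>j\<in>S. Fs (x + 2 * real (a j)) (S - {j})) = (\<Sum>j\<in>S. (x + 2 * real (a j)) * pochhammer ?Z l)"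
      by (intro sum.cong refl r)
    also have "\<dots> = (real (Suc n) * x + 2 * total S) * pochhammer ?Z l"
      by (simp only: sum_distrib_right[symmetric]) (simp add: sum.distrib total_def sum_distrib_left n)
    finally have 1: "(\<Sum>j\<in>S. Fs (x + 2 * real (a j)) (S - {j})) = (real (Suc n) * x + 2 * total S) * pochhammer ?Z l" .
    have 2: "Fs x S = x * (pochhammer ?Z l * (?Z + real l))"
      using False n Suc by (simp add: Fs_def pochhammer_Suc)
    have 3: "Fs (x - 1) S = (x - 1) * ((x + 2 * total S) * pochhammer ?Z l)"
      using False n Suc by (simp add: Fs_def pochhammer_rec)
    show ?thesis
      unfolding 1 2 3 Suc by (simp add: algebra_simps)
  qed
qed

lemma Fs_zero: "Fs 0 S = (if S = {} then 1 else 0)"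
  by (simp add: Fs_def)

end

section \<open>The closed formulas and their recursions\<close>

context
  fixes a :: "'i \<Rightarrow> nat"
begin

text \<open>\<open>N0 k S\<close> and \<open>N1 k S\<close> are the claimed numbers of factorizations in genus 0 and 1 of a permutation
  with cycle lengths \<open>k\<close> and \<open>a j\<close> for \<open>j \<in> S\<close>, divided by the product of the \<open>nbinom (a j)\<close>.\<close>

definition N0 :: "nat \<Rightarrow> 'i set \<Rightarrow> real" where
  "N0 k S = nbinom k * pochhammer (2 * (real k + total a S) - 1) (card S)
     / ((2 * (real k + total a S)) * (2 * (real k + total a S) - 1))"

definition N1 :: "nat \<Rightarrow> 'i set \<Rightarrow> real" where
  "N1 k S = nbinom k / 12 * ((real k - 1) * Vs a (2 * real k) S
     + (\<Sum>j\<in>S. real (a j) * yy (a j) * Ws a (2 * real k + 2 * real (a j)) (S - {j})))"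

lemma set_conv_Fs_affine:
  assumes fin: "finite S"
    and G: "\<And>x y S. finite S \<Longrightarrow> set_conv (Fs a x) (G y) S = G (x + y) S"
  shows "set_conv (Fs a x) (\<lambda>T. q0 * G y T + (\<Sum>j\<in>T. q1 j * G (y + 2 * real (a j)) (T - {j}))) S
    = q0 * G (x + y) S + (\<Sum>j\<in>S. q1 j * G (x + y + 2 * real (a j)) (S - {j}))"
  unfolding set_conv_add_right set_conv_scale_right G[OF fin]
  by (subst set_conv_marked_right[OF fin, where \<phi>="\<lambda>j T. q1 j * G (y + 2 * real (a j)) T"])
     (simp add: set_conv_scale_right G fin add.assoc)

text \<open>A product of two polynomials of degree one in the p_j s^(a j), where \<open>G\<close> is
  \<open>Fs\<close> in genus 0 and \<open>Ws\<close> in genus 1; what matters about \<open>G\<close>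
  is that multiplication by \<open>Fs\<close> adds exponents. In the double sum i comes from the
  first factor and j from the second.\<close>

lemma set_conv_affine:
  assumes fin: "finite S"
    and G: "\<And>x y S. finite S \<Longrightarrow> set_conv (Fs a x) (G y) S = G (x + y) S"
    and z: "x + y = z"
  shows "set_conv (\<lambda>T. p0 * Fs a x T - (\<Sum>j\<in>T. p1 j * Fs a (x + 2 * real (a j)) (T - {j})))
      (\<lambda>T. q0 * G y T + (\<Sum>j\<in>T. q1 j * G (y + 2 * real (a j)) (T - {j}))) S
    = p0 * q0 * G z S + (\<Sum>j\<in>S. (p0 * q1 j - p1 j * q0) * G (z + 2 * real (a j)) (S - {j}))
      - (\<Sum>i\<in>S. \<Sum>j\<in>S - {i}. p1 i * q1 j * G (z + 2 * real (a i) + 2 * real (a j)) (S - {i} - {j}))"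
proof -
  let ?g = "\<lambda>T. q0 * G y T + (\<Sum>j\<in>T. q1 j * G (y + 2 * real (a j)) (T - {j}))"
  note A = set_conv_Fs_affine[where G=G, OF _ G]
  have zj: "x + 2 * real (a j) + y = z + 2 * real (a j)" for j using z by simp
  have "set_conv (\<lambda>T. \<Sum>j\<in>T. p1 j * Fs a (x + 2 * real (a j)) (T - {j})) ?g S
     = (\<Sum>j\<in>S. p1 j * set_conv (Fs a (x + 2 * real (a j))) ?g (S - {j}))"
    by (subst set_conv_marked[OF fin, where \<phi>="\<lambda>j T. p1 j * Fs a (x + 2 * real (a j)) T"])
       (simp only: set_conv_scale_left)
  also have "\<dots> = (\<Sum>i\<in>S. p1 i * q0 * G (z + 2 * real (a i)) (S - {i})
      + (\<Sum>j\<in>S - {i}. p1 i * q1 j * G (z + 2 * real (a i) + 2 * real (a j)) (S - {i} - {j})))"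
    using fin by (intro sum.cong refl) (simp add: A zj distrib_left sum_distrib_left mult.assoc)
  finally have 1: "set_conv (\<lambda>T. \<Sum>j\<in>T. p1 j * Fs a (x + 2 * real (a j)) (T - {j})) ?g S
     = (\<Sum>j\<in>S. p1 j * q0 * G (z + 2 * real (a j)) (S - {j}))
      + (\<Sum>i\<in>S. \<Sum>j\<in>S - {i}. p1 i * q1 j * G (z + 2 * real (a i) + 2 * real (a j)) (S - {i} - {j}))"
    by (simp only: sum.distrib)
  have 2: "p0 * (\<Sum>j\<in>S. q1 j * G (z + 2 * real (a j)) (S - {j}))
      = (\<Sum>j\<in>S. p0 * q1 j * G (z + 2 * real (a j)) (S - {j}))"
    by (simp add: sum_distrib_left mult.assoc)
  have 3: "set_conv (Fs a x) ?g S = q0 * G (x + y) S + (\<Sum>j\<in>S. q1 j * G (x + y + 2 * real (a j)) (S - {j}))"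
    by (rule set_conv_Fs_affine[OF fin G])
  show ?thesis
    unfolding set_conv_diff_left set_conv_scale_left 1 3 z left_diff_distrib sum_subtractf distrib_left 2
    by (simp add: mult.assoc)
qed

text \<open>Exchanging the indices negates the sum. It is applied with \<open>g\<close> the
  coefficient that remains once i and j are removed, which does not depend on their order.\<close>

lemma double_sum_antisym:
  fixes c g :: "'i \<Rightarrow> 'i \<Rightarrow> real"
  assumes "finite S" and c: "\<And>i j. i \<in> S \<Longrightarrow> j \<in> S \<Longrightarrow> c i j + c j i = 0"
    and g: "\<And>i j. g i j = g j i"
  shows "(\<Sum>i\<in>S. \<Sum>j\<in>S - {i}. c i j * g i j) = 0"
proof -
  let ?D = "Sigma S (\<lambda>i. S - {i})"
  have s: "(\<Sum>i\<in>S. \<Sum>j\<in>S - {i}. c i j * g i j) = (\<Sum>(i, j)\<in>?D. c i j * g i j)"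
    using assms(1) by (subst sum.Sigma) auto
  have "(\<Sum>(i, j)\<in>?D. c i j * g i j) = (\<Sum>(i, j)\<in>?D. c j i * g j i)"
    by (rule sum.reindex_bij_witness[of _ "\<lambda>(i, j). (j, i)" "\<lambda>(i, j). (j, i)"]) auto
  also have "\<dots> = (\<Sum>(i, j)\<in>?D. - (c i j * g i j))"
  proof (rule sum.cong[OF refl])
    fix p assume "p \<in> ?D"
    then obtain i j where p: "p = (i, j)" "i \<in> S" "j \<in> S" by auto
    have "c j i = - c i j" using c[OF p(2,3)] by simp
    then show "(case p of (i, j) \<Rightarrow> c j i * g j i) = (case p of (i, j) \<Rightarrow> - (c i j * g i j))"
      using g[of i j] by (simp add: p)
  qed
  finally have "(\<Sum>(i, j)\<in>?D. c i j * g i j) = - (\<Sum>(i, j)\<in>?D. c i j * g i j)"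
    by (simp add: case_prod_unfold sum_negf)
  then show ?thesis using s by simp
qed

lemma N0_0 [simp]: "N0 0 S = 0"
  by (simp add: N0_def)

lemma N1_0 [simp]: "N1 0 S = 0"
  by (simp add: N1_def)

text \<open>For at least two elements all terms share a rising product with card S - 2 factors. The
  denominator k + a_j of \<open>attach\<close> cancels against the leading factor of
  \<open>Fs\<close>, and the weights that remain are added by \<open>sum_wt\<close>.\<close>

lemma N0_eq:
  assumes "finite S"
  shows "N0 k S = cat k * Fs a (2 * real k) S
    - (\<Sum>j\<in>S. attach k (a j) * Fs a (2 * real k + 2 * real (a j)) (S - {j}))"
proof (cases "k = 0")
  case True
  then show ?thesis by (simp add: N0_def)
next
  case k: False
  have odd: "2 * real k - 1 \<noteq> 0" by (rule odd_nonzero)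
  show ?thesis
  proof (cases "S = {}")
    case True
    then show ?thesis using k odd by (simp add: N0_def Fs_def total_def nbinom_cat)
  next
    case False
    then obtain n where n: "card S = Suc n" using assms by (metis card_eq_0_iff not0_implies_Suc)
    define D where "D = real k + total a S"
    have D: "D \<ge> 1" using k by (simp add: D_def total_def sum_nonneg add_increasing2)
    define f where "f j = Fs a (2 * real k + 2 * real (a j)) (S - {j})" for j
    have BBf: "attach k (a j) * (2 * real k + 2 * real (a j)) = 2 * real k * cat k * wt a j" for j
      using k by (simp add: attach_def wt_def field_simps)
    show ?thesis
    proof (cases n)
      case 0
      then obtain i where i: "S = {i}" using n by (metis One_nat_def card_1_singletonE)
      have B: "attach k (a i) * D = real k * cat k * (2 * real (a i) + 1)"
        using BBf[of i] by (simp add: i D_def total_def wt_def algebra_simps)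
      have "N0 k S = nbinom k / (2 * D)"
        using D unfolding N0_def n 0 D_def[symmetric] by simp
      also have "\<dots> = cat k * (2 * real k) - attach k (a i)"
      proof -
        have "(cat k * (2 * real k) - attach k (a i)) * (2 * D) = nbinom k"
          unfolding left_diff_distrib using B unfolding nbinom_cat
          by (simp add: i D_def total_def algebra_simps)
        then have "nbinom k / (2 * D) = (cat k * (2 * real k) - attach k (a i)) * (2 * D) / (2 * D)" by simp
        then show ?thesis using D by simp
      qed
      finally show ?thesis by (simp add: i Fs_def)
    next
      case (Suc l)
      let ?Z = "2 * real k + 2 * total a S + 1"
      have ne: "S - {j} \<noteq> {}" for j
      proof
        assume "S - {j} = {}"
        then have "S \<subseteq> {j}" by auto
        then have "card S \<le> 1" using card_mono[of "{j}" S] by simp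
        then show False using n Suc by simp
      qed
      have r: "Fs a (2 * real k + 2 * real (a j)) (S - {j}) = (2 * real k + 2 * real (a j)) * pochhammer ?Z l" if "j \<in> S" for j
        using assms that ne[of j]
        by (simp only: Fs_def if_False total_remove_arg card_Diff_singleton n Suc diff_Suc_1)
      have "(\<Sum>j\<in>S. attach k (a j) * Fs a (2 * real k + 2 * real (a j)) (S - {j}))
         = (\<Sum>j\<in>S. 2 * real k * cat k * pochhammer ?Z l * wt a j)"
        by (intro sum.cong refl, subst r, assumption, subst mult.assoc[symmetric], subst BBf) (simp only: mult_ac)
      also have "\<dots> = 2 * real k * cat k * pochhammer ?Z l * (2 * total a S + real (Suc n))"
        unfolding sum_distrib_left[symmetric] sum_wt n ..
      finally have 1: "(\<Sum>j\<in>S. attach k (a j) * Fs a (2 * real k + 2 * real (a j)) (S - {j}))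
         = 2 * real k * cat k * pochhammer ?Z l * (2 * total a S + real (Suc n))" .
      have 2: "Fs a (2 * real k) S = 2 * real k * (pochhammer ?Z l * (?Z + real l))"
        using False n Suc by (simp add: Fs_def pochhammer_Suc)
      have 3: "pochhammer (2 * D - 1) (card S) = (2 * D - 1) * ((2 * D) * pochhammer ?Z l)"
        unfolding n Suc pochhammer_rec by (simp add: D_def algebra_simps)
      have "N0 k S = nbinom k * pochhammer ?Z l"
        using D unfolding N0_def D_def[symmetric] 3 by simp
      also have "\<dots> = 2 * real k * cat k * pochhammer ?Z l * (2 * real k - 1)"
        by (simp add: nbinom_cat)
      finally show ?thesis unfolding 1 2 Suc by (simp add: algebra_simps)
    qed
  qed
qed

lemma sum_flip: "(\<Sum>i=0..k. f i * g (k - i)) = (\<Sum>i=0..(k::nat). g i * (f (k - i) :: real))"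
  by (rule sum.reindex_bij_witness[of _ "\<lambda>i. k - i" "\<lambda>i. k - i"]) auto

lemma remove2_commute: "S - {i} - {j} = S - {j} - {i}" for S :: "'i set"
  by blast

text \<open>With z = 1 the equation of s reads 1 = s (1 - \<gamma>)^2, and two applications of
  \<open>Fs_shift\<close> lead from x = 2 down to x = 0. This brings the base case k = 1 to the same
  exponents as the other terms.\<close>

lemma Fs_2_expand:
  assumes "finite S"
  shows "(if S = {} then 1 else 0) = Fs a 2 S - 2 * (\<Sum>j\<in>S. Fs a (2 + 2 * real (a j)) (S - {j}))
    + (\<Sum>i\<in>S. \<Sum>j\<in>S - {i}. Fs a (2 + 2 * real (a i) + 2 * real (a j)) (S - {i} - {j}))"
proof -
  have 1: "Fs a (1 + 2 * real (a j)) (S - {j}) = Fs a (2 + 2 * real (a j)) (S - {j})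
     - (\<Sum>i\<in>S - {j}. Fs a (2 + 2 * real (a j) + 2 * real (a i)) (S - {j} - {i}))" for j
    using Fs_shift[of "S - {j}" a "2 + 2 * real (a j)"] assms by simp
  have 2: "Fs a 1 S = Fs a 2 S - (\<Sum>j\<in>S. Fs a (2 + 2 * real (a j)) (S - {j}))"
    using Fs_shift[of S a 2] assms by simp
  have "(if S = {} then 1 else 0) = Fs a 1 S - (\<Sum>j\<in>S. Fs a (1 + 2 * real (a j)) (S - {j}))"
    using Fs_shift[of S a 1] assms by (simp add: Fs_zero)
  then show ?thesis unfolding 1 2 sum_subtractf by simp
qed

text \<open>Expands (1 - \<eta>)^2 over the denominator (1 - \<eta>)^2, so that the transitive cuts
  can be compared with the other terms of genus 1.\<close>

lemma Fs_Ws_expand: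
  assumes "finite S"
  shows "Fs a x S = Ws a x S - 2 * (\<Sum>j\<in>S. yy (a j) * Ws a (x + 2 * real (a j)) (S - {j}))
    + (\<Sum>i\<in>S. \<Sum>j\<in>S - {i}. yy (a i) * yy (a j) * Ws a (x + 2 * real (a i) + 2 * real (a j)) (S - {i} - {j}))"
proof -
  have V: "Vs a x T = Ws a x T - (\<Sum>j\<in>T. yy (a j) * Ws a (x + 2 * real (a j)) (T - {j}))"
    if "finite T" for x T
    using Ws_rec[OF that, of a x] by (simp add: wt_def)
  have "Fs a x S = Vs a x S - (\<Sum>j\<in>S. yy (a j) * Vs a (x + 2 * real (a j)) (S - {j}))"
    using Vs_rec[OF assms, of a x] by (simp add: wt_def)
  also have "(\<Sum>j\<in>S. yy (a j) * Vs a (x + 2 * real (a j)) (S - {j}))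
    = (\<Sum>i\<in>S. yy (a i) * Ws a (x + 2 * real (a i)) (S - {i})
        - (\<Sum>j\<in>S - {i}. yy (a i) * yy (a j) * Ws a (x + 2 * real (a i) + 2 * real (a j)) (S - {i} - {j})))"
    using assms by (intro sum.cong refl) (simp add: V right_diff_distrib sum_distrib_left mult.assoc)
  finally show ?thesis unfolding V[OF assms] sum_subtractf by simp
qed

lemma sum_collect:
  fixes c :: "nat \<Rightarrow> real"
  shows "(\<Sum>l\<in>L. c l * g + (\<Sum>j\<in>S. d l j * h j) + (\<Sum>i\<in>S. \<Sum>j\<in>S - {i}. e l i j * f i j))
   = (\<Sum>l\<in>L. c l) * g + (\<Sum>j\<in>S. (\<Sum>l\<in>L. d l j) * h j) + (\<Sum>i\<in>S. \<Sum>j\<in>S - {i}. (\<Sum>l\<in>L. e l i j) * (f i j :: real))"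
proof -
  have "(\<Sum>l\<in>L. \<Sum>i\<in>S. \<Sum>j\<in>S - {i}. e l i j * f i j) = (\<Sum>i\<in>S. \<Sum>l\<in>L. \<Sum>j\<in>S - {i}. e l i j * f i j)"
    by (rule sum.swap)
  also have "\<dots> = (\<Sum>i\<in>S. \<Sum>j\<in>S - {i}. \<Sum>l\<in>L. e l i j * f i j)"
    by (intro sum.cong refl sum.swap)
  finally have 1: "(\<Sum>l\<in>L. \<Sum>i\<in>S. \<Sum>j\<in>S - {i}. e l i j * f i j) = (\<Sum>i\<in>S. \<Sum>j\<in>S - {i}. \<Sum>l\<in>L. e l i j * f i j)" .
  have 2: "(\<Sum>l\<in>L. \<Sum>j\<in>S. d l j * h j) = (\<Sum>j\<in>S. \<Sum>l\<in>L. d l j * h j)"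
    by (rule sum.swap)
  show ?thesis unfolding sum.distrib 1 2 sum_distrib_right ..
qed

lemma sum_collect3:
  fixes g :: real
  shows "(\<Sum>j\<in>S. d j * h j) + (\<Sum>i\<in>S. \<Sum>j\<in>S - {i}. e i j * f i j)
    + (c' * g + (\<Sum>j\<in>S. d' j * h j) + (\<Sum>i\<in>S. \<Sum>j\<in>S - {i}. e' i j * f i j))
    + 2 * (c'' * g + (\<Sum>j\<in>S. d'' j * h j) + (\<Sum>i\<in>S. \<Sum>j\<in>S - {i}. e'' i j * f i j))
   = (c' + 2 * c'') * g + (\<Sum>j\<in>S. (d j + d' j + 2 * d'' j) * h j)
     + (\<Sum>i\<in>S. \<Sum>j\<in>S - {i}. (e i j + e' i j + 2 * e'' i j) * f i j)"
  by (simp add: sum.distrib sum_distrib_left distrib_right distrib_left mult.assoc)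

text \<open>The base term is the empty factorization of a single fixed point; then come the joins of
  the marked cycle with another one and its cuts. Once all terms are multiples of \<open>F0\<close>,
  \<open>F1\<close> and \<open>F2\<close>, their coefficients are the three convolution identities.
  The summands at l = 0 and l = k vanish and are kept so that the sums are full products of
  series.\<close>

theorem N0_rec:
  assumes fin: "finite S" and a: "\<And>j. j \<in> S \<Longrightarrow> a j \<ge> 1" and k: "k \<ge> 1"
  shows "N0 k S = (if k = 1 \<and> S = {} then 1 else 0)
    + (\<Sum>j\<in>S. N0 (k + a j) (S - {j}) / cbinom (a j)) + (\<Sum>l=0..k. set_conv (N0 l) (N0 (k - l)) S)"
proof -
  define d where "d = (if k = 1 then 1 else 0 :: real)"
  define F0 where "F0 = Fs a (2 * real k) S"
  define F1 where "F1 j = Fs a (2 * real k + 2 * real (a j)) (S - {j})" for j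
  define F2 where "F2 i j = Fs a (2 * real k + 2 * real (a i) + 2 * real (a j)) (S - {i} - {j})" for i j
  have base: "(if k = 1 \<and> S = {} then 1 else 0)
      = d * F0 + (\<Sum>j\<in>S. (- 2 * d) * F1 j) + (\<Sum>i\<in>S. \<Sum>j\<in>S - {i}. d * F2 i j)"
  proof (cases "k = 1")
    case True
    then show ?thesis using Fs_2_expand[OF fin]
      by (simp add: d_def F0_def F1_def F2_def sum_negf sum_distrib_left)
  qed (simp add: d_def)
  have join: "(\<Sum>j\<in>S. N0 (k + a j) (S - {j}) / cbinom (a j))
    = (\<Sum>j\<in>S. (cat (k + a j) / cbinom (a j)) * F1 j) + (\<Sum>i\<in>S. \<Sum>j\<in>S - {i}. (- attach (k + a i) (a j) / cbinom (a i)) * F2 i j)"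
  proof -
    have "N0 (k + a i) (S - {i}) / cbinom (a i) = (cat (k + a i) / cbinom (a i)) * F1 i
       + (\<Sum>j\<in>S - {i}. (- attach (k + a i) (a j) / cbinom (a i)) * F2 i j)" for i
      using fin by (simp add: N0_eq F1_def F2_def diff_divide_distrib sum_divide_distrib sum_negf distrib_left)
    then show ?thesis by (simp add: sum.distrib)
  qed
  have conv: "set_conv (N0 l) (N0 (k - l)) S
     = (cat l * cat (k - l)) * F0 + (\<Sum>j\<in>S. (- (cat l * attach (k - l) (a j)) - attach l (a j) * cat (k - l)) * F1 j)
      + (\<Sum>i\<in>S. \<Sum>j\<in>S - {i}. (attach l (a i) * attach (k - l) (a j)) * F2 i j)" if "l \<in> {0..k}" for l
  proof -
    have z: "2 * real l + 2 * real (k - l) = 2 * real k" using that by (simp add: of_nat_diff)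
    have "set_conv (N0 l) (N0 (k - l)) S
      = set_conv (\<lambda>T. cat l * Fs a (2 * real l) T - (\<Sum>j\<in>T. attach l (a j) * Fs a (2 * real l + 2 * real (a j)) (T - {j})))
       (\<lambda>T. cat (k - l) * Fs a (2 * real (k - l)) T + (\<Sum>j\<in>T. (- attach (k - l) (a j)) * Fs a (2 * real (k - l) + 2 * real (a j)) (T - {j}))) S"
      using finite_subset[OF _ fin] by (intro set_conv_cong) (simp_all add: N0_eq sum_negf)
    also have "\<dots> = (cat l * cat (k - l)) * F0 + (\<Sum>j\<in>S. (cat l * (- attach (k - l) (a j)) - attach l (a j) * cat (k - l)) * F1 j)
      - (\<Sum>i\<in>S. \<Sum>j\<in>S - {i}. attach l (a i) * (- attach (k - l) (a j)) * F2 i j)"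
      unfolding F0_def F1_def F2_def by (rule set_conv_affine[OF fin set_conv_Fs_Fs z])
    finally show ?thesis by (simp add: sum_negf)
  qed
  define c2 where "c2 i j = d - attach (k + a i) (a j) / cbinom (a i) + (\<Sum>l=0..k. attach l (a i) * attach (k - l) (a j))" for i j
  have "(\<Sum>l=0..k. set_conv (N0 l) (N0 (k - l)) S)
    = (\<Sum>l=0..k. cat l * cat (k - l)) * F0 + (\<Sum>j\<in>S. (\<Sum>l=0..k. - (cat l * attach (k - l) (a j)) - attach l (a j) * cat (k - l)) * F1 j)
      + (\<Sum>i\<in>S. \<Sum>j\<in>S - {i}. (\<Sum>l=0..k. attach l (a i) * attach (k - l) (a j)) * F2 i j)"
    unfolding sum_collect[symmetric] by (intro sum.cong refl conv)
  then have "(if k = 1 \<and> S = {} then 1 else 0)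
    + (\<Sum>j\<in>S. N0 (k + a j) (S - {j}) / cbinom (a j)) + (\<Sum>l=0..k. set_conv (N0 l) (N0 (k - l)) S)
    = (d + (\<Sum>l=0..k. cat l * cat (k - l))) * F0
      + (\<Sum>j\<in>S. (- 2 * d + cat (k + a j) / cbinom (a j) + (\<Sum>l=0..k. - (cat l * attach (k - l) (a j)) - attach l (a j) * cat (k - l))) * F1 j)
      + (\<Sum>i\<in>S. \<Sum>j\<in>S - {i}. c2 i j * F2 i j)"
    unfolding base join c2_def by (simp add: sum.distrib distrib_right sum_subtractf left_diff_distrib sum_negf)
  also have "(\<Sum>i\<in>S. \<Sum>j\<in>S - {i}. c2 i j * F2 i j) = 0"
  proof (rule double_sum_antisym[OF fin])
    show "c2 i j + c2 j i = 0" if "i \<in> S" "j \<in> S" for i j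
      using quadratic_convolution[of "a j" "a i" k] a[OF that(1)] a[OF that(2)] k
        sum_flip[of "\<lambda>l. attach l (a i)" "\<lambda>l. attach l (a j)" k]
      by (simp add: c2_def d_def)
    show "F2 i j = F2 j i" for i j
      unfolding F2_def remove2_commute[of S i j] by (simp add: add_ac)
  qed
  also have "(\<Sum>j\<in>S. (- 2 * d + cat (k + a j) / cbinom (a j) + (\<Sum>l=0..k. - (cat l * attach (k - l) (a j)) - attach l (a j) * cat (k - l))) * F1 j)
    = (\<Sum>j\<in>S. - attach k (a j) * F1 j)"
  proof (intro sum.cong refl arg_cong2[where f="(*)"])
    fix j assume "j \<in> S"
    then show "- 2 * d + cat (k + a j) / cbinom (a j) + (\<Sum>l=0..k. - (cat l * attach (k - l) (a j)) - attach l (a j) * cat (k - l)) = - attach k (a j)"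
      using linear_convolution[of "a j" k] a k sum_flip[of cat "\<lambda>l. attach l (a j)" k]
      by (simp add: d_def sum_subtractf sum_negf)
  qed
  also have "d + (\<Sum>l=0..k. cat l * cat (k - l)) = cat k"
    using Catalan_convolution[OF k] by (simp add: d_def)
  finally show ?thesis
    unfolding N0_eq[OF fin, of k] F0_def F1_def by (simp add: sum_negf)
qed

text \<open>In the definition \<open>N1\<close> mixes the denominators 1 - \<eta> and (1 -
  \<eta>)^2. Over the common denominator (1 - \<eta>)^2 the numerator still has degree one in the
  p_j s^(a j).\<close>

lemma N1_eq:
  assumes "finite S"
  shows "12 * N1 k S = (nbinom k * (real k - 1)) * Ws a (2 * real k) S
    + (\<Sum>j\<in>S. (nbinom k * (real (a j) - real k + 1) * yy (a j)) * Ws a (2 * real k + 2 * real (a j)) (S - {j}))"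
proof -
  have V: "Vs a (2 * real k) S = Ws a (2 * real k) S - (\<Sum>j\<in>S. yy (a j) * Ws a (2 * real k + 2 * real (a j)) (S - {j}))"
    using Ws_rec[OF assms, of a "2 * real k"] by (simp add: wt_def)
  have "(\<Sum>j\<in>S. (nbinom k * (real (a j) - real k + 1) * yy (a j)) * Ws a (2 * real k + 2 * real (a j)) (S - {j}))
    = nbinom k * ((\<Sum>j\<in>S. real (a j) * yy (a j) * Ws a (2 * real k + 2 * real (a j)) (S - {j}))
     - (real k - 1) * (\<Sum>j\<in>S. yy (a j) * Ws a (2 * real k + 2 * real (a j)) (S - {j})))"
    unfolding sum_distrib_left sum_subtractf[symmetric] by (intro sum.cong refl) (simp add: algebra_simps)
  then show ?thesis
    unfolding N1_def V by (simp add: algebra_simps)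
qed

text \<open>The term with \<open>Fs\<close> stands for the cuts after which the action is still
  transitive, of genus 0. The factor 2 arises because after a splitting cut the genus can lie on
  either orbit.\<close>

theorem N1_rec:
  assumes fin: "finite S" and a: "\<And>j. j \<in> S \<Longrightarrow> a j \<ge> 1" and k: "k \<ge> 1"
  shows "N1 k S = (\<Sum>j\<in>S. N1 (k + a j) (S - {j}) / cbinom (a j))
    + (\<Sum>l=0..k. nbinom l * nbinom (k - l)) * Fs a (2 * real k) S / (2 * real k)
    + 2 * (\<Sum>l=0..k. set_conv (N0 l) (N1 (k - l)) S)"
proof -
  define W0 where "W0 = Ws a (2 * real k) S"
  define W1 where "W1 j = Ws a (2 * real k + 2 * real (a j)) (S - {j})" for j
  define W2 where "W2 i j = Ws a (2 * real k + 2 * real (a i) + 2 * real (a j)) (S - {i} - {j})" for i j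
  define m0 where "m0 k = nbinom k * (real k - 1)" for k
  define m1 where "m1 k j = nbinom k * (real (a j) - real k + 1) * yy (a j)" for k j
  \<comment> \<open>The factor 12 clears the denominator of \<open>N1\<close>, and 12 / (2k) = 6 / k
    is the constant of \<open>KK_eq\<close>.\<close>
  have cut: "12 * ((\<Sum>l=0..k. nbinom l * nbinom (k - l)) * Fs a (2 * real k) S / (2 * real k))
      = KK k * W0 + (\<Sum>j\<in>S. (- 2 * yy (a j) * KK k) * W1 j) + (\<Sum>i\<in>S. \<Sum>j\<in>S - {i}. (yy (a i) * yy (a j) * KK k) * W2 i j)"
  proof -
    have 1: "12 * ((\<Sum>l=0..k. nbinom l * nbinom (k - l)) * Fs a (2 * real k) S / (2 * real k)) = KK k * Fs a (2 * real k) S"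
      using KK_eq[of k] k by (simp add: field_simps)
    have 2: "KK k * (2 * (\<Sum>j\<in>S. yy (a j) * W1 j)) = - (\<Sum>j\<in>S. (- 2 * yy (a j) * KK k) * W1 j)"
      unfolding sum_negf[symmetric] sum_distrib_left by (intro sum.cong refl) (simp add: algebra_simps)
    have 3: "KK k * (\<Sum>i\<in>S. \<Sum>j\<in>S - {i}. yy (a i) * yy (a j) * W2 i j)
       = (\<Sum>i\<in>S. \<Sum>j\<in>S - {i}. (yy (a i) * yy (a j) * KK k) * W2 i j)"
      unfolding sum_distrib_left by (intro sum.cong refl) simp
    have 4: "KK k * (u - v + w) = KK k * u - KK k * v + KK k * w" for u v w
      by (simp add: algebra_simps)
    show ?thesis
      unfolding 1 unfolding Fs_Ws_expand[OF fin] W0_def[symmetric] W1_def[symmetric] W2_def[symmetric] 4 2 3 by simp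
  qed
  have join: "12 * (\<Sum>j\<in>S. N1 (k + a j) (S - {j}) / cbinom (a j))
    = (\<Sum>j\<in>S. (m0 (k + a j) / cbinom (a j)) * W1 j) + (\<Sum>i\<in>S. \<Sum>j\<in>S - {i}. (m1 (k + a i) j / cbinom (a i)) * W2 i j)"
  proof -
    have "12 * (N1 (k + a i) (S - {i}) / cbinom (a i)) = (m0 (k + a i) / cbinom (a i)) * W1 i
       + (\<Sum>j\<in>S - {i}. (m1 (k + a i) j / cbinom (a i)) * W2 i j)" for i
    proof -
      have "12 * N1 (k + a i) (S - {i}) = m0 (k + a i) * W1 i + (\<Sum>j\<in>S - {i}. m1 (k + a i) j * W2 i j)"
        using fin by (simp add: N1_eq W1_def W2_def m0_def m1_def)
      then show ?thesis
        unfolding times_divide_eq_right by (simp add: add_divide_distrib sum_divide_distrib)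
    qed
    then show ?thesis by (simp add: sum.distrib sum_distrib_left)
  qed
  have conv: "12 * set_conv (N0 l) (N1 (k - l)) S
     = (cat l * m0 (k - l)) * W0 + (\<Sum>j\<in>S. (cat l * m1 (k - l) j - attach l (a j) * m0 (k - l)) * W1 j)
      + (\<Sum>i\<in>S. \<Sum>j\<in>S - {i}. (- (attach l (a i) * m1 (k - l) j)) * W2 i j)" if "l \<in> {0..k}" for l
  proof -
    have z: "2 * real l + 2 * real (k - l) = 2 * real k" using that by (simp add: of_nat_diff)
    have "12 * set_conv (N0 l) (N1 (k - l)) S
      = set_conv (\<lambda>T. cat l * Fs a (2 * real l) T - (\<Sum>j\<in>T. attach l (a j) * Fs a (2 * real l + 2 * real (a j)) (T - {j})))
       (\<lambda>T. m0 (k - l) * Ws a (2 * real (k - l)) T + (\<Sum>j\<in>T. m1 (k - l) j * Ws a (2 * real (k - l) + 2 * real (a j)) (T - {j}))) S"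
      unfolding set_conv_scale_right[symmetric] m0_def m1_def
      using finite_subset[OF _ fin] by (intro set_conv_cong N0_eq N1_eq)
    also have "\<dots> = (cat l * m0 (k - l)) * W0 + (\<Sum>j\<in>S. (cat l * m1 (k - l) j - attach l (a j) * m0 (k - l)) * W1 j)
      - (\<Sum>i\<in>S. \<Sum>j\<in>S - {i}. attach l (a i) * m1 (k - l) j * W2 i j)"
      unfolding W0_def W1_def W2_def by (rule set_conv_affine[OF fin set_conv_Fs_Ws z])
    finally show ?thesis by (simp add: sum_negf)
  qed
  define c2 where "c2 i j = m1 (k + a i) j / cbinom (a i) + yy (a i) * yy (a j) * KK k
    - 2 * (\<Sum>l=0..k. attach l (a i) * m1 (k - l) j)" for i j
  have conv_sum: "12 * (\<Sum>l=0..k. set_conv (N0 l) (N1 (k - l)) S)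
    = (\<Sum>l=0..k. cat l * m0 (k - l)) * W0 + (\<Sum>j\<in>S. (\<Sum>l=0..k. cat l * m1 (k - l) j - attach l (a j) * m0 (k - l)) * W1 j)
      + (\<Sum>i\<in>S. \<Sum>j\<in>S - {i}. (\<Sum>l=0..k. - (attach l (a i) * m1 (k - l) j)) * W2 i j)"
    unfolding sum_collect[symmetric] sum_distrib_left by (intro sum.cong refl conv)
  have scale: "12 * (u + v + 2 * w) = 12 * u + 12 * v + 2 * (12 * w)" for u v w :: real
    by simp
  have "12 * ((\<Sum>j\<in>S. N1 (k + a j) (S - {j}) / cbinom (a j))
    + (\<Sum>l=0..k. nbinom l * nbinom (k - l)) * Fs a (2 * real k) S / (2 * real k)
    + 2 * (\<Sum>l=0..k. set_conv (N0 l) (N1 (k - l)) S))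
    = (KK k + 2 * (\<Sum>l=0..k. cat l * m0 (k - l))) * W0
      + (\<Sum>j\<in>S. (m0 (k + a j) / cbinom (a j) + - 2 * yy (a j) * KK k + 2 * (\<Sum>l=0..k. cat l * m1 (k - l) j - attach l (a j) * m0 (k - l))) * W1 j)
      + (\<Sum>i\<in>S. \<Sum>j\<in>S - {i}. c2 i j * W2 i j)"
    unfolding scale join cut conv_sum sum_collect3 c2_def sum_negf by simp
  also have "(\<Sum>i\<in>S. \<Sum>j\<in>S - {i}. c2 i j * W2 i j) = 0"
  proof (rule double_sum_antisym[OF fin])
    show "c2 i j + c2 j i = 0" if "i \<in> S" "j \<in> S" for i j
      using genus1_quadratic[of "a i" "a j" k] a[OF that(1)] a[OF that(2)] k
      by (simp add: c2_def m1_def)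
    show "W2 i j = W2 j i" for i j
      unfolding W2_def remove2_commute[of S i j] by (simp add: add_ac)
  qed
  also have "(\<Sum>j\<in>S. (m0 (k + a j) / cbinom (a j) + - 2 * yy (a j) * KK k + 2 * (\<Sum>l=0..k. cat l * m1 (k - l) j - attach l (a j) * m0 (k - l))) * W1 j)
    = (\<Sum>j\<in>S. m1 k j * W1 j)"
  proof (intro sum.cong refl arg_cong2[where f="(*)"])
    fix j assume "j \<in> S"
    then show "m0 (k + a j) / cbinom (a j) + - 2 * yy (a j) * KK k + 2 * (\<Sum>l=0..k. cat l * m1 (k - l) j - attach l (a j) * m0 (k - l)) = m1 k j"
      using genus1_linear[of "a j" k] a k by (simp add: m0_def m1_def) (simp add: algebra_simps)
  qed
  also have "KK k + 2 * (\<Sum>l=0..k. cat l * m0 (k - l)) = m0 k"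
    using genus1_constant[of k] by (simp add: m0_def)
  finally have "12 * ((\<Sum>j\<in>S. N1 (k + a j) (S - {j}) / cbinom (a j))
    + (\<Sum>l=0..k. nbinom l * nbinom (k - l)) * Fs a (2 * real k) S / (2 * real k)
    + 2 * (\<Sum>l=0..k. set_conv (N0 l) (N1 (k - l)) S)) = 12 * N1 k S"
    unfolding N1_eq[OF fin, of k] W0_def W1_def m0_def m1_def by simp
  moreover have "12 * u = 12 * v \<Longrightarrow> v = u" for u v :: real
    by simp
  ultimately show ?thesis by blast
qed

end

section \<open>Symmetric forms of the formulas\<close>

context
  fixes a :: "'i \<Rightarrow> nat"
begin

text \<open>The symmetric forms of the two formulas. For \<open>Phi0\<close> the rising product with \<open>card I - 3\<close> factors is
  written with the quotient \<open>2d (2d - 1)\<close> because \<open>card I\<close> can be less than 3.\<close>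

definition Phi0 :: "'i set \<Rightarrow> real" where
  "Phi0 I = (\<Prod>X\<in>I. nbinom (a X)) * pochhammer (2 * total a I - 1) (card I - 1) / ((2 * total a I) * (2 * total a I - 1))"

definition Phi1 :: "'i set \<Rightarrow> real" where
  "Phi1 I = (\<Prod>X\<in>I. nbinom (a X)) / 24 * (pochhammer (2 * total a I + 1) (card I)
     - 3 * pochhammer (2 * total a I + 1) (card I - 1)
     - (\<Sum>m=2..card I. fact (m - 2) * pochhammer (2 * total a I + 1) (card I - m) * esym (wt a) m I))"

definition M0 :: "nat \<Rightarrow> 'i set \<Rightarrow> real" where "M0 k S = (\<Prod>X\<in>S. nbinom (a X)) * N0 a k S"
definition M1 :: "nat \<Rightarrow> 'i set \<Rightarrow> real" where "M1 k S = (\<Prod>X\<in>S. nbinom (a X)) * N1 a k S"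
text \<open>The genus 0 formula with two distinguished cycles: apart from the factors
  \<open>nbinom\<close> it involves only the sum k + l of their lengths. Dividing \<open>Fs\<close>
  by its leading factor is also correct for empty S.\<close>

definition M00 :: "nat \<Rightarrow> nat \<Rightarrow> 'i set \<Rightarrow> real" where
  "M00 k l S = (\<Prod>X\<in>S. nbinom (a X)) * (nbinom k * nbinom l * Fs a (2 * real (k + l)) S / (2 * real (k + l)))"

lemma Phi0_insert: "finite S \<Longrightarrow> x \<notin> S \<Longrightarrow> Phi0 (insert x S) = M0 (a x) S"
  by (simp add: Phi0_def M0_def N0_def total_insert)

lemma Phi0_insert2:
  assumes "finite S" "x \<notin> S" "z \<notin> S" "x \<noteq> z" "a x + a z \<ge> 1"
  shows "Phi0 (insert x (insert z S)) = M00 (a x) (a z) S"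
proof -
  define D where "D = real (a x) + real (a z) + total a S"
  have D: "D \<ge> 1" using assms(5) unfolding D_def total_def by (simp add: sum_nonneg add_increasing2)
  have total: "total a (insert x (insert z S)) = D" using assms by (simp add: total_insert D_def)
  have e: "pochhammer (2 * D - 1) (card S + 1) / ((2 * D) * (2 * D - 1)) = Fs a (2 * real (a x + a z)) S / (2 * real (a x + a z))"
  proof (cases "S = {}")
    case True
    then show ?thesis using D by (simp add: Fs_def D_def total_def)
  next
    case False
    then obtain n where n: "card S = Suc n" using assms by (metis card_eq_0_iff not0_implies_Suc)
    have "pochhammer (2 * D - 1) (card S + 1) = (2 * D - 1) * ((2 * D) * pochhammer (2 * D + 1) n)"
      unfolding n by (simp add: pochhammer_rec)
    moreover have "Fs a (2 * real (a x + a z)) S / (2 * real (a x + a z)) = pochhammer (2 * D + 1) n"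
    proof -
      have e: "2 * real (a x + a z) + 2 * total a S + 1 = 2 * D + 1" by (simp add: D_def)
      have "Fs a (2 * real (a x + a z)) S = 2 * real (a x + a z) * pochhammer (2 * D + 1) n"
        by (simp only: Fs_def False if_False n diff_Suc_1 e)
      then show ?thesis using assms(5) by simp
    qed
    ultimately show ?thesis using D by simp
  qed
  have "Phi0 (insert x (insert z S))
      = (\<Prod>X\<in>S. nbinom (a X)) * (nbinom (a x) * nbinom (a z) * (pochhammer (2 * D - 1) (card S + 1) / ((2 * D) * (2 * D - 1))))"
    unfolding Phi0_def total using assms by simp
  then show ?thesis
    unfolding e M00_def by simp
qed

text \<open>Summation by parts, where y is the weight of the distinguished element. By X + card S =
  y + e_1 the last factor of a rising product becomes y + e_1 - (m + 1), and multiplied by e_(m+1)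
  it matches the other terms up to a telescoping difference.\<close>

lemma esym_sum_identity:
  assumes fin: "finite S" and X: "X + real (card S) = y + sum (wt a) S"
  shows "pochhammer X (Suc (card S)) - 3 * pochhammer X (card S)
      - (\<Sum>m=2..Suc (card S). fact (m - 2) * pochhammer X (Suc (card S) - m) * (esym (wt a) m S + y * esym (wt a) (m - 1) S))
    = (y - 3) * pochhammer X (card S)
      + (\<Sum>m<card S. fact m * pochhammer X (card S - Suc m) *
          (sum (wt a) S * esym (wt a) (Suc m) S - real (m + 2) * esym (wt a) (m + 2) S - real (Suc m) * esym (wt a) (Suc m) S))"
proof -
  let ?e = "\<lambda>m. esym (wt a) m S" and ?s = "card S" and ?P = "pochhammer X"
  have 1: "(\<Sum>m=2..Suc ?s. fact (m - 2) * ?P (Suc ?s - m) * (?e m + y * ?e (m - 1)))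
     = (\<Sum>m<?s. fact m * ?P (?s - Suc m) * (?e (m + 2) + y * ?e (Suc m)))"
  proof (rule sum.reindex_cong[of "\<lambda>m. m + 2"])
    show "{2..Suc ?s} = (\<lambda>m. m + 2) ` {..<?s}"
      by (auto simp: image_iff Bex_def) presburger
  qed (auto simp: inj_on_def)
  have 2: "fact m * ?P (?s - Suc m) * (sum (wt a) S * ?e (Suc m) - real (m + 2) * ?e (m + 2) - real (Suc m) * ?e (Suc m))
      + fact m * ?P (?s - Suc m) * (?e (m + 2) + y * ?e (Suc m))
     = fact m * ?P (?s - m) * ?e (Suc m) - fact (Suc m) * ?P (?s - Suc m) * ?e (Suc (Suc m))" if "m < ?s" for m
  proof -
    have P: "?P (?s - m) = ?P (?s - Suc m) * (X + real ?s - real (Suc m))"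
      using that pochhammer_Suc[of X "?s - Suc m"] by (simp add: Suc_diff_Suc of_nat_diff algebra_simps)
    show ?thesis unfolding P X by (simp add: algebra_simps)
  qed
  have "(\<Sum>m<?s. fact m * ?P (?s - Suc m) * (sum (wt a) S * ?e (Suc m) - real (m + 2) * ?e (m + 2) - real (Suc m) * ?e (Suc m)))
      + (\<Sum>m<?s. fact m * ?P (?s - Suc m) * (?e (m + 2) + y * ?e (Suc m)))
     = (\<Sum>m<?s. fact m * ?P (?s - m) * ?e (Suc m) - fact (Suc m) * ?P (?s - Suc m) * ?e (Suc (Suc m)))"
    unfolding sum.distrib[symmetric] by (intro sum.cong refl 2) auto
  also have "\<dots> = fact 0 * ?P (?s - 0) * ?e (Suc 0) - fact ?s * ?P (?s - ?s) * ?e (Suc ?s)"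
    by (rule sum_lessThan_telescope'[where f="\<lambda>m. fact m * ?P (?s - m) * ?e (Suc m)"])
  also have "\<dots> = ?P ?s * sum (wt a) S"
    using fin by (simp add: esym_1 esym_eq_0)
  finally have 3: "(\<Sum>m<?s. fact m * ?P (?s - Suc m) * (sum (wt a) S * ?e (Suc m) - real (m + 2) * ?e (m + 2) - real (Suc m) * ?e (Suc m)))
     = ?P ?s * sum (wt a) S - (\<Sum>m<?s. fact m * ?P (?s - Suc m) * (?e (m + 2) + y * ?e (Suc m)))" by linarith
  show ?thesis unfolding 1 3 pochhammer_Suc X by (simp add: algebra_simps)
qed

text \<open>For y = 2 a_j + 1 the factor a_j (2 a_j + 1) is (y^2 - y) / 2, which leads to the sums
  of y_j e_m and y_j^2 e_m over the sets with one element removed.\<close>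

lemma sum_marked_Ws:
  assumes "finite S"
  shows "(\<Sum>j\<in>S. real (a j) * yy (a j) * Ws a (x + 2 * real (a j)) (S - {j}))
    = (\<Sum>m<card S. fact m * pochhammer (x + 2 * total a S + 1) (card S - Suc m) *
          (sum (wt a) S * esym (wt a) (Suc m) S - real (m + 2) * esym (wt a) (m + 2) S - real (Suc m) * esym (wt a) (Suc m) S)) / 2"
proof -
  let ?P = "pochhammer (x + 2 * total a S + 1)" and ?y = "wt a"
  have W: "Ws a (x + 2 * real (a j)) (S - {j}) = (\<Sum>m<card S. fact m * esym ?y m (S - {j}) * ?P (card S - Suc m))"
    if "j \<in> S" for j
  proof -
    have "card S > 0" using assms that by (auto simp: card_gt_0_iff)
    then obtain n where n: "card S = Suc n" by (metis gr0_implies_Suc)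
    have "Ws a (x + 2 * real (a j)) (S - {j}) = (\<Sum>m\<le>n. fact m * esym ?y m (S - {j}) * ?P (n - m))"
      using assms that by (simp only: Ws_def total_remove_arg card_Diff_singleton n diff_Suc_1)
    then show ?thesis by (simp add: n lessThan_Suc_atMost)
  qed
  have "(\<Sum>j\<in>S. real (a j) * yy (a j) * Ws a (x + 2 * real (a j)) (S - {j}))
     = (\<Sum>j\<in>S. \<Sum>m<card S. fact m * ?P (card S - Suc m) / 2 * (?y j * (?y j * esym ?y m (S - {j})) - ?y j * esym ?y m (S - {j})))"
    by (intro sum.cong refl, subst W, assumption)
       (auto simp: sum_distrib_left wt_def field_simps intro!: sum.cong)
  also have "\<dots> = (\<Sum>m<card S. fact m * ?P (card S - Suc m) / 2 *
      ((\<Sum>j\<in>S. ?y j * (?y j * esym ?y m (S - {j}))) - (\<Sum>j\<in>S. ?y j * esym ?y m (S - {j}))))"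
    by (subst sum.swap) (simp add: sum_distrib_left sum_divide_distrib sum_subtractf[symmetric])
  finally show ?thesis
    unfolding sum_esym_remove[OF assms] sum_sq_esym_remove[OF assms] sum_divide_distrib by simp
qed

text \<open>Here lies the symmetry of genus 1: \<open>N1\<close> distinguishes one cycle, and its
  independence of this choice is not visible from the definition.\<close>

lemma Phi1_insert:
  assumes fin: "finite S" "x \<notin> S"
  shows "Phi1 (insert x S) = M1 (a x) S"
proof -
  define X where "X = 2 * real (a x) + 2 * total a S + 1"
  have X: "X + real (card S) = wt a x + sum (wt a) S"
    unfolding sum_wt by (simp add: X_def wt_def)
  have e: "(\<Sum>m=2..Suc (card S). fact (m - 2) * pochhammer X (Suc (card S) - m) * esym (wt a) m (insert x S))
    = (\<Sum>m=2..Suc (card S). fact (m - 2) * pochhammer X (Suc (card S) - m) * (esym (wt a) m S + wt a x * esym (wt a) (m - 1) S))"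
  proof (intro sum.cong refl arg_cong2[where f="(*)"])
    fix m assume "m \<in> {2..Suc (card S)}"
    then obtain l where "m = Suc l" by (cases m) auto
    then show "esym (wt a) m (insert x S) = esym (wt a) m S + wt a x * esym (wt a) (m - 1) S"
      using esym_insert[OF fin] by simp
  qed
  have "Phi1 (insert x S) = (\<Prod>X\<in>S. nbinom (a X)) * nbinom (a x) / 24 * (pochhammer X (Suc (card S)) - 3 * pochhammer X (card S)
      - (\<Sum>m=2..Suc (card S). fact (m - 2) * pochhammer X (Suc (card S) - m) * (esym (wt a) m S + wt a x * esym (wt a) (m - 1) S)))"
    unfolding Phi1_def e[symmetric] using fin by (simp add: total_insert X_def)
  also have "\<dots> = M1 (a x) S"
    unfolding esym_sum_identity[OF fin(1) X] M1_def N1_def sum_marked_Ws[OF fin(1)] X_def[symmetric] Vs_def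
    by (simp add: wt_def field_simps)
  finally show ?thesis .
qed

lemma prod_nbinom_remove:
  assumes "finite S" "j \<in> S"
  shows "(\<Prod>X\<in>S. nbinom (a X)) = real (a j) * cbinom (a j) * (\<Prod>X\<in>S - {j}. nbinom (a X))"
  using assms by (simp add: prod.remove nbinom_def)

lemma prod_split: "finite S \<Longrightarrow> T \<subseteq> S \<Longrightarrow> prod f S = prod f T * prod f (S - T)" for f :: "'i \<Rightarrow> real"
  by (metis mult.commute prod.subset_diff)

text \<open>Since nbinom (a j) = a_j cbinom (a j), the denominator cancels and the number of points
  of the joined cycle remains.\<close>

lemma join_scale:
  assumes "finite S"
  shows "(\<Prod>X\<in>S. nbinom (a X)) * (\<Sum>j\<in>S. N (k + a j) (S - {j}) / cbinom (a j))
    = (\<Sum>j\<in>S. real (a j) * ((\<Prod>X\<in>S - {j}. nbinom (a X)) * N (k + a j) (S - {j})))"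
  unfolding sum_distrib_left
proof (intro sum.cong refl)
  fix j assume "j \<in> S"
  from prod_nbinom_remove[OF assms this] cbinom_pos[of "a j"]
  show "(\<Prod>X\<in>S. nbinom (a X)) * (N (k + a j) (S - {j}) / cbinom (a j)) =
         real (a j) * ((\<Prod>X\<in>S - {j}. nbinom (a X)) * N (k + a j) (S - {j}))"
    by simp
qed

lemma conv_scale:
  assumes "finite S"
  shows "(\<Prod>X\<in>S. nbinom (a X)) * set_conv f g S
    = (\<Sum>T\<in>Pow S. ((\<Prod>X\<in>T. nbinom (a X)) * f T) * ((\<Prod>X\<in>S - T. nbinom (a X)) * g (S - T)))"
  unfolding set_conv_def sum_distrib_left
  by (intro sum.cong refl, subst prod_split[OF assms]) auto

lemma sum_interior: "f 0 = 0 \<Longrightarrow> f k = 0 \<Longrightarrow> k \<ge> 1 \<Longrightarrow> (\<Sum>l=0..k. f l) = (\<Sum>l=1..<k. f l)" for f :: "nat \<Rightarrow> real"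
  by (cases k) (simp_all add: sum.atLeast_Suc_atMost atLeastLessThanSuc_atLeastAtMost)

lemma sum_rev_interior: "(\<Sum>l=1..<k. f l (k - l)) = (\<Sum>l=1..<k. f (k - l) (l::nat) :: real)"
  by (rule sum.reindex_bij_witness[of _ "\<lambda>l. k - l" "\<lambda>l. k - l"]) auto

theorem M0_rec:
  assumes fin: "finite S" and a: "\<And>j. j \<in> S \<Longrightarrow> a j \<ge> 1" and k: "k \<ge> 1" "k \<noteq> 1 \<or> S \<noteq> {}"
  shows "M0 k S = (\<Sum>j\<in>S. real (a j) * M0 (k + a j) (S - {j}))
    + (\<Sum>l=1..<k. \<Sum>T\<in>Pow S. M0 (k - l) T * M0 l (S - T))"
proof -
  have "M0 k S = (\<Prod>X\<in>S. nbinom (a X)) * (\<Sum>j\<in>S. N0 a (k + a j) (S - {j}) / cbinom (a j))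
     + (\<Sum>l=0..k. (\<Prod>X\<in>S. nbinom (a X)) * set_conv (N0 a l) (N0 a (k - l)) S)"
    unfolding M0_def using N0_rec[of S a k, OF fin a k(1)] k(2) by (simp add: distrib_left sum_distrib_left)
  also have "\<dots> = (\<Sum>j\<in>S. real (a j) * M0 (k + a j) (S - {j})) + (\<Sum>l=0..k. \<Sum>T\<in>Pow S. M0 l T * M0 (k - l) (S - T))"
    unfolding join_scale[OF fin] conv_scale[OF fin] M0_def ..
  also have "(\<Sum>l=0..k. \<Sum>T\<in>Pow S. M0 l T * M0 (k - l) (S - T)) = (\<Sum>l=1..<k. \<Sum>T\<in>Pow S. M0 l T * M0 (k - l) (S - T))"
    using k by (intro sum_interior) (simp_all add: M0_def)
  finally show ?thesis
    unfolding sum_rev_interior[where f="\<lambda>u v. \<Sum>T\<in>Pow S. M0 u T * M0 v (S - T)"] .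
qed

theorem M1_rec:
  assumes fin: "finite S" and a: "\<And>j. j \<in> S \<Longrightarrow> a j \<ge> 1" and k: "k \<ge> 1"
  shows "M1 k S = (\<Sum>j\<in>S. real (a j) * M1 (k + a j) (S - {j}))
    + (\<Sum>l=1..<k. M00 (k - l) l S + (\<Sum>T\<in>Pow S. M0 (k - l) T * M1 l (S - T) + M1 (k - l) T * M0 l (S - T)))"
proof -
  let ?p = "\<Prod>X\<in>S. nbinom (a X)"
  have cut: "?p * ((\<Sum>l=0..k. nbinom l * nbinom (k - l)) * Fs a (2 * real k) S / (2 * real k)) = (\<Sum>l=1..<k. M00 (k - l) l S)"
  proof -
    have "?p * ((\<Sum>l=0..k. nbinom l * nbinom (k - l)) * Fs a (2 * real k) S / (2 * real k))
       = (\<Sum>l=0..k. ?p * (nbinom (k - l) * nbinom l * Fs a (2 * real k) S / (2 * real k)))"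
      unfolding sum_distrib_left sum_distrib_right sum_divide_distrib by (intro sum.cong refl) simp
    also have "\<dots> = (\<Sum>l=1..<k. ?p * (nbinom (k - l) * nbinom l * Fs a (2 * real k) S / (2 * real k)))"
      using k by (intro sum_interior) simp_all
    also have "\<dots> = (\<Sum>l=1..<k. M00 (k - l) l S)"
      unfolding M00_def by (intro sum.cong refl) simp
    finally show ?thesis .
  qed
  have flip: "(\<Sum>l=1..<k. set_conv (N0 a l) (N1 a (k - l)) S) = (\<Sum>l=1..<k. set_conv (N1 a l) (N0 a (k - l)) S)"
    by (rule sum.reindex_bij_witness[of _ "\<lambda>l. k - l" "\<lambda>l. k - l"]) (auto simp: set_conv_commute[of "N0 a _"])
  have int: "(\<Sum>l=0..k. set_conv (N0 a l) (N1 a (k - l)) S) = (\<Sum>l=1..<k. set_conv (N0 a l) (N1 a (k - l)) S)"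
    using k by (intro sum_interior) (simp_all add: set_conv_def)
  have "M1 k S = ?p * (\<Sum>j\<in>S. N1 a (k + a j) (S - {j}) / cbinom (a j))
     + ?p * ((\<Sum>l=0..k. nbinom l * nbinom (k - l)) * Fs a (2 * real k) S / (2 * real k))
     + (?p * (\<Sum>l=1..<k. set_conv (N0 a l) (N1 a (k - l)) S) + ?p * (\<Sum>l=1..<k. set_conv (N1 a l) (N0 a (k - l)) S))"
    unfolding M1_def flip[symmetric] int[symmetric] using N1_rec[of S a k, OF fin a k] by (simp add: distrib_left)
  also have "\<dots> = (\<Sum>j\<in>S. real (a j) * M1 (k + a j) (S - {j})) + (\<Sum>l=1..<k. M00 (k - l) l S)
     + ((\<Sum>l=1..<k. \<Sum>T\<in>Pow S. M0 l T * M1 (k - l) (S - T)) + (\<Sum>l=1..<k. \<Sum>T\<in>Pow S. M1 l T * M0 (k - l) (S - T)))"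
    unfolding cut sum_distrib_left[of _ _ "{1..<k}"] join_scale[OF fin] conv_scale[OF fin] M0_def M1_def ..
  finally show ?thesis
    unfolding sum.distrib
      sum_rev_interior[where f="\<lambda>u v. \<Sum>T\<in>Pow S. M0 u T * M1 v (S - T)"]
      sum_rev_interior[where f="\<lambda>u v. \<Sum>T\<in>Pow S. M1 u T * M0 v (S - T)"] by (simp only: add.assoc)
qed

end

section \<open>Removing the last transposition\<close>

text \<open>With transpositions coded as pairs of a smaller and a larger entry, monotonicity is
  sortedness of the second components. The functions return with \<open>trs\<close>.\<close>

definition mono_seqs :: "nat set \<Rightarrow> nat \<Rightarrow> (nat \<times> nat) list set" where
  "mono_seqs A r = {ps. length ps = r \<and> (\<forall>(a, b)\<in>set ps. a \<in> A \<and> b \<in> A \<and> a < b) \<and> sorted (map snd ps)}"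

definition prod_tr :: "(nat \<times> nat) list \<Rightarrow> nat \<Rightarrow> nat" where
  "prod_tr ps = foldr (\<lambda>(a, b) f. transpose a b \<circ> f) ps id"

text \<open>No edge of the graph formed by the pairs leaves B: inside a ground set, B is a union of
  connected components.\<close>

definition stable :: "nat set \<Rightarrow> (nat \<times> nat) list \<Rightarrow> bool" where
  "stable B ps \<longleftrightarrow> (\<forall>(a, b)\<in>set ps. a \<in> B \<longleftrightarrow> b \<in> B)"

definition connected_seq :: "nat set \<Rightarrow> (nat \<times> nat) list \<Rightarrow> bool" where
  "connected_seq A ps \<longleftrightarrow> (\<forall>B. B \<subseteq> A \<longrightarrow> B \<noteq> {} \<longrightarrow> stable B ps \<longrightarrow> B = A)"

text \<open>The product is compared with \<sigma> on A only, so that the same permutation serves for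
  all its invariant sets and never has to be restricted.\<close>

definition mono_facts :: "nat set \<Rightarrow> (nat \<Rightarrow> nat) \<Rightarrow> nat \<Rightarrow> (nat \<times> nat) list set" where
  "mono_facts A \<sigma> r = {ps \<in> mono_seqs A r. connected_seq A ps \<and> (\<forall>x\<in>A. prod_tr ps x = \<sigma> x)}"

lemma finite_mono_seqs: "finite A \<Longrightarrow> finite (mono_seqs A r)"
  by (rule finite_subset[OF _ finite_lists_length_eq[of "A \<times> A" r]]) (auto simp: mono_seqs_def)

lemma finite_mono_facts: "finite A \<Longrightarrow> finite (mono_facts A \<sigma> r)"
  by (rule finite_subset[OF _ finite_mono_seqs[of A r]]) (auto simp: mono_facts_def)

lemma prod_tr_Nil [simp]: "prod_tr [] = id"
  by (simp add: prod_tr_def)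

lemma prod_tr_Cons: "prod_tr (p # ps) = transpose (fst p) (snd p) \<circ> prod_tr ps"
  by (simp add: prod_tr_def case_prod_unfold)

lemma prod_tr_append: "prod_tr (ps @ qs) = prod_tr ps \<circ> prod_tr qs"
  by (induction ps) (simp_all add: prod_tr_Cons comp_assoc)

lemma prod_tr_snoc: "prod_tr (ps @ [(a, b)]) = prod_tr ps \<circ> transpose a b"
  by (simp add: prod_tr_append prod_tr_Cons)

lemma stable_Cons: "stable B (p # ps) \<longleftrightarrow> (fst p \<in> B \<longleftrightarrow> snd p \<in> B) \<and> stable B ps"
  by (auto simp: stable_def)

lemma stable_snoc: "stable B (ps @ [(a, b)]) \<longleftrightarrow> stable B ps \<and> (a \<in> B \<longleftrightarrow> b \<in> B)"
  by (auto simp: stable_def)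

lemma stable_Int: "stable B ps \<Longrightarrow> stable C ps \<Longrightarrow> stable (B \<inter> C) ps"
  and stable_Diff: "stable B ps \<Longrightarrow> stable C ps \<Longrightarrow> stable (B - C) ps"
  by (auto simp: stable_def)

lemma stable_self: "ps \<in> mono_seqs A r \<Longrightarrow> stable A ps"
  by (auto simp: stable_def mono_seqs_def)

lemma prod_tr_stable:
  assumes "stable B ps" "x \<in> B"
  shows "prod_tr ps x \<in> B \<and> prod_tr ps x = prod_tr (filter (\<lambda>p. fst p \<in> B) ps) x"
  using assms
proof (induction ps)
  case (Cons p ps)
  have IH: "prod_tr ps x \<in> B" "prod_tr ps x = prod_tr (filter (\<lambda>p. fst p \<in> B) ps) x"
    using Cons by (auto simp: stable_Cons)
  have s: "fst p \<in> B \<longleftrightarrow> snd p \<in> B" using Cons.prems by (simp add: stable_Cons)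
  show ?case
  proof (cases "fst p \<in> B")
    case True
    then show ?thesis using IH s by (simp add: prod_tr_Cons) (auto simp: transpose_def)
  next
    case False
    then show ?thesis using IH s by (simp add: prod_tr_Cons) (auto simp: transpose_def)
  qed
qed simp

lemma mono_seqs_snoc:
  assumes "finite A"
  shows "ps @ [(a, Max A)] \<in> mono_seqs A (Suc r) \<longleftrightarrow> ps \<in> mono_seqs A r \<and> a \<in> A - {Max A} \<and> Max A \<in> A"
proof -
  have "b \<le> Max A" if "b \<in> A" for b using assms that by simp
  then show ?thesis
    by (fastforce simp: mono_seqs_def sorted_append less_le)
qed

text \<open>By connectedness \<open>Max A\<close> is not isolated. A pair containing it has it as
  larger entry, and sortedness carries this entry to the last pair.\<close>

lemma mono_facts_Suc_snoc:
  assumes fin: "finite A" and card: "card A \<ge> 2" and ps: "qs \<in> mono_facts A \<sigma> (Suc r)"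
  shows "\<exists>ps a. qs = ps @ [(a, Max A)]"
proof -
  let ?m = "Max A"
  have m: "?m \<in> A" using card fin by (intro Max_in) auto
  have q: "qs \<in> mono_seqs A (Suc r)" and c: "connected_seq A qs" using ps by (auto simp: mono_facts_def)
  have "qs \<noteq> []" using q by (auto simp: mono_seqs_def)
  then obtain ps a b where qs: "qs = ps @ [(a, b)]" by (metis rev_exhaust surj_pair)
  have "\<not> stable {?m} qs"
  proof
    assume "stable {?m} qs"
    then have "{?m} = A" using c m unfolding connected_seq_def by blast
    then show False using card by (metis card.empty card_insert_disjoint empty_iff finite.emptyI numeral_2_eq_2 One_nat_def not_less_eq_eq le_refl)
  qed
  then obtain x y where xy: "(x, y) \<in> set qs" "x = ?m \<or> y = ?m" by (auto simp: stable_def)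
  have "x \<in> A" "y \<in> A" "x < y" using q xy by (auto simp: mono_seqs_def)
  then have "y = ?m" using xy(2) fin by (metis Max_ge leD)
  moreover have "y \<le> b" using q xy(1) unfolding qs by (auto simp: mono_seqs_def sorted_append)
  moreover have "b \<le> ?m" using q fin unfolding qs by (auto simp: mono_seqs_def)
  ultimately show ?thesis using qs by auto
qed

definition ext_facts :: "nat set \<Rightarrow> (nat \<Rightarrow> nat) \<Rightarrow> nat \<Rightarrow> nat \<Rightarrow> (nat \<times> nat) list set" where
  "ext_facts A \<tau> a r = {ps \<in> mono_seqs A r. (\<forall>x\<in>A. prod_tr ps x = \<tau> x) \<and> connected_seq A (ps @ [(a, Max A)])}"

lemma mono_facts_Suc:
  assumes fin: "finite A" and card: "card A \<ge> 2"
  shows "mono_facts A \<sigma> (Suc r)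
    = (\<Union>a\<in>A - {Max A}. (\<lambda>ps. ps @ [(a, Max A)]) ` ext_facts A (\<sigma> \<circ> transpose a (Max A)) a r)"
    (is "?L = ?R")
proof -
  let ?m = "Max A"
  have m: "?m \<in> A" using card fin by (intro Max_in) auto
  have eq: "(\<forall>x\<in>A. prod_tr (ps @ [(a, ?m)]) x = \<sigma> x) \<longleftrightarrow> (\<forall>x\<in>A. prod_tr ps x = (\<sigma> \<circ> transpose a ?m) x)"
    if "a \<in> A" for ps a
  proof -
    have t: "transpose a ?m x \<in> A" if "x \<in> A" for x using \<open>a \<in> A\<close> m that by (auto simp: transpose_def)
    show ?thesis unfolding prod_tr_snoc o_apply using t by (metis transpose_involutory)
  qed
  have key: "ps @ [(a, ?m)] \<in> ?L \<longleftrightarrow> a \<in> A - {?m} \<and> ps \<in> ext_facts A (\<sigma> \<circ> transpose a ?m) a r" for ps a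
    using eq[of a ps] mono_seqs_snoc[OF fin, of ps a r] m by (auto simp: mono_facts_def ext_facts_def)
  show ?thesis
  proof (intro subset_antisym subsetI)
    fix qs assume qs: "qs \<in> ?L"
    obtain ps a where "qs = ps @ [(a, ?m)]" using mono_facts_Suc_snoc[OF fin card qs] by blast
    then show "qs \<in> ?R" using qs key[of ps a] by blast
  next
    fix qs assume "qs \<in> ?R"
    then obtain ps a where "qs = ps @ [(a, ?m)]" "a \<in> A - {?m}" "ps \<in> ext_facts A (\<sigma> \<circ> transpose a ?m) a r" by blast
    then show "qs \<in> ?L" using key[of ps a] by blast
  qed
qed

lemma card_mono_facts_Suc:
  assumes fin: "finite A" and card: "card A \<ge> 2"
  shows "card (mono_facts A \<sigma> (Suc r)) = (\<Sum>a\<in>A - {Max A}. card (ext_facts A (\<sigma> \<circ> transpose a (Max A)) a r))"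
proof -
  have f: "finite (ext_facts A \<tau> a r)" for \<tau> a
    by (rule finite_subset[OF _ finite_mono_seqs[OF fin, of r]]) (auto simp: ext_facts_def)
  show ?thesis
    unfolding mono_facts_Suc[OF assms]
    using fin f by (subst card_UN_disjoint) (auto simp: card_image inj_on_def)
qed

section \<open>Sequences with two components\<close>

definition split_facts :: "nat set \<Rightarrow> (nat \<Rightarrow> nat) \<Rightarrow> nat set \<Rightarrow> nat \<Rightarrow> (nat \<times> nat) list set" where
  "split_facts A \<tau> B r = {ps \<in> mono_seqs A r. (\<forall>x\<in>A. prod_tr ps x = \<tau> x) \<and> stable B ps \<and>
     connected_seq B (filter (\<lambda>p. fst p \<in> B) ps) \<and> connected_seq (A - B) (filter (\<lambda>p. fst p \<in> A - B) ps)}"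

lemma stable_if_filter: "stable B ps \<Longrightarrow> D \<subseteq> B \<Longrightarrow> stable D (filter (\<lambda>p. fst p \<in> B) ps) \<Longrightarrow> stable D ps"
  by (fastforce simp: stable_def)

lemma stable_filterI: "stable D ps \<Longrightarrow> stable D (filter P ps)"
  by (auto simp: stable_def)

lemma connected_seqD: "connected_seq A ps \<Longrightarrow> B \<subseteq> A \<Longrightarrow> stable B ps \<Longrightarrow> B = {} \<or> B = A"
  by (auto simp: connected_seq_def)

text \<open>When the edge from \<open>a\<close> to \<open>Max A\<close> is removed, the graph is still connected or has exactly two
  components, of which \<open>B\<close> is the one of \<open>Max A\<close>.\<close>

lemma ext_facts_decomp:
  assumes a: "a \<in> A" and m: "Max A \<in> A" "a \<noteq> Max A"
  shows "ext_facts A \<tau> a r = mono_facts A \<tau> r \<union> (\<Union>B\<in>{B. B \<subseteq> A \<and> Max A \<in> B \<and> a \<notin> B}. split_facts A \<tau> B r)"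
    (is "?L = ?R")
proof (intro subset_antisym subsetI)
  let ?m = "Max A"
  fix ps assume ps: "ps \<in> ?L"
  then have seq: "ps \<in> mono_seqs A r" and prod: "\<forall>x\<in>A. prod_tr ps x = \<tau> x" and con: "connected_seq A (ps @ [(a, ?m)])"
    by (auto simp: ext_facts_def)
  have sA: "stable A ps" by (rule stable_self[OF seq])
  \<comment> \<open>A set that no edge of \<open>ps\<close> leaves and that does not separate
    \<open>a\<close> from \<open>Max A\<close> also survives the additional edge.\<close>
  have key: "D = A" if "D \<subseteq> A" "D \<noteq> {}" "stable D ps" "a \<in> D \<longleftrightarrow> ?m \<in> D" for D
    using con that unfolding connected_seq_def stable_snoc by blast
  show "ps \<in> ?R"
  proof (cases "connected_seq A ps")
    case True
    then show ?thesis using seq prod by (auto simp: mono_facts_def)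
  next
    case False
    then obtain D where D: "D \<subseteq> A" "D \<noteq> {}" "stable D ps" "D \<noteq> A" by (auto simp: connected_seq_def)
    \<comment> \<open>Both D and its complement are unions of components; the one containing
      \<open>Max A\<close> is taken.\<close>
    define B where "B = (if ?m \<in> D then D else A - D)"
    have B: "B \<subseteq> A" "?m \<in> B" "stable B ps" "B \<noteq> A"
      using D m sA by (auto simp: B_def stable_Diff)
    have aB: "a \<notin> B" using key[of B] B by auto
    have "connected_seq B (filter (\<lambda>p. fst p \<in> B) ps)"
      unfolding connected_seq_def
    proof (intro allI impI)
      fix E assume E: "E \<subseteq> B" "E \<noteq> {}" "stable E (filter (\<lambda>p. fst p \<in> B) ps)"
      have sE: "stable E ps" using stable_if_filter[OF B(3) E(1,3)] .
      show "E = B"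
      proof (cases "?m \<in> E")
        case False
        then have "E = A" using E B aB sE by (intro key) auto
        then show ?thesis using False m by simp
      next
        case True
        show ?thesis
        proof (rule ccontr)
          assume "E \<noteq> B"
          then have "B - E = A" using E B aB sE True by (intro key) (auto intro: stable_Diff)
          then show False using True m by auto
        qed
      qed
    qed
    moreover have "connected_seq (A - B) (filter (\<lambda>p. fst p \<in> A - B) ps)"
      unfolding connected_seq_def
    proof (intro allI impI)
      have s: "stable (A - B) ps" using sA B by (simp add: stable_Diff)
      fix E assume E: "E \<subseteq> A - B" "E \<noteq> {}" "stable E (filter (\<lambda>p. fst p \<in> A - B) ps)"
      have sE: "stable E ps" using stable_if_filter[OF s E(1,3)] .
      show "E = A - B"
      proof (cases "a \<in> E")
        case False
        then have "E = A" using E B aB sE by (intro key) auto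
        then show ?thesis using False a by simp
      next
        case True
        show ?thesis
        proof (rule ccontr)
          assume "E \<noteq> A - B"
          then have "(A - B) - E = A" using E B aB sE s True by (intro key) (auto intro: stable_Diff)
          then show False using True a by auto
        qed
      qed
    qed
    ultimately have "ps \<in> split_facts A \<tau> B r" using seq prod B by (auto simp: split_facts_def)
    then show ?thesis using B aB by blast
  qed
next
  let ?m = "Max A"
  fix ps assume "ps \<in> ?R"
  then consider "ps \<in> mono_facts A \<tau> r" | B where "B \<subseteq> A" "?m \<in> B" "a \<notin> B" "ps \<in> split_facts A \<tau> B r" by auto
  then show "ps \<in> ?L"
  proof cases
    case 1
    then show ?thesis by (auto simp: mono_facts_def ext_facts_def connected_seq_def stable_snoc)
  next
    case 2
    then have B: "stable B ps" "connected_seq B (filter (\<lambda>p. fst p \<in> B) ps)"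
       "connected_seq (A - B) (filter (\<lambda>p. fst p \<in> A - B) ps)"
       and seq: "ps \<in> mono_seqs A r" "\<forall>x\<in>A. prod_tr ps x = \<tau> x"
      by (auto simp: split_facts_def)
    have sA: "stable A ps" by (rule stable_self[OF seq(1)])
    have "D = A" if D: "D \<subseteq> A" "D \<noteq> {}" "stable D ps" "a \<in> D \<longleftrightarrow> ?m \<in> D" for D
    proof -
      have 1: "D \<inter> B = {} \<or> D \<inter> B = B"
        by (rule connected_seqD[OF B(2) _ stable_filterI[OF stable_Int[OF D(3) B(1)]]]) simp
      have "stable (D - B) ps" using D(3) B(1) by (rule stable_Diff)
      then have 2: "D - B = {} \<or> D - B = A - B"
        using D(1) by (intro connected_seqD[OF B(3)] stable_filterI) auto
      show ?thesis
      proof (cases "?m \<in> D")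
        case True
        then have "D \<inter> B = B" "D - B = A - B" using 1 2 D(4) \<open>?m \<in> B\<close> \<open>a \<notin> B\<close> by auto
        then show ?thesis using \<open>B \<subseteq> A\<close> D(1) by auto
      next
        case False
        then have "D \<inter> B = {}" "D - B = {}" using 1 2 D(4) \<open>?m \<in> B\<close> \<open>a \<notin> B\<close> a by auto
        then show ?thesis using D(2) by auto
      qed
    qed
    then show ?thesis using seq by (auto simp: ext_facts_def connected_seq_def stable_snoc)
  qed
qed

lemma split_facts_disjoint:
  assumes "B \<subseteq> A" "C \<subseteq> A" "x \<in> B" "x \<in> C" "ps \<in> split_facts A \<tau> B r" "ps \<in> split_facts A \<tau> C r"
  shows "B = C"
proof -
  have B: "stable B ps" "connected_seq B (filter (\<lambda>p. fst p \<in> B) ps)"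
    and C: "stable C ps" "connected_seq C (filter (\<lambda>p. fst p \<in> C) ps)"
    using assms by (auto simp: split_facts_def)
  have "B \<inter> C = B" using connected_seqD[OF B(2) _ stable_filterI[OF stable_Int[OF B(1) C(1)]]] assms(3,4) by auto
  moreover have "B \<inter> C = C" using connected_seqD[OF C(2) _ stable_filterI[OF stable_Int[OF B(1) C(1)]]] assms(3,4) by auto
  ultimately show ?thesis by simp
qed

text \<open>A split sequence has a product that preserves B, so sets that are not invariant under
  \<tau> contribute nothing. Invariant sets can later be indexed by sets of cycles.\<close>

lemma card_ext_facts:
  assumes fin: "finite A" and a: "a \<in> A" and m: "Max A \<in> A" "a \<noteq> Max A"
  shows "card (ext_facts A \<tau> a r) = card (mono_facts A \<tau> r)
     + (\<Sum>B | B \<subseteq> A \<and> Max A \<in> B \<and> a \<notin> B \<and> (\<forall>x\<in>B. \<tau> x \<in> B). card (split_facts A \<tau> B r))"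
proof -
  let ?m = "Max A"
  let ?I = "{B. B \<subseteq> A \<and> ?m \<in> B \<and> a \<notin> B}"
  have finI: "finite ?I" by (rule finite_subset[of _ "Pow A"]) (use fin in auto)
  have f: "finite (split_facts A \<tau> B r)" for B
    by (rule finite_subset[OF _ finite_mono_seqs[OF fin, of r]]) (auto simp: split_facts_def)
  have disj: "mono_facts A \<tau> r \<inter> (\<Union>B\<in>?I. split_facts A \<tau> B r) = {}"
  proof (rule equals0I)
    fix ps assume "ps \<in> mono_facts A \<tau> r \<inter> (\<Union>B\<in>?I. split_facts A \<tau> B r)"
    then obtain B where "B \<subseteq> A" "?m \<in> B" "a \<notin> B" "stable B ps" "connected_seq A ps"
      by (auto simp: mono_facts_def split_facts_def)
    then have "B = A" unfolding connected_seq_def by blast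
    then show False using a \<open>a \<notin> B\<close> by simp
  qed
  have "card (ext_facts A \<tau> a r) = card (mono_facts A \<tau> r) + card (\<Union>B\<in>?I. split_facts A \<tau> B r)"
    unfolding ext_facts_decomp[OF a m] using finI f disj finite_mono_facts[OF fin] by (intro card_Un_disjoint) auto
  also have "card (\<Union>B\<in>?I. split_facts A \<tau> B r) = (\<Sum>B\<in>?I. card (split_facts A \<tau> B r))"
  proof (intro card_UN_disjoint finI ballI f impI)
    fix B C assume "B \<in> ?I" "C \<in> ?I" "B \<noteq> C"
    then show "split_facts A \<tau> B r \<inter> split_facts A \<tau> C r = {}"
      using split_facts_disjoint[of B A C ?m _ \<tau> r] by blast
  qed
  also have "\<dots> = (\<Sum>B | B \<subseteq> A \<and> ?m \<in> B \<and> a \<notin> B \<and> (\<forall>x\<in>B. \<tau> x \<in> B). card (split_facts A \<tau> B r))"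
  proof (rule sum.mono_neutral_right[OF finI])
    show "\<forall>B\<in>?I - {B. B \<subseteq> A \<and> ?m \<in> B \<and> a \<notin> B \<and> (\<forall>x\<in>B. \<tau> x \<in> B)}. card (split_facts A \<tau> B r) = 0"
    proof
      fix B assume B: "B \<in> ?I - {B. B \<subseteq> A \<and> ?m \<in> B \<and> a \<notin> B \<and> (\<forall>x\<in>B. \<tau> x \<in> B)}"
      then obtain x where x: "x \<in> B" "\<tau> x \<notin> B" "x \<in> A" by auto
      have "split_facts A \<tau> B r = {}"
      proof (rule equals0I)
        fix ps assume "ps \<in> split_facts A \<tau> B r"
        then have "stable B ps" "prod_tr ps x = \<tau> x" using x by (auto simp: split_facts_def)
        then show False using prod_tr_stable[of B ps x] x by auto
      qed
      then show "card (split_facts A \<tau> B r) = 0" by simp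
    qed
  qed auto
  finally show ?thesis .
qed

text \<open>The sort is stable: the original order is restored as soon as pairs with equal larger
  entries belong to the same sublist.\<close>

lemma sort_key_merge:
  assumes "sorted (map snd ps)" "\<And>p q. p \<in> set ps \<Longrightarrow> q \<in> set ps \<Longrightarrow> snd p = snd q \<Longrightarrow> P p = P q"
  shows "sort_key snd (filter P ps @ filter (\<lambda>p. \<not> P p) ps) = ps"
proof (rule properties_for_sort_key)
  show "mset ps = mset (filter P ps @ filter (\<lambda>p. \<not> P p) ps)" by simp
  show "sorted (map snd ps)" by fact
  fix k assume k: "k \<in> set ps"
  have "filter (\<lambda>x. snd k = snd x) (filter P ps) @ filter (\<lambda>x. snd k = snd x) (filter (\<lambda>p. \<not> P p) ps)
     = filter (\<lambda>x. snd k = snd x) ps"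
  proof (cases "P k")
    case True
    then have "filter (\<lambda>x. snd k = snd x) (filter P ps) = filter (\<lambda>x. snd k = snd x) ps"
       "filter (\<lambda>x. snd k = snd x) (filter (\<lambda>p. \<not> P p) ps) = []"
      using assms(2)[OF k] by (auto intro!: filter_cong simp: filter_empty_conv)
    then show ?thesis by simp
  next
    case False
    then have "filter (\<lambda>x. snd k = snd x) (filter P ps) = []"
       "filter (\<lambda>x. snd k = snd x) (filter (\<lambda>p. \<not> P p) ps) = filter (\<lambda>x. snd k = snd x) ps"
      using assms(2)[OF k] by (auto intro!: filter_cong simp: filter_empty_conv)
    then show ?thesis by simp
  qed
  then show "filter (\<lambda>x. snd k = snd x) ps = filter (\<lambda>x. snd k = snd x) (filter P ps @ filter (\<lambda>p. \<not> P p) ps)"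
    by simp
qed

text \<open>The two monotone sequences move disjoint sets of points, so that their larger entries never tie and
  there is only one monotone way to merge them.\<close>

lemma card_split_facts:
  assumes fin: "finite A" and B: "B \<subseteq> A"
  shows "card (split_facts A \<tau> B r) = (\<Sum>i\<le>r. card (mono_facts B \<tau> i) * card (mono_facts (A - B) \<tau> (r - i)))"
proof -
  let ?C = "A - B"
  let ?F = "\<lambda>ps. (filter (\<lambda>p. fst p \<in> B) ps, filter (\<lambda>p. fst p \<in> ?C) ps)"
  let ?G = "\<lambda>(ps, qs). sort_key snd (ps @ qs) :: (nat \<times> nat) list"
  let ?R = "\<Union>i\<in>{..r}. mono_facts B \<tau> i \<times> mono_facts ?C \<tau> (r - i)"
  have notB: "filter (\<lambda>p. fst p \<in> ?C) ps = filter (\<lambda>p. fst p \<notin> B) ps" if "ps \<in> mono_seqs A r" for ps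
    using that by (intro filter_cong) (auto simp: mono_seqs_def)
  have "bij_betw ?F (split_facts A \<tau> B r) ?R"
  proof (rule bij_betw_byWitness[where f' = ?G])
    show "\<forall>ps\<in>split_facts A \<tau> B r. ?G (?F ps) = ps"
    proof
      fix ps assume "ps \<in> split_facts A \<tau> B r"
      then have ps: "ps \<in> mono_seqs A r" "stable B ps" by (auto simp: split_facts_def)
      have "fst p \<in> B \<longleftrightarrow> snd p \<in> B" if "p \<in> set ps" for p
        using ps(2) that by (auto simp: stable_def)
      then have st: "(fst p \<in> B) = (fst q \<in> B)" if "p \<in> set ps" "q \<in> set ps" "snd p = snd q" for p q
        using that by simp
      have "sorted (map snd ps)" using ps(1) by (simp add: mono_seqs_def)
      then have "sort_key snd (filter (\<lambda>p. fst p \<in> B) ps @ filter (\<lambda>p. \<not> fst p \<in> B) ps) = ps"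
        by (rule sort_key_merge[where P = "\<lambda>p. fst p \<in> B"]) (rule st)
      then show "?G (?F ps) = ps" by (simp only: prod.case notB[OF ps(1)])
    qed
    show "\<forall>pq\<in>?R. ?F (?G pq) = pq"
    proof
      fix pq assume "pq \<in> ?R"
      then obtain i ps qs where pq: "pq = (ps, qs)" "ps \<in> mono_seqs B i" "qs \<in> mono_seqs ?C (r - i)"
        by (auto simp: mono_facts_def)
      have 1: "filter (\<lambda>p. fst p \<in> B) ps = ps" "filter (\<lambda>p. fst p \<in> B) qs = []"
          "filter (\<lambda>p. fst p \<in> ?C) ps = []" "filter (\<lambda>p. fst p \<in> ?C) qs = qs"
        using pq by (auto simp: mono_seqs_def filter_empty_conv intro!: filter_True)
      have 2: "sort_key snd ps = ps" "sort_key snd qs = qs"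
        using pq by (auto simp: mono_seqs_def intro: sort_key_id_if_sorted sorted_sort_id)
      show "?F (?G pq) = pq"
        unfolding pq(1) prod.case filter_sort filter_append 1 by (simp add: 2)
    qed
    show "?F ` split_facts A \<tau> B r \<subseteq> ?R"
    proof (rule image_subsetI)
      fix ps assume "ps \<in> split_facts A \<tau> B r"
      then have ps: "ps \<in> mono_seqs A r" "stable B ps" "\<forall>x\<in>A. prod_tr ps x = \<tau> x"
        "connected_seq B (filter (\<lambda>p. fst p \<in> B) ps)" "connected_seq ?C (filter (\<lambda>p. fst p \<in> ?C) ps)"
        by (auto simp: split_facts_def)
      let ?i = "length (filter (\<lambda>p. fst p \<in> B) ps)"
      have sC: "stable ?C ps" using stable_self[OF ps(1)] ps(2) by (rule stable_Diff)
      have len: "length (filter (\<lambda>p. fst p \<in> ?C) ps) = r - ?i" "?i \<le> r"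
        using sum_length_filter_compl[of "\<lambda>p. fst p \<in> B" ps] ps(1) unfolding notB[OF ps(1)]
        by (auto simp: mono_seqs_def)
      have srt: "sorted (map snd (filter P ps))" for P
        using ps(1) by (auto simp: mono_seqs_def intro: sorted_filter)
      have "filter (\<lambda>p. fst p \<in> B) ps \<in> mono_facts B \<tau> ?i"
        using ps srt prod_tr_stable[OF ps(2)] B
        by (fastforce simp: mono_facts_def mono_seqs_def stable_def)
      moreover have "filter (\<lambda>p. fst p \<in> ?C) ps \<in> mono_facts ?C \<tau> (r - ?i)"
        using ps srt prod_tr_stable[OF sC] sC len
        by (fastforce simp: mono_facts_def mono_seqs_def stable_def)
      ultimately show "?F ps \<in> ?R" using len by auto
    qed
    show "?G ` ?R \<subseteq> split_facts A \<tau> B r"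
    proof (rule image_subsetI)
      fix pq assume "pq \<in> ?R"
      then obtain i ps qs where pq: "pq = (ps, qs)" "i \<le> r" "ps \<in> mono_facts B \<tau> i" "qs \<in> mono_facts ?C \<tau> (r - i)"
        by auto
      let ?s = "sort_key snd (ps @ qs)"
      have p: "ps \<in> mono_seqs B i" "connected_seq B ps" "\<forall>x\<in>B. prod_tr ps x = \<tau> x"
        and q: "qs \<in> mono_seqs ?C (r - i)" "connected_seq ?C qs" "\<forall>x\<in>?C. prod_tr qs x = \<tau> x"
        using pq by (auto simp: mono_facts_def)
      have 1: "filter (\<lambda>p. fst p \<in> B) ps = ps" "filter (\<lambda>p. fst p \<in> B) qs = []"
          "filter (\<lambda>p. fst p \<in> ?C) ps = []" "filter (\<lambda>p. fst p \<in> ?C) qs = qs"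
        using p(1) q(1) by (auto simp: mono_seqs_def filter_empty_conv intro!: filter_True)
      have 2: "sort_key snd ps = ps" "sort_key snd qs = qs"
        using p(1) q(1) by (auto simp: mono_seqs_def intro: sort_key_id_if_sorted sorted_sort_id)
      have F: "filter (\<lambda>p. fst p \<in> B) ?s = ps" "filter (\<lambda>p. fst p \<in> ?C) ?s = qs"
        unfolding filter_sort filter_append 1 by (simp_all add: 2)
      have s: "?s \<in> mono_seqs A r"
        using p(1) q(1) pq(2) B by (fastforce simp: mono_seqs_def)
      have sB: "stable B ?s" and sC: "stable ?C ?s"
        using p(1) q(1) by (fastforce simp: mono_seqs_def stable_def)+
      have "prod_tr ?s x = \<tau> x" if "x \<in> A" for x
        using prod_tr_stable[OF sB, of x] prod_tr_stable[OF sC, of x] that p(3) q(3) unfolding F by (cases "x \<in> B") auto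
      then show "?G pq \<in> split_facts A \<tau> B r"
        using s sB F p(2) q(2) by (simp add: split_facts_def pq(1))
    qed
  qed
  then have "card (split_facts A \<tau> B r) = card ?R" by (rule bij_betw_same_card)
  also have "\<dots> = (\<Sum>i\<le>r. card (mono_facts B \<tau> i \<times> mono_facts ?C \<tau> (r - i)))"
  proof (rule card_UN_disjoint)
    show "\<forall>i\<in>{..r}. finite (mono_facts B \<tau> i \<times> mono_facts ?C \<tau> (r - i))"
      using fin finite_subset[OF B] finite_mono_facts by auto
    show "\<forall>i\<in>{..r}. \<forall>j\<in>{..r}. i \<noteq> j \<longrightarrow>
      (mono_facts B \<tau> i \<times> mono_facts ?C \<tau> (r - i)) \<inter> (mono_facts B \<tau> j \<times> mono_facts ?C \<tau> (r - j)) = {}"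
      by (auto simp: mono_facts_def mono_seqs_def)
  qed simp
  finally show ?thesis by (simp add: card_cartesian_product)
qed

section \<open>Orbits after multiplication by a transposition\<close>

lemma orbit_eq_if_mem: "permutation \<sigma> \<Longrightarrow> y \<in> orbit \<sigma> x \<Longrightarrow> orbit \<sigma> y = orbit \<sigma> x"
  using orbit_cyclic_eq3[OF cyclic_on_orbit'] by metis

text \<open>Exponents run from 1 to k instead of from 0 to k - 1. Then m comes last, and a cut
  divides the orbit into the intervals up to i and after i.\<close>

lemma orbit_powers:
  fixes \<sigma> :: "'a \<Rightarrow> 'a" and m :: 'a
  assumes "permutation \<sigma>"
  defines "k \<equiv> card (orbit \<sigma> m)"
  shows "k > 0" "(\<sigma> ^^ k) m = m" "inj_on (\<lambda>i. (\<sigma> ^^ i) m) {1..k}" "orbit \<sigma> m = (\<lambda>i. (\<sigma> ^^ i) m) ` {1..k}"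
    "\<And>i. 0 < i \<Longrightarrow> i < k \<Longrightarrow> (\<sigma> ^^ i) m \<noteq> m"
proof -
  have self: "m \<in> orbit \<sigma> m" by (rule permutation_self_in_orbit[OF assms(1)])
  let ?d = "funpow_dist1 \<sigma> m m"
  have o: "orbit \<sigma> m = (\<lambda>n. (\<sigma> ^^ n) m) ` {0..<?d}" by (rule orbit_conv_funpow_dist1[OF self])
  have i: "inj_on (\<lambda>n. (\<sigma> ^^ n) m) {0..<?d}" by (rule inj_on_funpow_dist1[OF self])
  have k: "k = ?d" unfolding k_def o using card_image[OF i] by simp
  show k0: "k > 0" using k by simp
  show p: "(\<sigma> ^^ k) m = m" unfolding k by (rule funpow_dist1_prop[OF self])
  have inj: "inj \<sigma>" using assms(1) by (metis bij_is_inj permutation_bijective)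
  show inj1: "inj_on (\<lambda>i. (\<sigma> ^^ i) m) {1..k}"
  proof (rule inj_onI)
    fix u v assume uv: "u \<in> {1..k}" "v \<in> {1..k}" "(\<sigma> ^^ u) m = (\<sigma> ^^ v) m"
    then obtain u' v' where s: "u = Suc u'" "v = Suc v'" by (metis atLeastAtMost_iff not_one_le_zero not0_implies_Suc)
    then have "(\<sigma> ^^ u') m = (\<sigma> ^^ v') m" using uv(3) inj by (simp add: inj_eq)
    then have "u' = v'" using inj_onD[OF i] uv s k by simp
    then show "u = v" using s by simp
  qed
  have "(\<lambda>i. (\<sigma> ^^ i) m) ` {1..k} \<subseteq> orbit \<sigma> m" by (auto simp: orbit_altdef)
  moreover have "card ((\<lambda>i. (\<sigma> ^^ i) m) ` {1..k}) = card (orbit \<sigma> m)"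
    using card_image[OF inj1] by (simp add: k_def)
  ultimately show "orbit \<sigma> m = (\<lambda>i. (\<sigma> ^^ i) m) ` {1..k}"
    using finite_orbit[OF self] by (metis card_subset_eq)
  show "(\<sigma> ^^ i) m \<noteq> m" if "0 < i" "i < k" for i
    using inj_onD[OF inj1, of i k] p that by auto
qed

lemma orbit_transpose_other:
  assumes "permutation \<sigma>" "a \<notin> orbit \<sigma> x" "m \<notin> orbit \<sigma> x"
  shows "orbit (\<sigma> \<circ> transpose a m) x = orbit \<sigma> x"
  using assms by (intro orbit_cong permutation_self_in_orbit) (auto simp: transpose_def)

text \<open>The new permutation maps m to \<sigma>^(i+1) m and \<open>a\<close> to \<sigma> m. Hence
  the cycle of m runs through the exponents i + 1, ..., k and that of \<open>a\<close> through 1,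
  ..., i.\<close>

lemma orbit_cut:
  assumes perm: "permutation \<sigma>" and i: "0 < i" "i < card (orbit \<sigma> m)" and a: "a = (\<sigma> ^^ i) m"
  defines "\<tau> \<equiv> \<sigma> \<circ> transpose a m"
  shows "card (orbit \<tau> m) = card (orbit \<sigma> m) - i" "card (orbit \<tau> a) = i"
    "orbit \<tau> m \<union> orbit \<tau> a = orbit \<sigma> m" "orbit \<tau> m \<inter> orbit \<tau> a = {}"
proof -
  let ?f = "\<lambda>j. (\<sigma> ^^ j) m"
  define k where "k = card (orbit \<sigma> m)"
  note P = orbit_powers[OF perm, where m=m, folded k_def]
  have ik: "0 < i" "i < k" using i by (auto simp: k_def)
  have am: "a \<noteq> m" using P(5)[OF ik] a by simp
  have ne: "?f j \<noteq> a" if "j \<in> {1..k}" "j \<noteq> i" for j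
    using inj_onD[OF P(3), of j i] that ik a by auto
  have t: "\<tau> m = ?f (Suc i)" "\<tau> a = ?f 1" using am a by (auto simp: \<tau>_def)
  have s: "\<tau> (?f j) = ?f (Suc j)" if "0 < j" "j < k" "j \<noteq> i" for j
    using P(5)[OF that(1,2)] ne[of j] that by (simp add: \<tau>_def transpose_def)
  have o1: "orbit \<tau> m = ?f ` {i<..k}"
  proof (intro subset_antisym subsetI)
    fix y assume "y \<in> orbit \<tau> m"
    then show "y \<in> ?f ` {i<..k}"
    proof induction
      case base
      show ?case unfolding t using ik by (intro imageI) auto
    next
      case (step y)
      then obtain j where j: "y = ?f j" "i < j" "j \<le> k" by auto
      show ?case
      proof (cases "j = k")
        case True
        then have "\<tau> y = ?f (Suc i)" using j P(2) t by simp
        then show ?thesis using ik by (intro image_eqI[of _ _ "Suc i"]) auto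
      next
        case False
        then have "\<tau> y = ?f (Suc j)" using j s[of j] by simp
        then show ?thesis using j False by (intro image_eqI[of _ _ "Suc j"]) auto
      qed
    qed
  next
    have "?f (Suc i + j) \<in> orbit \<tau> m" if "Suc i + j \<le> k" for j
      using that
    proof (induction j)
      case 0
      then show ?case using t(1) orbit.base[of \<tau> m] by simp
    next
      case (Suc j)
      then have "\<tau> (?f (Suc i + j)) \<in> orbit \<tau> m" by (auto intro: orbit.step)
      then show ?case using s[of "Suc i + j"] Suc.prems by simp
    qed
    moreover fix y assume "y \<in> ?f ` {i<..k}"
    ultimately show "y \<in> orbit \<tau> m" by (auto dest!: less_imp_Suc_add)
  qed
  have o2: "orbit \<tau> a = ?f ` {1..i}"
  proof (intro subset_antisym subsetI)
    fix y assume "y \<in> orbit \<tau> a"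
    then show "y \<in> ?f ` {1..i}"
    proof induction
      case base
      show ?case unfolding t using ik by (intro imageI) auto
    next
      case (step y)
      then obtain j where j: "y = ?f j" "1 \<le> j" "j \<le> i" by auto
      show ?case
      proof (cases "j = i")
        case True
        then have "\<tau> y = ?f 1" using j a t by simp
        then show ?thesis using ik by (intro image_eqI[of _ _ 1]) auto
      next
        case False
        then have "\<tau> y = ?f (Suc j)" using j ik s[of j] by simp
        then show ?thesis using j False by (intro image_eqI[of _ _ "Suc j"]) auto
      qed
    qed
  next
    have S: "?f (Suc j) \<in> orbit \<tau> a" if "Suc j \<le> i" for j
      using that
    proof (induction j)
      case 0
      then show ?case using t(2) orbit.base[of \<tau> a] by simp
    next
      case (Suc j)
      then have "\<tau> (?f (Suc j)) \<in> orbit \<tau> a" by (auto intro: orbit.step)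
      then show ?case using s[of "Suc j"] Suc.prems ik by simp
    qed
    fix y assume "y \<in> ?f ` {1..i}"
    then obtain j where j: "y = ?f j" "1 \<le> j" "j \<le> i" by auto
    then show "y \<in> orbit \<tau> a" using S[of "j - 1"] by simp
  qed
  have sub: "{i<..k} \<subseteq> {1..k}" "{1..i} \<subseteq> {1..k}" "{i<..k} \<union> {1..i} = {1..k}" "{i<..k} \<inter> {1..i} = {}"
    using ik by auto
  show "card (orbit \<tau> m) = card (orbit \<sigma> m) - i"
    unfolding o1 card_image[OF inj_on_subset[OF P(3) sub(1)]] k_def[symmetric] by simp
  show "card (orbit \<tau> a) = i"
    unfolding o2 card_image[OF inj_on_subset[OF P(3) sub(2)]] by simp
  show "orbit \<tau> m \<union> orbit \<tau> a = orbit \<sigma> m"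
    unfolding o1 o2 P(4) image_Un[symmetric] sub(3) ..
  show "orbit \<tau> m \<inter> orbit \<tau> a = {}"
    unfolding o1 o2 inj_on_image_Int[OF P(3) sub(1,2), symmetric] sub(4) by simp
qed

lemma permutation_comp_transpose: "permutation \<sigma> \<Longrightarrow> permutation (\<sigma> \<circ> transpose a m)"
  by (intro permutation_compose permutation_swap_id)

lemma orbit_cut':
  assumes perm: "permutation \<sigma>" and a: "a \<in> orbit \<sigma> m" "a \<noteq> m"
  defines "\<tau> \<equiv> \<sigma> \<circ> transpose a m"
  shows "orbit \<tau> m \<union> orbit \<tau> a = orbit \<sigma> m" "orbit \<tau> m \<inter> orbit \<tau> a = {}"
proof -
  note P = orbit_powers[OF perm, where m=m]
  obtain i where i: "i \<in> {1..card (orbit \<sigma> m)}" "a = (\<sigma> ^^ i) m" using a(1) P(4) by blast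
  then have "i \<noteq> card (orbit \<sigma> m)" using P(2) a(2) by auto
  then have "0 < i" "i < card (orbit \<sigma> m)" using i by auto
  from orbit_cut(3,4)[OF perm this i(2)]
  show "orbit \<tau> m \<union> orbit \<tau> a = orbit \<sigma> m" "orbit \<tau> m \<inter> orbit \<tau> a = {}"
    by (simp_all only: \<tau>_def)
qed

text \<open>Starting at m, \<tau> runs through the \<sigma>-cycle of \<open>a\<close> until it
  reaches \<open>a\<close>. As composing \<tau> with the same transposition returns \<sigma>, the
  union follows from the cut lemma applied to \<tau>.\<close>

lemma orbit_join:
  assumes perm: "permutation \<sigma>" and a: "a \<notin> orbit \<sigma> m"
  defines "\<tau> \<equiv> \<sigma> \<circ> transpose a m"
  shows "orbit \<tau> m = orbit \<sigma> m \<union> orbit \<sigma> a" "orbit \<tau> a = orbit \<tau> m"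
proof -
  have permt: "permutation \<tau>" unfolding \<tau>_def by (rule permutation_comp_transpose[OF perm])
  have am: "a \<noteq> m" using a permutation_self_in_orbit[OF perm, of m] by auto
  have m: "m \<notin> orbit \<sigma> a" using a orbit_eq_if_mem[OF perm, of m a] permutation_self_in_orbit[OF perm, of a] by auto
  define k where "k = card (orbit \<sigma> a)"
  note P = orbit_powers[OF perm, where m=a, folded k_def]
  have "(\<sigma> ^^ Suc j) a \<in> orbit \<tau> m" if "Suc j \<le> k" for j
    using that
  proof (induction j)
    case 0
    have "\<tau> m = \<sigma> a" using am by (simp add: \<tau>_def)
    then show ?case using orbit.base[of \<tau> m] by simp
  next
    case (Suc j)
    have "(\<sigma> ^^ Suc j) a \<noteq> a" by (rule P(5)) (use Suc.prems in auto)
    moreover have "(\<sigma> ^^ Suc j) a \<noteq> m"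
    proof
      assume "(\<sigma> ^^ Suc j) a = m"
      then have "m \<in> orbit \<sigma> a" unfolding orbit_altdef by blast
      then show False using m by simp
    qed
    ultimately have "\<tau> ((\<sigma> ^^ Suc j) a) = (\<sigma> ^^ Suc (Suc j)) a" by (simp add: \<tau>_def transpose_def)
    moreover have "\<tau> ((\<sigma> ^^ Suc j) a) \<in> orbit \<tau> m" using Suc by (auto intro: orbit.step)
    ultimately show ?case by simp
  qed
  from this[of "k - 1"] have "a \<in> orbit \<tau> m" using P(1,2) by simp
  moreover have "\<tau> \<circ> transpose a m = \<sigma>" by (simp add: \<tau>_def comp_assoc)
  ultimately show "orbit \<tau> m = orbit \<sigma> m \<union> orbit \<sigma> a"
    using orbit_cut'(1)[OF permt _ am] by simp
  show "orbit \<tau> a = orbit \<tau> m" using orbit_eq_if_mem[OF permt \<open>a \<in> orbit \<tau> m\<close>] .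
qed

section \<open>The set of orbits under joins and cuts\<close>

definition orbs :: "nat set \<Rightarrow> (nat \<Rightarrow> nat) \<Rightarrow> nat set set" where
  "orbs A \<sigma> = orbit \<sigma> ` A"

definition perm_inv :: "nat set \<Rightarrow> (nat \<Rightarrow> nat) \<Rightarrow> bool" where
  "perm_inv A \<sigma> \<longleftrightarrow> permutation \<sigma> \<and> (\<forall>x\<in>A. \<sigma> x \<in> A)"

lemma orbit_subset_inv:
  assumes "perm_inv A \<sigma>" "x \<in> A" shows "orbit \<sigma> x \<subseteq> A"
proof
  fix y assume "y \<in> orbit \<sigma> x"
  then show "y \<in> A" using assms by induction (auto simp: perm_inv_def)
qed

lemma orbs_disjoint: "perm_inv A \<sigma> \<Longrightarrow> X \<in> orbs A \<sigma> \<Longrightarrow> Y \<in> orbs A \<sigma> \<Longrightarrow> z \<in> X \<Longrightarrow> z \<in> Y \<Longrightarrow> X = Y"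
  unfolding orbs_def perm_inv_def using orbit_eq_if_mem by (metis imageE)

lemma orbs_eq_orbit: "perm_inv A \<sigma> \<Longrightarrow> X \<in> orbs A \<sigma> \<Longrightarrow> z \<in> X \<Longrightarrow> X = orbit \<sigma> z"
  unfolding orbs_def perm_inv_def using orbit_eq_if_mem by (metis imageE)

lemma Union_orbs:
  assumes "perm_inv A \<sigma>" shows "\<Union>(orbs A \<sigma>) = A"
proof
  show "\<Union>(orbs A \<sigma>) \<subseteq> A"
    unfolding orbs_def using orbit_subset_inv[OF assms] by (intro Union_least) auto
  have "permutation \<sigma>" using assms by (simp add: perm_inv_def)
  then show "A \<subseteq> \<Union>(orbs A \<sigma>)"
    unfolding orbs_def using permutation_self_in_orbit[of \<sigma>] by auto
qed

lemma finite_orbs: "finite A \<Longrightarrow> finite (orbs A \<sigma>)"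
  by (simp add: orbs_def)

lemma finite_orbs_member: "finite A \<Longrightarrow> perm_inv A \<sigma> \<Longrightarrow> X \<in> orbs A \<sigma> \<Longrightarrow> finite X"
  using Union_orbs finite_subset by (metis Union_upper)

lemma orbs_nonempty: "X \<in> orbs A \<sigma> \<Longrightarrow> X \<noteq> {}"
  by (auto simp: orbs_def orbit_nonempty)

lemma sum_orbs:
  fixes f :: "nat \<Rightarrow> real"
  assumes "finite A" "perm_inv A \<sigma>"
  shows "(\<Sum>x\<in>A. f x) = (\<Sum>X\<in>orbs A \<sigma>. \<Sum>x\<in>X. f x)"
proof -
  have 1: "\<forall>X\<in>orbs A \<sigma>. finite X"
    using finite_orbs_member[OF assms] by (intro ballI)
  have 2: "\<forall>X\<in>orbs A \<sigma>. \<forall>Y\<in>orbs A \<sigma>. X \<noteq> Y \<longrightarrow> X \<inter> Y = {}"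
  proof (intro ballI impI equals0I)
    fix X Y z assume "X \<in> orbs A \<sigma>" "Y \<in> orbs A \<sigma>" "X \<noteq> Y" "z \<in> X \<inter> Y"
    then show False using orbs_disjoint[OF assms(2), of X Y z] by simp
  qed
  from sum.Union_disjoint[OF 1 2, of f] show ?thesis
    unfolding Union_orbs[OF assms(2)] comp_def .
qed

lemma perm_inv_transpose:
  assumes "perm_inv A \<sigma>" "a \<in> A" "m \<in> A"
  shows "perm_inv A (\<sigma> \<circ> transpose a m)"
  using assms permutation_comp_transpose by (auto simp: perm_inv_def transpose_def)

lemma orbs_join:
  assumes A: "perm_inv A \<sigma>" and m: "m \<in> A" and a: "a \<in> A" "a \<notin> orbit \<sigma> m"
  defines "\<S> \<equiv> orbs A \<sigma> - {orbit \<sigma> m}"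
  shows "orbs A (\<sigma> \<circ> transpose a m) = insert (orbit \<sigma> m \<union> orbit \<sigma> a) (\<S> - {orbit \<sigma> a})"
    "orbit \<sigma> m \<union> orbit \<sigma> a \<notin> \<S>" "orbit \<sigma> a \<in> \<S>" "orbit \<sigma> m \<inter> orbit \<sigma> a = {}"
proof -
  let ?\<tau> = "\<sigma> \<circ> transpose a m" and ?K = "orbit \<sigma> m" and ?X = "orbit \<sigma> a"
  have perm: "permutation \<sigma>" using A by (simp add: perm_inv_def)
  have permt: "permutation ?\<tau>" by (rule permutation_comp_transpose[OF perm])
  note self = permutation_self_in_orbit[OF perm]
  note J = orbit_join[OF perm a(2)]
  have KX: "?K \<noteq> ?X" using self[of a] a(2) by auto
  have KO: "?K \<in> orbs A \<sigma>" "?X \<in> orbs A \<sigma>" using m a by (auto simp: orbs_def)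
  show "?K \<inter> ?X = {}" using orbs_disjoint[OF A KO] KX by blast
  show "?X \<in> \<S>" using KX KO by (auto simp: \<S>_def)
  show "?K \<union> ?X \<notin> \<S>"
  proof
    assume "?K \<union> ?X \<in> \<S>"
    then have "?K \<union> ?X = ?K" using orbs_disjoint[OF A _ KO(1), of "?K \<union> ?X" m] self by (auto simp: \<S>_def)
    then show False using self[of a] a(2) by blast
  qed
  have other: "orbit ?\<tau> x = orbit \<sigma> x \<and> orbit \<sigma> x \<in> \<S> - {?X}" if "x \<in> A" "x \<notin> ?K \<union> ?X" for x
  proof -
    have ne: "orbit \<sigma> x \<noteq> ?K" "orbit \<sigma> x \<noteq> ?X" using self[of x] that(2) by auto
    have "a \<notin> orbit \<sigma> x" "m \<notin> orbit \<sigma> x" using ne orbit_eq_if_mem[OF perm] by metis+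
    then show ?thesis using orbit_transpose_other[OF perm] ne that(1) by (auto simp: \<S>_def orbs_def)
  qed
  have mem: "orbit ?\<tau> x = ?K \<union> ?X" if "x \<in> ?K \<union> ?X" for x
    using orbit_eq_if_mem[OF permt, of x m] that unfolding J by simp
  show "orbs A ?\<tau> = insert (?K \<union> ?X) (\<S> - {?X})"
  proof (intro subset_antisym subsetI)
    fix Z assume "Z \<in> orbs A ?\<tau>"
    then obtain x where "x \<in> A" "Z = orbit ?\<tau> x" by (auto simp: orbs_def)
    then show "Z \<in> insert (?K \<union> ?X) (\<S> - {?X})" using other[of x] mem[of x] by (cases "x \<in> ?K \<union> ?X") auto
  next
    fix Z assume "Z \<in> insert (?K \<union> ?X) (\<S> - {?X})"
    then consider "Z = ?K \<union> ?X" | "Z \<in> \<S>" "Z \<noteq> ?X" by auto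
    then show "Z \<in> orbs A ?\<tau>"
    proof cases
      case 1
      then have "Z = orbit ?\<tau> m" using mem[of m] self[of m] by simp
      then show ?thesis using m by (simp add: orbs_def)
    next
      case 2
      then obtain x where x: "x \<in> A" "Z = orbit \<sigma> x" "Z \<noteq> ?K" by (auto simp: \<S>_def orbs_def)
      then have "x \<notin> ?K \<union> ?X" using 2 orbit_eq_if_mem[OF perm] by auto
      then show ?thesis using other[of x] x by (auto simp: orbs_def)
    qed
  qed
qed

lemma orbs_cut:
  assumes A: "perm_inv A \<sigma>" and m: "m \<in> A" and a: "a \<in> orbit \<sigma> m" "a \<noteq> m"
  defines "\<S> \<equiv> orbs A \<sigma> - {orbit \<sigma> m}" and "\<tau> \<equiv> \<sigma> \<circ> transpose a m"
  shows "orbs A \<tau> = insert (orbit \<tau> m) (insert (orbit \<tau> a) \<S>)"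
    "orbit \<tau> m \<notin> \<S>" "orbit \<tau> a \<notin> \<S>" "orbit \<tau> m \<noteq> orbit \<tau> a"
proof -
  let ?K = "orbit \<sigma> m"
  have perm: "permutation \<sigma>" using A by (simp add: perm_inv_def)
  have permt: "permutation \<tau>" unfolding \<tau>_def by (rule permutation_comp_transpose[OF perm])
  note self = permutation_self_in_orbit[OF perm]
  note selft = permutation_self_in_orbit[OF permt]
  note C = orbit_cut'[OF perm a, folded \<tau>_def]
  have aA: "a \<in> A" using orbit_subset_inv[OF A m] a by auto
  have KO: "?K \<in> orbs A \<sigma>" using m by (auto simp: orbs_def)
  show "orbit \<tau> m \<noteq> orbit \<tau> a" using C(2) selft by blast
  have notS: "Z \<notin> \<S>" if "z \<in> Z" "z \<in> ?K" for z Z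
    using orbs_disjoint[OF A _ KO _ that(2), of Z] that by (auto simp: \<S>_def)
  show "orbit \<tau> m \<notin> \<S>" "orbit \<tau> a \<notin> \<S>" using notS selft C(1) by blast+
  have other: "orbit \<tau> x = orbit \<sigma> x \<and> orbit \<sigma> x \<in> \<S>" if "x \<in> A" "x \<notin> ?K" for x
  proof -
    have ne: "orbit \<sigma> x \<noteq> ?K" using self[of x] that(2) by auto
    have "orbit \<sigma> a = ?K" by (rule orbit_eq_if_mem[OF perm a(1)])
    then have "a \<notin> orbit \<sigma> x" "m \<notin> orbit \<sigma> x" using ne orbit_eq_if_mem[OF perm] by metis+
    then show ?thesis unfolding \<tau>_def using orbit_transpose_other[OF perm] ne that(1) by (auto simp: \<S>_def orbs_def)
  qed
  have mem: "orbit \<tau> x = orbit \<tau> m \<or> orbit \<tau> x = orbit \<tau> a" if "x \<in> ?K" for x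
    using that orbit_eq_if_mem[OF permt] unfolding C(1)[symmetric] by blast
  show "orbs A \<tau> = insert (orbit \<tau> m) (insert (orbit \<tau> a) \<S>)"
  proof (intro subset_antisym subsetI)
    fix Z assume "Z \<in> orbs A \<tau>"
    then obtain x where "x \<in> A" "Z = orbit \<tau> x" by (auto simp: orbs_def)
    then show "Z \<in> insert (orbit \<tau> m) (insert (orbit \<tau> a) \<S>)" using other[of x] mem[of x] by (cases "x \<in> ?K") auto
  next
    fix Z assume "Z \<in> insert (orbit \<tau> m) (insert (orbit \<tau> a) \<S>)"
    then consider "Z = orbit \<tau> m" | "Z = orbit \<tau> a" | "Z \<in> \<S>" by auto
    then show "Z \<in> orbs A \<tau>"
    proof cases
      case 3
      then obtain x where x: "x \<in> A" "Z = orbit \<sigma> x" "Z \<noteq> ?K" by (auto simp: \<S>_def orbs_def)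
      then have "x \<notin> ?K" using orbit_eq_if_mem[OF perm] by auto
      then show ?thesis using other[of x] x by (auto simp: orbs_def)
    qed (use m aA in \<open>auto simp: orbs_def\<close>)
  qed
qed

lemma orbs_Union:
  assumes A: "perm_inv A \<tau>" and U: "\<U> \<subseteq> orbs A \<tau>"
  shows "orbs (\<Union>\<U>) \<tau> = \<U>" "perm_inv (\<Union>\<U>) \<tau>" "A - \<Union>\<U> = \<Union>(orbs A \<tau> - \<U>)"
proof -
  have eq: "X = orbit \<tau> z" if "X \<in> \<U>" "z \<in> X" for X z using orbs_eq_orbit[OF A _ that(2)] that(1) U by blast
  show "orbs (\<Union>\<U>) \<tau> = \<U>"
  proof (intro subset_antisym subsetI)
    fix Z assume "Z \<in> orbs (\<Union>\<U>) \<tau>"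
    then show "Z \<in> \<U>" using eq by (auto simp: orbs_def)
  next
    fix Z assume Z: "Z \<in> \<U>"
    then obtain z where "z \<in> Z" using orbs_nonempty U by blast
    then show "Z \<in> orbs (\<Union>\<U>) \<tau>" using eq[OF Z] Z unfolding orbs_def by blast
  qed
  show "perm_inv (\<Union>\<U>) \<tau>"
    unfolding perm_inv_def
  proof (intro conjI ballI)
    show "permutation \<tau>" using A by (simp add: perm_inv_def)
    fix x assume "x \<in> \<Union>\<U>"
    then obtain X where X: "X \<in> \<U>" "x \<in> X" by auto
    then have "\<tau> x \<in> X" using eq[OF X] orbit.base[of \<tau> x] by simp
    then show "\<tau> x \<in> \<Union>\<U>" using X by auto
  qed
  show "A - \<Union>\<U> = \<Union>(orbs A \<tau> - \<U>)"
  proof (intro subset_antisym subsetI)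
    fix x assume "x \<in> A - \<Union>\<U>"
    moreover have "\<Union>(orbs A \<tau>) = A" by (rule Union_orbs[OF A])
    ultimately show "x \<in> \<Union>(orbs A \<tau> - \<U>)" by blast
  next
    fix x assume "x \<in> \<Union>(orbs A \<tau> - \<U>)"
    then obtain X where X: "X \<in> orbs A \<tau>" "X \<notin> \<U>" "x \<in> X" by auto
    then have "x \<in> A" using Union_orbs[OF A] by blast
    moreover have "x \<notin> Y" if "Y \<in> \<U>" for Y using orbs_disjoint[OF A X(1) _ X(3), of Y] that U X(2) by blast
    ultimately show "x \<in> A - \<Union>\<U>" by auto
  qed
qed

lemma orbs_mono: "B \<subseteq> A \<Longrightarrow> orbs B \<tau> \<subseteq> orbs A \<tau>"
  by (auto simp: orbs_def)

text \<open>An invariant set that contains m contains its orbit, hence \<open>a\<close>: after a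
  join the action cannot split.\<close>

lemma no_split_if_joined:
  assumes "a \<in> orbit \<tau> m" "m \<in> B" "a \<notin> B" "\<forall>x\<in>B. \<tau> x \<in> B"
  shows False
proof -
  have "y \<in> B" if "y \<in> orbit \<tau> m" for y
    using that assms by induction auto
  then show False using assms by blast
qed

text \<open>Invariant sets are unions of orbits; those in the sum contain K1, avoid K2 and are free
  in the other orbits.\<close>

lemma sum_splits:
  fixes f :: "nat set \<Rightarrow> real"
  assumes A: "perm_inv A \<tau>" and O: "orbs A \<tau> = insert K1 (insert K2 \<S>)" "K1 \<notin> \<S>" "K2 \<notin> \<S>" "K1 \<noteq> K2"
    and mem: "m \<in> K1" "a \<in> K2"
  shows "(\<Sum>B | B \<subseteq> A \<and> m \<in> B \<and> a \<notin> B \<and> (\<forall>x\<in>B. \<tau> x \<in> B). f B) = (\<Sum>\<T>\<in>Pow \<S>. f (\<Union>(insert K1 \<T>)))"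
proof (rule sum.reindex_bij_witness[of _ "\<lambda>\<T>. \<Union>(insert K1 \<T>)" "\<lambda>B. orbs B \<tau> - {K1}"])
  have K: "K1 = orbit \<tau> m" "K2 = orbit \<tau> a" using orbs_eq_orbit[OF A _ mem(1)] orbs_eq_orbit[OF A _ mem(2)] O by auto
  fix B assume B: "B \<in> {B. B \<subseteq> A \<and> m \<in> B \<and> a \<notin> B \<and> (\<forall>x\<in>B. \<tau> x \<in> B)}"
  then have pB: "perm_inv B \<tau>" using A by (auto simp: perm_inv_def)
  have K1B: "K1 \<in> orbs B \<tau>" using B K by (auto simp: orbs_def)
  have "K2 \<notin> orbs B \<tau>" using Union_orbs[OF pB] mem B by blast
  then show "orbs B \<tau> - {K1} \<in> Pow \<S>" using orbs_mono[of B A \<tau>] B O(1) by auto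
  show "\<Union>(insert K1 (orbs B \<tau> - {K1})) = B" using K1B Union_orbs[OF pB] by (simp add: insert_absorb)
  then show "f (\<Union>(insert K1 (orbs B \<tau> - {K1}))) = f B" by simp
next
  fix \<T> assume T: "\<T> \<in> Pow \<S>"
  have U: "insert K1 \<T> \<subseteq> orbs A \<tau>" using T O(1) by auto
  note L = orbs_Union[OF A U]
  show "orbs (\<Union>(insert K1 \<T>)) \<tau> - {K1} = \<T>" unfolding L(1) using T O(2) by auto
  have "a \<notin> \<Union>(insert K1 \<T>)"
  proof
    assume "a \<in> \<Union>(insert K1 \<T>)"
    then obtain X where X: "X \<in> insert K1 \<T>" "a \<in> X" by auto
    then have "X = K2" using orbs_disjoint[OF A, of X K2 a] U O(1) mem by blast
    then show False using X(1) T O(3,4) by auto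
  qed
  moreover have "\<Union>(insert K1 \<T>) \<subseteq> A" using U Union_orbs[OF A] by blast
  moreover have "\<forall>x\<in>\<Union>(insert K1 \<T>). \<tau> x \<in> \<Union>(insert K1 \<T>)" using L(2) unfolding perm_inv_def by blast
  ultimately show "\<Union>(insert K1 \<T>) \<in> {B. B \<subseteq> A \<and> m \<in> B \<and> a \<notin> B \<and> (\<forall>x\<in>B. \<tau> x \<in> B)}"
    using mem by auto
qed

section \<open>The factorization count in genus 0 and 1\<close>

text \<open>Values of f beyond p + 2 and of g beyond q + 2 are unknown, but since r \<le> p + q + 2
  the other factor is then taken below its least index p or q and vanishes.\<close>

lemma sum_by_rank:
  fixes f g :: "nat \<Rightarrow> real"
  assumes f: "\<And>j. j \<le> r \<Longrightarrow> j \<le> p + 2 \<Longrightarrow> f j = (if j = p then f0 else if j = p + 2 then f2 else 0)"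
    and g: "\<And>j. j \<le> r \<Longrightarrow> j \<le> q + 2 \<Longrightarrow> g j = (if j = q then g0 else if j = q + 2 then g2 else 0)"
    and r: "r \<le> p + q + 2"
  shows "(\<Sum>j\<le>r. f j * g (r - j))
    = (if r = p + q then f0 * g0 else if r = p + q + 2 then f0 * g2 + f2 * g0 else 0)"
proof -
  have "f j * g (r - j) = (if j = p then (if r = p + q then f0 * g0 else if r = p + q + 2 then f0 * g2 else 0) else 0)
     + (if j = p + 2 then (if r = p + q + 2 then f2 * g0 else 0) else 0)" if "j \<le> r" for j
  proof -
    consider "j < p" | "j = p" | "j = p + 1" | "j = p + 2" | "j > p + 2" by linarith
    then show ?thesis
    proof cases
      case 5
      then have "g (r - j) = 0" using g[of "r - j"] r that by auto
      then show ?thesis using 5 by simp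
    qed (use f[of j] g[of "r - j"] that r in auto)
  qed
  then have "(\<Sum>j\<le>r. f j * g (r - j)) = (\<Sum>j\<le>r. (if j = p then (if r = p + q then f0 * g0 else if r = p + q + 2 then f0 * g2 else 0) else 0))
     + (\<Sum>j\<le>r. (if j = p + 2 then (if r = p + q + 2 then f2 * g0 else 0) else 0))"
    unfolding sum.distrib[symmetric] by (intro sum.cong refl) simp
  then show ?thesis by (simp only: sum.delta finite_atMost atMost_iff) auto
qed

definition count_facts :: "nat set \<Rightarrow> (nat \<Rightarrow> nat) \<Rightarrow> nat \<Rightarrow> real" where
  "count_facts A \<sigma> r = real (card (mono_facts A \<sigma> r))"

text \<open>The length in genus 0 by the Riemann-Hurwitz formula. The natural subtraction is exact
  for finite nonempty A, see \<open>min_len_add\<close>.\<close>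

definition min_len :: "nat set \<Rightarrow> (nat \<Rightarrow> nat) \<Rightarrow> nat" where
  "min_len A \<sigma> = card A + card (orbs A \<sigma>) - 2"

text \<open>The zeros for r < p and r = p + 1 are part of the claim; the value for r > p + 2 is only
  a default, as the count is asserted up to p + 2.\<close>

definition Psi :: "nat \<Rightarrow> nat \<Rightarrow> nat set set \<Rightarrow> real" where
  "Psi p r \<X> = (if r = p then Phi0 card \<X> else if r = p + 2 then Phi1 card \<X> else 0)"

lemma count_facts_singleton:
  assumes "perm_inv {x} \<sigma>" "r \<le> min_len {x} \<sigma> + 2"
  shows "count_facts {x} \<sigma> r = Psi (min_len {x} \<sigma>) r (orbs {x} \<sigma>)"
proof -
  have fx: "\<sigma> x = x" using assms(1) by (auto simp: perm_inv_def)
  then have o: "orbs {x} \<sigma> = {{x}}" using orbit_eq_singleton_iff[of \<sigma> x] by (simp add: orbs_def)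
  have p: "min_len {x} \<sigma> = 0" by (simp add: min_len_def o)
  show ?thesis
  proof (cases r)
    case 0
    have "mono_facts {x} \<sigma> 0 = {[]}"
      using fx by (auto simp: mono_facts_def mono_seqs_def connected_seq_def)
    then show ?thesis using 0
      by (simp add: count_facts_def p o Psi_def Phi0_def total_def nbinom_def cbinom_def)
  next
    \<comment> \<open>For one cycle of length 1 the bracket in \<open>Phi1\<close> is 3 - 3 =
      0.\<close>
    case (Suc n)
    have "mono_seqs {x} (Suc n) = {}"
      by (auto simp: mono_seqs_def length_Suc_conv)
    then have "mono_facts {x} \<sigma> r = {}" by (simp add: mono_facts_def Suc)
    then show ?thesis using Suc
      by (simp add: count_facts_def p o Psi_def Phi1_def total_def)
  qed
qed

lemma count_facts_0:
  assumes "finite A" "card A \<ge> 2"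
  shows "count_facts A \<sigma> 0 = 0"
proof -
  obtain x where x: "x \<in> A" using assms by fastforce
  have "{x} \<noteq> A" using assms(2) by auto
  then have "\<not> connected_seq A []" using x by (auto simp: connected_seq_def stable_def)
  then have "mono_facts A \<sigma> 0 = {}" by (auto simp: mono_facts_def mono_seqs_def)
  then show ?thesis by (simp add: count_facts_def)
qed

lemma min_len_add:
  assumes "finite A" "A \<noteq> {}" shows "min_len A \<sigma> + 2 = card A + card (orbs A \<sigma>)"
proof -
  have "card A \<ge> 1" "card (orbs A \<sigma>) \<ge> 1"
    using assms by (auto simp: orbs_def Suc_le_eq card_gt_0_iff)
  then show ?thesis by (simp add: min_len_def)
qed

text \<open>The recursion singles out the orbit of \<open>Max A\<close>, but the right-hand side is symmetric in the orbits.
  Hence the induction needs no separate proof that the count depends on the cycle type only.\<close>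

theorem count_facts_eq:
  assumes "finite A" "A \<noteq> {}" "perm_inv A \<sigma>" "r \<le> min_len A \<sigma> + 2"
  shows "count_facts A \<sigma> r = Psi (min_len A \<sigma>) r (orbs A \<sigma>)"
  using assms
proof (induction r arbitrary: A \<sigma> rule: less_induct)
  case (less s)
  note fin = less.prems(1) and inv = less.prems(3)
  have cA: "card A \<ge> 1" using less.prems by (simp add: Suc_le_eq card_gt_0_iff)
  define p where "p = min_len A \<sigma>"
  have p2: "p + 2 = card A + card (orbs A \<sigma>)" unfolding p_def by (rule min_len_add[OF less.prems(1,2)])
  consider "card A = 1" | "card A \<ge> 2" "s = 0" | r where "card A \<ge> 2" "s = Suc r"
    using cA by (cases s; cases "card A = 1") auto
  then show ?case
  proof cases
    case 1
    then obtain x where "A = {x}" by (metis card_1_singletonE)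
    then show ?thesis using count_facts_singleton less.prems by blast
  next
    case 2
    have "card (orbs A \<sigma>) \<ge> 1"
      using less.prems(1,2) by (auto simp: orbs_def Suc_le_eq card_gt_0_iff)
    then have "p > 0" using p2 2 by linarith
    then show ?thesis using count_facts_0[OF fin 2(1)] 2 unfolding p_def by (simp add: Psi_def)
  next
    case (3 r)
    let ?m = "Max A"
    have m: "?m \<in> A" using fin less.prems(2) by (rule Max_in)
    have perm: "permutation \<sigma>" using inv by (simp add: perm_inv_def)
    define K where "K = orbit \<sigma> ?m"
    define k where "k = card K"
    define \<S> where "\<S> = orbs A \<sigma> - {K}"
    have KO: "K \<in> orbs A \<sigma>" using m by (auto simp: K_def orbs_def)
    have mK: "?m \<in> K" unfolding K_def by (rule permutation_self_in_orbit[OF perm])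
    have finO: "finite (orbs A \<sigma>)" by (rule finite_orbs[OF fin])
    have finS: "finite \<S>" using finO by (simp add: \<S>_def)
    have O: "orbs A \<sigma> = insert K \<S>" "K \<notin> \<S>" using KO by (auto simp: \<S>_def)
    have finK: "finite K" by (rule finite_orbs_member[OF fin inv KO])
    have KA: "K \<subseteq> A" unfolding K_def by (rule orbit_subset_inv[OF inv m])
    have k: "k \<ge> 1" using mK finK by (auto simp: k_def Suc_le_eq card_gt_0_iff)
    have cS: "\<And>X. X \<in> \<S> \<Longrightarrow> card X \<ge> 1"
      using finite_orbs_member[OF fin inv] orbs_nonempty[of _ A \<sigma>] by (auto simp: \<S>_def Suc_le_eq card_gt_0_iff)
    have pS: "p + 1 = card A + card \<S>" using p2 O finS by simp
    have sp: "Suc r \<le> p + 2" using less.prems(4) 3 by (simp add: p_def)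
    \<comment> \<open>The value of \<open>E a\<close> for every point \<open>a\<close> of another
      cycle X: the joined cycle has length k + card X.\<close>
    define jn where "jn X = (if Suc r = p then M0 card (k + card X) (\<S> - {X}) else if Suc r = p + 2 then M1 card (k + card X) (\<S> - {X}) else 0)" for X
    \<comment> \<open>The value of \<open>E a\<close> for the i-th point of K: \<open>M00\<close>
      belongs to the transitive remainder, the products to the two orbits, over which the remaining
      cycles are distributed.\<close>
    define ct where "ct i = (if Suc r = p then (\<Sum>\<T>\<in>Pow \<S>. M0 card (k - i) \<T> * M0 card i (\<S> - \<T>))
        else if Suc r = p + 2 then M00 card (k - i) i \<S> + (\<Sum>\<T>\<in>Pow \<S>. M0 card (k - i) \<T> * M1 card i (\<S> - \<T>) + M1 card (k - i) \<T> * M0 card i (\<S> - \<T>)) else 0)" for i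
    define E where "E a = real (card (ext_facts A (\<sigma> \<circ> transpose a ?m) a r))" for a
    have AK: "A - K = \<Union>\<S>" "perm_inv (\<Union>\<S>) \<sigma>" "orbs (\<Union>\<S>) \<sigma> = \<S>"
      using orbs_Union[OF inv, of "{K}"] orbs_Union[OF inv, of \<S>] KO by (auto simp: \<S>_def)
    have invt: "perm_inv A (\<sigma> \<circ> transpose a ?m)" if "a \<in> A" for a
      by (rule perm_inv_transpose[OF inv that m])
    have IH: "count_facts B \<tau> j = Psi (min_len B \<tau>) j (orbs B \<tau>)"
      if "j \<le> r" "finite B" "B \<noteq> {}" "perm_inv B \<tau>" "j \<le> min_len B \<tau> + 2" for j B \<tau>
      using less.IH[of j B \<tau>] that 3 by simp
    have E: "E a = count_facts A (\<sigma> \<circ> transpose a ?m) r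
        + (\<Sum>B | B \<subseteq> A \<and> ?m \<in> B \<and> a \<notin> B \<and> (\<forall>x\<in>B. (\<sigma> \<circ> transpose a ?m) x \<in> B).
             \<Sum>j\<le>r. count_facts B (\<sigma> \<circ> transpose a ?m) j * count_facts (A - B) (\<sigma> \<circ> transpose a ?m) (r - j))"
      if "a \<in> A" "a \<noteq> ?m" for a
    proof -
      have "card (split_facts A \<tau> B r) = (\<Sum>i\<le>r. card (mono_facts B \<tau> i) * card (mono_facts (A - B) \<tau> (r - i)))"
        if "B \<subseteq> A" for B \<tau> using card_split_facts[OF fin that] .
      then show ?thesis
        unfolding E_def count_facts_def card_ext_facts[OF fin that(1) m that(2)] by simp
    qed
    have join: "E a = jn X"
      if X: "X \<in> \<S>" "a \<in> X" for X a
    proof -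
      let ?\<tau> = "\<sigma> \<circ> transpose a ?m"
      have XO: "X \<in> orbs A \<sigma>" using X by (simp add: \<S>_def)
      have Xa: "X = orbit \<sigma> a" by (rule orbs_eq_orbit[OF inv XO X(2)])
      have aA: "a \<in> A" using XO X(2) Union_orbs[OF inv] by blast
      have aK: "a \<notin> orbit \<sigma> ?m" using orbs_disjoint[OF inv XO KO X(2)] O X by (auto simp: K_def)
      then have am: "a \<noteq> ?m" using mK by (auto simp: K_def)
      note J = orbs_join[OF inv m aA aK, folded K_def Xa, folded \<S>_def]
      have "a \<in> orbit ?\<tau> ?m" unfolding orbit_join(1)[OF perm aK] using X(2) Xa by simp
      then have e: "{B. B \<subseteq> A \<and> ?m \<in> B \<and> a \<notin> B \<and> (\<forall>x\<in>B. ?\<tau> x \<in> B)} = {}"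
        using no_split_if_joined[of a ?\<tau> ?m] by blast
      have KX: "K \<union> X \<notin> \<S> - {X}" using J(2) by simp
      have cKX: "card (K \<union> X) = k + card X"
        unfolding k_def using J(4) finK finite_orbs_member[OF fin inv XO] by (rule card_Un_disjoint[rotated 2])
      have "card \<S> > 0" using finS X(1) by (auto simp: card_gt_0_iff)
      then have "card (orbs A ?\<tau>) = card \<S>"
        unfolding J(1) using KX finS X(1) by simp
      \<comment> \<open>One orbit less lowers the minimal length by one, as does the removed
        transposition the actual length: the genus is kept.\<close>
      then have p': "min_len A ?\<tau> + 1 = p"
        using min_len_add[OF fin less.prems(2), of ?\<tau>] pS by simp
      have "E a = Psi (min_len A ?\<tau>) r (orbs A ?\<tau>)"
        unfolding E[OF aA am] e using p' sp by (simp add: IH[OF le_refl fin less.prems(2) invt[OF aA]])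
      also have "\<dots> = (if Suc r = p then Phi0 card (insert (K \<union> X) (\<S> - {X})) else if Suc r = p + 2 then Phi1 card (insert (K \<union> X) (\<S> - {X})) else 0)"
        unfolding Psi_def J(1) p'[symmetric] by simp
      finally show ?thesis
        unfolding jn_def using finS KX by (simp add: Phi0_insert Phi1_insert cKX)
    qed
    have cut: "E ((\<sigma> ^^ i) ?m) = ct i"
      if i: "i \<in> {1..<k}" for i
    proof -
      define a where "a = (\<sigma> ^^ i) ?m"
      let ?\<tau> = "\<sigma> \<circ> transpose a ?m"
      have i': "0 < i" "i < card (orbit \<sigma> ?m)" using i by (auto simp: k_def K_def)
      have am: "a \<noteq> ?m" unfolding a_def by (rule orbit_powers(5)[OF perm i'])
      have aK: "a \<in> orbit \<sigma> ?m" unfolding a_def using i' by (auto simp: orbit_altdef)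
      have aA: "a \<in> A" using aK KA by (auto simp: K_def)
      define K1 where "K1 = orbit ?\<tau> ?m"
      define K2 where "K2 = orbit ?\<tau> a"
      have cK: "card K1 = k - i" "card K2 = i"
        using orbit_cut(1,2)[OF perm i' a_def] by (simp_all add: K1_def K2_def k_def K_def)
      note C = orbs_cut[OF inv m aK am, folded K_def, folded \<S>_def, folded K1_def K2_def]
      have permt: "permutation ?\<tau>" by (rule permutation_comp_transpose[OF perm])
      have mem: "?m \<in> K1" "a \<in> K2" unfolding K1_def K2_def by (rule permutation_self_in_orbit[OF permt])+
      have "card (orbs A ?\<tau>) = card \<S> + 2" unfolding C(1) using C(2-4) finS by simp
      \<comment> \<open>One orbit more raises the minimal length while the actual length drops, so a
        transitive remainder has its genus lowered by one.\<close>
      then have p': "min_len A ?\<tau> = p + 1"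
        using min_len_add[OF fin less.prems(2), of ?\<tau>] pS by simp
      have c1: "count_facts A ?\<tau> r = (if Suc r = p + 2 then M00 card (k - i) i \<S> else 0)"
      proof -
        have "count_facts A ?\<tau> r = (if r = p + 1 then Phi0 card (insert K1 (insert K2 \<S>)) else 0)"
          using p' sp by (simp add: IH[OF le_refl fin less.prems(2) invt[OF aA]] Psi_def C(1))
        also have "Phi0 card (insert K1 (insert K2 \<S>)) = M00 card (card K1) (card K2) \<S>"
          using finS C cK i by (intro Phi0_insert2) auto
        finally have "count_facts A ?\<tau> r = (if r = p + 1 then M00 card (card K1) (card K2) \<S> else 0)" .
        then show ?thesis unfolding cK by (rule trans) simp
      qed
      have c2: "(\<Sum>j\<le>r. count_facts (\<Union>(insert K1 \<T>)) ?\<tau> j * count_facts (A - \<Union>(insert K1 \<T>)) ?\<tau> (r - j))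
         = (if Suc r = p then M0 card (k - i) \<T> * M0 card i (\<S> - \<T>)
            else if Suc r = p + 2 then M0 card (k - i) \<T> * M1 card i (\<S> - \<T>) + M1 card (k - i) \<T> * M0 card i (\<S> - \<T>) else 0)"
        if T: "\<T> \<in> Pow \<S>" for \<T>
      proof -
        let ?B = "\<Union>(insert K1 \<T>)" and ?C = "A - \<Union>(insert K1 \<T>)"
        have U: "insert K1 \<T> \<subseteq> orbs A ?\<tau>" "insert K2 (\<S> - \<T>) \<subseteq> orbs A ?\<tau>" using T unfolding C(1) by auto
        have rest: "orbs A ?\<tau> - insert K1 \<T> = insert K2 (\<S> - \<T>)" using T C by auto
        note B = orbs_Union[OF invt[OF aA] U(1)]
        note C' = orbs_Union[OF invt[OF aA] U(2), folded rest, folded B(3), unfolded rest]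
        have BA: "?B \<subseteq> A" using U(1) Union_orbs[OF invt[OF aA]] by blast
        have finB: "finite ?B" "finite ?C" using fin finite_subset[OF BA] by auto
        have "a \<in> ?C" using mem(2) B(3) rest by blast
        then have ne: "?B \<noteq> {}" "?C \<noteq> {}" using mem(1) by auto
        have finT: "finite \<T>" "finite (\<S> - \<T>)" using T finS finite_subset by auto
        have nK: "K1 \<notin> \<T>" "K2 \<notin> \<S> - \<T>" using C T by auto
        have "card ?B + card ?C = card A" using BA fin by (metis card_Diff_subset card_mono finB(1) le_add_diff_inverse)
        moreover have "card \<T> + card (\<S> - \<T>) = card \<S>" using T finS by (metis PowD card_Diff_subset card_mono finT(1) le_add_diff_inverse)
        moreover have "card (orbs ?B ?\<tau>) = card \<T> + 1" unfolding B(1) using finT nK by simp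
        moreover have "card (orbs ?C ?\<tau>) = card (\<S> - \<T>) + 1" unfolding C'(1) using finT nK by simp
        \<comment> \<open>The two minimal lengths and the removed transposition add up to p, so the
          genera of the two parts add up to the genus of the whole.\<close>
        ultimately have q: "min_len ?B ?\<tau> + min_len ?C ?\<tau> + 1 = p"
          using min_len_add[OF finB(1) ne(1), of ?\<tau>] min_len_add[OF finB(2) ne(2), of ?\<tau>] pS by linarith
        have tot2: "(\<Sum>j\<le>r. count_facts ?B ?\<tau> j * count_facts ?C ?\<tau> (r - j))
          = (if r = min_len ?B ?\<tau> + min_len ?C ?\<tau> then Phi0 card (insert K1 \<T>) * Phi0 card (insert K2 (\<S> - \<T>))
             else if r = min_len ?B ?\<tau> + min_len ?C ?\<tau> + 2 then
               Phi0 card (insert K1 \<T>) * Phi1 card (insert K2 (\<S> - \<T>)) + Phi1 card (insert K1 \<T>) * Phi0 card (insert K2 (\<S> - \<T>)) else 0)"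
        proof (rule sum_by_rank)
          show "r \<le> min_len ?B ?\<tau> + min_len ?C ?\<tau> + 2" using q sp by linarith
          show "count_facts ?B ?\<tau> j = (if j = min_len ?B ?\<tau> then Phi0 card (insert K1 \<T>)
              else if j = min_len ?B ?\<tau> + 2 then Phi1 card (insert K1 \<T>) else 0)"
            if "j \<le> r" "j \<le> min_len ?B ?\<tau> + 2" for j
            using IH[OF that(1) finB(1) ne(1) B(2) that(2)] unfolding Psi_def B(1) .
          show "count_facts ?C ?\<tau> j = (if j = min_len ?C ?\<tau> then Phi0 card (insert K2 (\<S> - \<T>))
              else if j = min_len ?C ?\<tau> + 2 then Phi1 card (insert K2 (\<S> - \<T>)) else 0)"
            if "j \<le> r" "j \<le> min_len ?C ?\<tau> + 2" for j
            using IH[OF that(1) finB(2) ne(2) C'(2) that(2)] unfolding Psi_def C'(1) .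
        qed
        have ph: "Phi0 card (insert K1 \<T>) = M0 card (k - i) \<T>" "Phi1 card (insert K1 \<T>) = M1 card (k - i) \<T>"
          "Phi0 card (insert K2 (\<S> - \<T>)) = M0 card i (\<S> - \<T>)" "Phi1 card (insert K2 (\<S> - \<T>)) = M1 card i (\<S> - \<T>)"
          using Phi0_insert[OF finT(1) nK(1), of card] Phi1_insert[OF finT(1) nK(1), of card]
            Phi0_insert[OF finT(2) nK(2), of card] Phi1_insert[OF finT(2) nK(2), of card] by (simp_all add: cK)
        show ?thesis unfolding tot2 ph q[symmetric] by simp
      qed
      have "E a = (if Suc r = p + 2 then M00 card (k - i) i \<S> else 0) + (\<Sum>\<T>\<in>Pow \<S>.
         (if Suc r = p then M0 card (k - i) \<T> * M0 card i (\<S> - \<T>)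
            else if Suc r = p + 2 then M0 card (k - i) \<T> * M1 card i (\<S> - \<T>) + M1 card (k - i) \<T> * M0 card i (\<S> - \<T>) else 0))"
        unfolding E[OF aA am] c1 sum_splits[OF invt[OF aA] C mem] using c2 by simp
      then show ?thesis unfolding a_def[symmetric] ct_def by simp
    qed
    have bij: "bij_betw (\<lambda>i. (\<sigma> ^^ i) ?m) {1..<k} (K - {?m})"
    proof -
      note P = orbit_powers[OF perm, where m="?m", folded K_def, folded k_def]
      have d: "{1..<k} = {1..k} - {k}" by auto
      have i: "inj_on (\<lambda>i. (\<sigma> ^^ i) ?m) {1..<k}"
        by (rule inj_on_subset[OF P(3)]) auto
      have "(\<lambda>i. (\<sigma> ^^ i) ?m) ` ({1..k} - {k}) = (\<lambda>i. (\<sigma> ^^ i) ?m) ` {1..k} - (\<lambda>i. (\<sigma> ^^ i) ?m) ` {k}"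
        by (rule inj_on_image_set_diff[OF P(3)]) (use k in simp_all)
      then have "(\<lambda>i. (\<sigma> ^^ i) ?m) ` {1..<k} = K - {?m}"
        unfolding d P(4)[symmetric] by (simp add: P(2))
      with i show ?thesis unfolding bij_betw_def ..
    qed
    have "count_facts A \<sigma> (Suc r) = (\<Sum>a\<in>A - {?m}. E a)"
      unfolding count_facts_def card_mono_facts_Suc[OF fin 3(1)] E_def by simp
    also have "\<dots> = (\<Sum>a\<in>A - K. E a) + (\<Sum>a\<in>K - {?m}. E a)"
    proof -
      have "A - {?m} = (A - K) \<union> (K - {?m})" using KA mK by auto
      moreover have "sum E ((A - K) \<union> (K - {?m})) = sum E (A - K) + sum E (K - {?m})"
        by (rule sum.union_disjoint) (use fin finK in auto)
      ultimately show ?thesis by simp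
    qed
    also have "(\<Sum>a\<in>A - K. E a) = (\<Sum>X\<in>\<S>. \<Sum>a\<in>X. E a)"
      unfolding AK(1) using sum_orbs[OF _ AK(2), of E] fin AK by (metis finite_Diff)
    also have "\<dots> = (\<Sum>X\<in>\<S>. real (card X) * jn X)"
      by (intro sum.cong refl) (simp only: join sum_constant cong: sum.cong)
    also have "(\<Sum>a\<in>K - {?m}. E a) = (\<Sum>i=1..<k. E ((\<sigma> ^^ i) ?m))"
      by (rule sum.reindex_bij_betw[OF bij, symmetric])
    also have "\<dots> = (\<Sum>i=1..<k. ct i)"
      by (intro sum.cong refl cut)
    finally have tot: "count_facts A \<sigma> (Suc r) =
      (\<Sum>X\<in>\<S>. real (card X) * jn X)
      + (\<Sum>i=1..<k. ct i)" .
    \<comment> \<open>The base case of \<open>M0_rec\<close> is a single fixed point, impossible for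
      card A \<ge> 2.\<close>
    have big: "k \<noteq> 1 \<or> \<S> \<noteq> {}"
    proof -
      have "A = K" if "\<S> = {}" using AK(1) KA that by auto
      then show ?thesis using 3(1) by (auto simp: k_def)
    qed
    have "count_facts A \<sigma> (Suc r) = (if Suc r = p then M0 card k \<S> else if Suc r = p + 2 then M1 card k \<S> else 0)"
      unfolding tot jn_def ct_def using M0_rec[where a=card, OF finS cS k big] M1_rec[where a=card, OF finS cS k] by simp
    also have "\<dots> = Psi p (Suc r) (orbs A \<sigma>)"
      unfolding O(1) Psi_def using Phi0_insert[OF finS O(2), of card] Phi1_insert[OF finS O(2), of card] by (simp add: k_def)
    finally show ?thesis unfolding p_def 3(2) .
  qed
qed

section \<open>Permutations of a given cycle type\<close>

definition perms_of_type :: "nat \<Rightarrow> nat multiset \<Rightarrow> (nat \<Rightarrow> nat) set" where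
  "perms_of_type d \<beta> = {\<sigma>. \<sigma> permutes {1..d} \<and> cycle_type d \<sigma> = \<beta>}"

definition centralizer_size :: "nat multiset \<Rightarrow> nat" where
  "centralizer_size \<beta> = prod_mset \<beta> * (\<Prod>i\<in>set_mset \<beta>. fact (count \<beta> i))"

lemma cycle_type_orbs: "cycle_type d \<sigma> = image_mset card (mset_set (orbs {1..d} \<sigma>))"
  by (simp add: cycle_type_def orbs_def)

lemma perm_inv_permutes: "\<sigma> permutes {1..d} \<Longrightarrow> perm_inv {1..d} \<sigma>"
  unfolding perm_inv_def by (metis finite_atLeastAtMost permutation_permutes permutes_in_image)

lemma centralizer_size_add:
  "centralizer_size (add_mset x \<gamma>) = centralizer_size \<gamma> * (x * (count \<gamma> x + 1))"
proof -
  let ?f = "\<lambda>\<beta> i. fact (count \<beta> i) :: nat"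
  have 1: "(\<Prod>i\<in>set_mset (add_mset x \<gamma>). ?f (add_mset x \<gamma>) i)
      = ?f (add_mset x \<gamma>) x * (\<Prod>i\<in>set_mset \<gamma> - {x}. ?f \<gamma> i)"
    by (subst prod.remove[of _ x]) (auto intro!: prod.cong)
  have 2: "(\<Prod>i\<in>set_mset \<gamma>. ?f \<gamma> i) = ?f \<gamma> x * (\<Prod>i\<in>set_mset \<gamma> - {x}. ?f \<gamma> i)"
  proof (cases "x \<in># \<gamma>")
    case True
    then show ?thesis by (subst prod.remove[of _ x]) auto
  next
    case False
    then have "set_mset \<gamma> - {x} = set_mset \<gamma>" "count \<gamma> x = 0" by (auto simp: not_in_iff)
    then show ?thesis by simp
  qed
  show ?thesis unfolding centralizer_size_def 1 2 by (simp add: algebra_simps)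
qed

lemma sum_mset_eq_sum_count:
  assumes "finite A" "set_mset \<beta> \<subseteq> A"
  shows "sum_mset \<beta> = (\<Sum>i\<in>A. i * count \<beta> i :: nat)"
  using assms(2)
proof (induction \<beta>)
  case (add x \<beta>)
  have "(\<Sum>i\<in>A. i * count (add_mset x \<beta>) i) = (\<Sum>i\<in>A. i * count \<beta> i + (if i = x then x else 0))"
    by (intro sum.cong) auto
  also have "\<dots> = sum_mset \<beta> + x"
    using add assms(1) by (simp add: sum.distrib sum.delta)
  finally show ?case by simp
qed simp

lemma finite_perms_of_type: "finite (perms_of_type d \<beta>)"
  by (rule finite_subset[OF _ finite_permutations[of "{1..d}"]]) (auto simp: perms_of_type_def)

text \<open>The new largest point is inserted into its cycle directly after \<open>a\<close>, or as
  a fixed point if \<open>a\<close> is that point itself. It is recovered as the preimage of the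
  largest point.\<close>

lemma bij_betw_perms_Suc:
  "bij_betw (\<lambda>(a, \<sigma>). \<sigma> \<circ> transpose a (Suc d)) ({1..Suc d} \<times> {\<sigma>. \<sigma> permutes {1..d}}) {\<sigma>. \<sigma> permutes {1..Suc d}}"
proof (rule bij_betw_byWitness[where f' = "\<lambda>\<sigma>. (inv' \<sigma> (Suc d), \<sigma> \<circ> transpose (inv' \<sigma> (Suc d)) (Suc d))"])
  let ?n = "Suc d"
  have sub: "\<sigma> permutes {1..?n}" if "\<sigma> permutes {1..d}" for \<sigma>
    using that by (rule permutes_subset) auto
  show "\<forall>x\<in>{1..?n} \<times> {\<sigma>. \<sigma> permutes {1..d}}.
      (inv' (case x of (a, \<sigma>) \<Rightarrow> \<sigma> \<circ> transpose a ?n) ?n,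
       (case x of (a, \<sigma>) \<Rightarrow> \<sigma> \<circ> transpose a ?n) \<circ> transpose (inv' (case x of (a, \<sigma>) \<Rightarrow> \<sigma> \<circ> transpose a ?n) ?n) ?n) = x"
  proof
    fix x assume "x \<in> {1..?n} \<times> {\<sigma>. \<sigma> permutes {1..d}}"
    then obtain a \<sigma> where x: "x = (a, \<sigma>)" "a \<in> {1..?n}" "\<sigma> permutes {1..d}" by auto
    let ?p = "\<sigma> \<circ> transpose a ?n"
    have p: "?p permutes {1..?n}"
      using sub[OF x(3)] x(2) by (intro permutes_compose permutes_swap_id) auto
    have "?p a = ?n" using x(3) by (simp add: permutes_def)
    then have "inv' ?p ?n = a" using p by (metis permutes_inv_eq)
    then show "(inv' (case x of (a, \<sigma>) \<Rightarrow> \<sigma> \<circ> transpose a ?n) ?n,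
       (case x of (a, \<sigma>) \<Rightarrow> \<sigma> \<circ> transpose a ?n) \<circ> transpose (inv' (case x of (a, \<sigma>) \<Rightarrow> \<sigma> \<circ> transpose a ?n) ?n) ?n) = x"
      by (simp add: x(1) comp_assoc)
  qed
  show "\<forall>\<sigma>\<in>{\<sigma>. \<sigma> permutes {1..?n}}. (case (inv' \<sigma> ?n, \<sigma> \<circ> transpose (inv' \<sigma> ?n) ?n) of (a, \<sigma>) \<Rightarrow> \<sigma> \<circ> transpose a ?n) = \<sigma>"
    by (simp add: comp_assoc)
  show "(\<lambda>(a, \<sigma>). \<sigma> \<circ> transpose a ?n) ` ({1..?n} \<times> {\<sigma>. \<sigma> permutes {1..d}}) \<subseteq> {\<sigma>. \<sigma> permutes {1..?n}}"
    using sub by (auto intro!: permutes_compose permutes_swap_id)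
  show "(\<lambda>\<sigma>. (inv' \<sigma> ?n, \<sigma> \<circ> transpose (inv' \<sigma> ?n) ?n)) ` {\<sigma>. \<sigma> permutes {1..?n}} \<subseteq> {1..?n} \<times> {\<sigma>. \<sigma> permutes {1..d}}"
  proof (rule image_subsetI)
    fix \<sigma> assume "\<sigma> \<in> {\<sigma>. \<sigma> permutes {1..?n}}"
    then have s: "\<sigma> permutes {1..?n}" by simp
    have a: "inv' \<sigma> ?n \<in> {1..?n}" using permutes_in_image[OF permutes_inv[OF s], of ?n] by simp
    have p: "\<sigma> \<circ> transpose (inv' \<sigma> ?n) ?n permutes {1..?n}"
      using s a by (intro permutes_compose permutes_swap_id) auto
    have "(\<sigma> \<circ> transpose (inv' \<sigma> ?n) ?n) ?n = ?n" using permutes_inverses(1)[OF s] by simp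
    then have "\<sigma> \<circ> transpose (inv' \<sigma> ?n) ?n permutes {1..d}"
      by (intro permutes_superset[OF p]) (auto simp: le_Suc_eq)
    then show "(inv' \<sigma> ?n, \<sigma> \<circ> transpose (inv' \<sigma> ?n) ?n) \<in> {1..?n} \<times> {\<sigma>. \<sigma> permutes {1..d}}"
      using a by simp
  qed
qed

text \<open>The point d + 1 is fixed by \<sigma>, so the insertion after \<open>a\<close> is a join
  of its one-point cycle with the cycle of \<open>a\<close>.\<close>

lemma cycle_type_insert:
  assumes s: "\<sigma> permutes {1..d}"
  shows "cycle_type (Suc d) (\<sigma> \<circ> transpose (Suc d) (Suc d)) = add_mset 1 (cycle_type d \<sigma>)"
    "\<And>a. a \<in> {1..d} \<Longrightarrow> cycle_type (Suc d) (\<sigma> \<circ> transpose a (Suc d))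
       = add_mset (Suc (card (orbit \<sigma> a))) (cycle_type d \<sigma> - {#card (orbit \<sigma> a)#})"
proof -
  let ?n = "Suc d"
  have inv: "perm_inv {1..d} \<sigma>" by (rule perm_inv_permutes[OF s])
  have sn: "\<sigma> permutes {1..?n}" using s by (rule permutes_subset) auto
  have invn: "perm_inv {1..?n} \<sigma>" by (rule perm_inv_permutes[OF sn])
  have fx: "\<sigma> ?n = ?n" using s by (simp add: permutes_def)
  have o: "orbit \<sigma> ?n = {?n}" using fx by (simp add: orbit_eq_singleton_iff)
  have ins: "{1..?n} = insert ?n {1..d}" by auto
  have O: "orbs {1..?n} \<sigma> = insert {?n} (orbs {1..d} \<sigma>)" unfolding orbs_def ins by (simp add: o)
  have sub: "X \<subseteq> {1..d}" if "X \<in> orbs {1..d} \<sigma>" for X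
    using that orbit_subset_inv[OF inv] unfolding orbs_def by blast
  then have nO: "{?n} \<notin> orbs {1..d} \<sigma>" by fastforce
  have fin: "finite (orbs {1..d} \<sigma>)" by (rule finite_orbs) simp
  show "cycle_type ?n (\<sigma> \<circ> transpose ?n ?n) = add_mset 1 (cycle_type d \<sigma>)"
    unfolding cycle_type_orbs using O nO fin by simp
  fix a assume a: "a \<in> {1..d}"
  let ?X = "orbit \<sigma> a"
  have aK: "a \<notin> orbit \<sigma> ?n" using a o by simp
  have D: "orbs {1..?n} \<sigma> - {orbit \<sigma> ?n} = orbs {1..d} \<sigma>" using O nO o by auto
  have "a \<in> {1..?n}" "?n \<in> {1..?n}" using a by auto
  note J = orbs_join[OF invn this(2) this(1) aK, unfolded D, unfolded o]
  have XO: "?X \<in> orbs {1..d} \<sigma>" by (rule J(3))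
  have fX: "finite ?X" using sub[OF XO] finite_subset by blast
  have nX: "?n \<notin> ?X" using J(4) by auto
  have "cycle_type ?n (\<sigma> \<circ> transpose a ?n) = image_mset card (mset_set (insert ({?n} \<union> ?X) (orbs {1..d} \<sigma> - {?X})))"
    unfolding cycle_type_orbs J(1) ..
  also have "\<dots> = add_mset (card ({?n} \<union> ?X)) (image_mset card (mset_set (orbs {1..d} \<sigma> - {?X})))"
    using J(2) fin by simp
  also have "card ({?n} \<union> ?X) = Suc (card ?X)" using fX nX by simp
  also have "image_mset card (mset_set (orbs {1..d} \<sigma> - {?X})) = cycle_type d \<sigma> - {#card ?X#}"
    unfolding cycle_type_orbs using XO fin by (simp add: mset_set_Diff image_mset_Diff)
  finally show "cycle_type ?n (\<sigma> \<circ> transpose a ?n) = add_mset (Suc (card ?X)) (cycle_type d \<sigma> - {#card ?X#})" .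
qed

lemma indicator_card: "finite P \<Longrightarrow> real (card {x\<in>P. Q x}) = (\<Sum>x\<in>P. if Q x then 1 else 0)"
  by (simp add: sum.If_cases Int_def)

text \<open>The points are grouped by the length j = i - 1 of their cycle; there are j times the
  multiplicity of j of them, and the insertion creates a part i.\<close>

lemma sum_cycle_indicator:
  assumes s: "\<sigma> permutes {1..d}"
  defines "\<gamma> \<equiv> cycle_type d \<sigma>"
  shows "(\<Sum>a\<in>{1..d}. if add_mset (Suc (card (orbit \<sigma> a))) (\<gamma> - {#card (orbit \<sigma> a)#}) = \<beta> then 1 else (0::real))
    = (\<Sum>i\<in>set_mset \<beta>. if \<gamma> = add_mset (i - 1) (\<beta> - {#i#}) \<and> i \<ge> 1 then real (i - 1) * real (count \<gamma> (i - 1)) else 0)"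
proof -
  let ?O = "orbs {1..d} \<sigma>"
  let ?Q = "\<lambda>j. add_mset (Suc j) (\<gamma> - {#j#}) = \<beta>"
  have inv: "perm_inv {1..d} \<sigma>" by (rule perm_inv_permutes[OF s])
  have fin: "finite ?O" by (rule finite_orbs) simp
  have \<gamma>: "\<gamma> = image_mset card (mset_set ?O)" by (simp add: \<gamma>_def cycle_type_orbs)
  have set\<gamma>: "set_mset \<gamma> = card ` ?O" using fin by (simp add: \<gamma>)
  have cnt: "count \<gamma> j = card {X\<in>?O. card X = j}" for j
  proof -
    have "(\<Sum>X | X \<in># mset_set ?O \<and> j = card X. count (mset_set ?O) X) = (\<Sum>X\<in>{X\<in>?O. card X = j}. 1)"
      using fin by (intro sum.cong) auto
    then show ?thesis unfolding \<gamma> count_image_mset' by simp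
  qed
  have "(\<Sum>a\<in>{1..d}. if ?Q (card (orbit \<sigma> a)) then 1 else (0::real)) = (\<Sum>X\<in>?O. \<Sum>a\<in>X. if ?Q (card (orbit \<sigma> a)) then 1 else 0)"
    by (rule sum_orbs[OF _ inv]) simp
  also have "\<dots> = (\<Sum>X\<in>?O. \<Sum>a\<in>X. if ?Q (card X) then 1 else 0)"
  proof (intro sum.cong refl)
    fix X a assume "X \<in> ?O" "a \<in> X"
    then have "orbit \<sigma> a = X" using orbs_eq_orbit[OF inv] by blast
    then show "(if ?Q (card (orbit \<sigma> a)) then 1 else (0::real)) = (if ?Q (card X) then 1 else 0)" by simp
  qed
  also have "\<dots> = (\<Sum>X\<in>?O. if ?Q (card X) then real (card X) else 0)"
    by (intro sum.cong refl) simp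
  also have "\<dots> = (\<Sum>j\<in>card ` ?O. \<Sum>X\<in>{X\<in>?O. card X = j}. if ?Q (card X) then real (card X) else 0)"
    by (rule sum.image_gen[OF fin])
  also have "\<dots> = (\<Sum>j\<in>set_mset \<gamma>. if ?Q j then real j * real (count \<gamma> j) else 0)"
    unfolding set\<gamma>
  proof (intro sum.cong refl)
    fix j
    have "(\<Sum>X\<in>{X\<in>?O. card X = j}. if ?Q (card X) then real (card X) else 0) = (\<Sum>X\<in>{X\<in>?O. card X = j}. if ?Q j then real j else 0)"
      by (intro sum.cong) auto
    then show "(\<Sum>X\<in>{X\<in>?O. card X = j}. if ?Q (card X) then real (card X) else 0) = (if ?Q j then real j * real (count \<gamma> j) else 0)"
      by (simp add: cnt)
  qed
  also have "\<dots> = (\<Sum>j\<in>{j\<in>set_mset \<gamma>. ?Q j}. real j * real (count \<gamma> j))"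
    by (rule sum.inter_filter[symmetric]) simp
  also have "\<dots> = (\<Sum>i\<in>{i\<in>set_mset \<beta>. \<gamma> = add_mset (i - 1) (\<beta> - {#i#}) \<and> i \<ge> 1}. real (i - 1) * real (count \<gamma> (i - 1)))"
    by (rule sum.reindex_bij_witness[of _ "\<lambda>i. i - 1" Suc]) auto
  also have "\<dots> = (\<Sum>i\<in>set_mset \<beta>. if \<gamma> = add_mset (i - 1) (\<beta> - {#i#}) \<and> i \<ge> 1 then real (i - 1) * real (count \<gamma> (i - 1)) else 0)"
    by (rule sum.inter_filter) simp
  finally show ?thesis .
qed

text \<open>The largest point is deleted from its cycle, of length i. Comparing centralizer sizes
  before and after, the contribution of i becomes d! times i times its multiplicity, and these
  products add up to d! (d + 1).\<close>

theorem card_perms_of_type: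
  assumes "0 \<notin># \<beta>" "sum_mset \<beta> = d"
  shows "real (card (perms_of_type d \<beta>)) * real (centralizer_size \<beta>) = fact d"
  using assms
proof (induction d arbitrary: \<beta>)
  case 0
  then have "\<beta> = {#}" by (metis multiset_nonemptyE sum_mset_0_iff)
  moreover have "perms_of_type 0 {#} = {id}"
    by (auto simp: perms_of_type_def cycle_type_def)
  ultimately show ?case by (simp add: centralizer_size_def)
next
  case (Suc d)
  let ?n = "Suc d" and ?P = "{\<sigma>. \<sigma> permutes {1..d}}"
  have finP: "finite ?P" by (rule finite_permutations) simp
  have sums: "sum_mset \<beta> = (\<Sum>i\<in>set_mset \<beta>. i * count \<beta> i)"
    by (rule sum_mset_eq_sum_count) simp_all
  \<comment> \<open>The number of places for reinsertion. For i > 1 the deletion has changed one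
    part i into i - 1, hence the increased multiplicity.\<close>
  define g where "g i = (if i = 1 then 1 else real (i - 1) * real (count \<beta> (i - 1) + 1))" for i
  define G where "G i = (if i = 1 then \<beta> - {#1#} else add_mset (i - 1) (\<beta> - {#i#}))" for i
  have "real (card (perms_of_type ?n \<beta>)) = (\<Sum>\<sigma>\<in>{\<sigma>. \<sigma> permutes {1..?n}}. if cycle_type ?n \<sigma> = \<beta> then 1 else 0)"
    unfolding perms_of_type_def by (subst indicator_card[symmetric]) (auto intro: finite_permutations)
  also have "\<dots> = (\<Sum>(a, \<sigma>)\<in>{1..?n} \<times> ?P. if cycle_type ?n (\<sigma> \<circ> transpose a ?n) = \<beta> then 1 else 0)"
    by (subst sum.reindex_bij_betw[OF bij_betw_perms_Suc, symmetric]) (simp add: case_prod_unfold)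
  also have "\<dots> = (\<Sum>\<sigma>\<in>?P. \<Sum>a\<in>{1..?n}. if cycle_type ?n (\<sigma> \<circ> transpose a ?n) = \<beta> then 1 else 0)"
    by (subst sum.cartesian_product[symmetric], rule sum.swap)
  also have "\<dots> = (\<Sum>\<sigma>\<in>?P. \<Sum>i\<in>set_mset \<beta>. if cycle_type d \<sigma> = G i then g i else 0)"
  proof (rule sum.cong[OF refl])
    fix \<sigma> assume "\<sigma> \<in> ?P"
    then have s: "\<sigma> permutes {1..d}" by simp
    let ?\<gamma> = "cycle_type d \<sigma>"
    have h1: "(\<Sum>a\<in>{1..?n}. if cycle_type ?n (\<sigma> \<circ> transpose a ?n) = \<beta> then 1 else (0::real))
      = (if add_mset 1 ?\<gamma> = \<beta> then 1 else 0) + (\<Sum>a\<in>{1..d}. if cycle_type ?n (\<sigma> \<circ> transpose a ?n) = \<beta> then 1 else 0)"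
      unfolding cycle_type_insert(1)[OF s, symmetric] by simp
    have "(\<Sum>a\<in>{1..d}. if cycle_type ?n (\<sigma> \<circ> transpose a ?n) = \<beta> then 1 else (0::real))
      = (\<Sum>a\<in>{1..d}. if add_mset (Suc (card (orbit \<sigma> a))) (?\<gamma> - {#card (orbit \<sigma> a)#}) = \<beta> then 1 else 0)"
      by (intro sum.cong refl) (simp only: cycle_type_insert(2)[OF s])
    also have "\<dots> = (\<Sum>i\<in>set_mset \<beta>. if ?\<gamma> = add_mset (i - 1) (\<beta> - {#i#}) \<and> i \<ge> 1 then real (i - 1) * real (count ?\<gamma> (i - 1)) else 0)"
      by (rule sum_cycle_indicator[OF s])
    finally have h2: "(\<Sum>a\<in>{1..d}. if cycle_type ?n (\<sigma> \<circ> transpose a ?n) = \<beta> then 1 else (0::real))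
      = (\<Sum>i\<in>set_mset \<beta>. if ?\<gamma> = add_mset (i - 1) (\<beta> - {#i#}) \<and> i \<ge> 1 then real (i - 1) * real (count ?\<gamma> (i - 1)) else 0)" .
    have h3: "(if add_mset 1 ?\<gamma> = \<beta> then 1 else 0) = (\<Sum>i\<in>set_mset \<beta>. if i = 1 \<and> ?\<gamma> = \<beta> - {#1#} then 1 else (0::real))"
    proof (cases "1 \<in># \<beta>")
      case True
      then have "add_mset 1 ?\<gamma> = \<beta> \<longleftrightarrow> ?\<gamma> = \<beta> - {#1#}" by auto
      moreover have "(\<Sum>i\<in>set_mset \<beta>. if i = 1 \<and> ?\<gamma> = \<beta> - {#1#} then 1 else (0::real))
          = (\<Sum>i\<in>set_mset \<beta>. if i = 1 then (if ?\<gamma> = \<beta> - {#1#} then 1 else 0) else 0)"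
        by (intro sum.cong refl) simp
      ultimately show ?thesis using True by (simp add: sum.delta)
    next
      case False
      then have "(\<Sum>i\<in>set_mset \<beta>. if i = 1 \<and> ?\<gamma> = \<beta> - {#1#} then 1 else (0::real)) = 0"
        by (intro sum.neutral) auto
      then show ?thesis using False by auto
    qed
    have h4: "(\<Sum>i\<in>set_mset \<beta>. if i = 1 \<and> ?\<gamma> = \<beta> - {#1#} then 1 else (0::real))
       + (\<Sum>i\<in>set_mset \<beta>. if ?\<gamma> = add_mset (i - 1) (\<beta> - {#i#}) \<and> i \<ge> 1 then real (i - 1) * real (count ?\<gamma> (i - 1)) else 0)
       = (\<Sum>i\<in>set_mset \<beta>. if ?\<gamma> = G i then g i else 0)"
      unfolding sum.distrib[symmetric]
    proof (intro sum.cong refl)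
      fix i assume "i \<in> set_mset \<beta>"
      then have "i \<ge> 1" using Suc.prems(1) by (cases i) auto
      then show "(if i = 1 \<and> ?\<gamma> = \<beta> - {#1#} then 1 else (0::real)) +
          (if ?\<gamma> = add_mset (i - 1) (\<beta> - {#i#}) \<and> i \<ge> 1 then real (i - 1) * real (count ?\<gamma> (i - 1)) else 0) =
          (if ?\<gamma> = G i then g i else 0)"
        by (auto simp: G_def g_def)
    qed
    show "(\<Sum>a\<in>{1..?n}. if cycle_type ?n (\<sigma> \<circ> transpose a ?n) = \<beta> then 1 else (0::real))
      = (\<Sum>i\<in>set_mset \<beta>. if ?\<gamma> = G i then g i else 0)"
      by (simp only: h1 h2 h3 h4)
  qed
  also have "\<dots> = (\<Sum>i\<in>set_mset \<beta>. \<Sum>\<sigma>\<in>?P. if cycle_type d \<sigma> = G i then g i else 0)"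
    by (rule sum.swap)
  also have "\<dots> = (\<Sum>i\<in>set_mset \<beta>. real (card (perms_of_type d (G i))) * g i)"
  proof (intro sum.cong refl)
    fix i
    have "real (card (perms_of_type d (G i))) = (\<Sum>\<sigma>\<in>?P. if cycle_type d \<sigma> = G i then 1 else 0)"
      using indicator_card[OF finP, of "\<lambda>\<sigma>. cycle_type d \<sigma> = G i"] by (simp add: perms_of_type_def)
    then show "(\<Sum>\<sigma>\<in>?P. if cycle_type d \<sigma> = G i then g i else 0) = real (card (perms_of_type d (G i))) * g i"
      by (simp add: sum_distrib_right if_distrib[of "\<lambda>x. x * g i"] cong: if_cong)
  qed
  finally have cnt: "real (card (perms_of_type ?n \<beta>)) = (\<Sum>i\<in>set_mset \<beta>. real (card (perms_of_type d (G i))) * g i)" .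
  have summand: "real (card (perms_of_type d (G i))) * g i * real (centralizer_size \<beta>) = fact d * real (i * count \<beta> i)"
    if i: "i \<in># \<beta>" for i
  proof -
    obtain \<delta> where \<delta>: "\<beta> = add_mset i \<delta>" using i by (metis mset_add)
    have i1: "i \<ge> 1" using i Suc.prems(1) by (cases i) auto
    have IH: "real (card (perms_of_type d (G i))) * real (centralizer_size (G i)) = fact d"
    proof (rule Suc.IH)
      show "0 \<notin># G i" using Suc.prems(1) i1 by (auto simp: G_def \<delta>)
      show "sum_mset (G i) = d" using Suc.prems(2) i1 by (auto simp: G_def \<delta>)
    qed
    have e: "real (centralizer_size \<beta>) * g i = real (centralizer_size (G i)) * real (i * count \<beta> i)"
    proof (cases "i = 1")
      case True
      then show ?thesis by (simp add: G_def g_def \<delta> centralizer_size_add algebra_simps)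
    next
      case False
      then obtain k where k: "i = Suc k" "k > 0" using i1 by (cases i) auto
      have c: "centralizer_size \<beta> = centralizer_size \<delta> * (Suc k * (count \<delta> (Suc k) + 1))"
        "centralizer_size (G i) = centralizer_size \<delta> * (k * (count \<delta> k + 1))"
        "g i = real k * real (count \<delta> k + 1)" "count \<beta> i = count \<delta> (Suc k) + 1"
        using k by (simp_all add: G_def g_def \<delta> centralizer_size_add)
      show ?thesis unfolding c of_nat_mult unfolding k(1) by (simp only: mult_ac)
    qed
    have "real (card (perms_of_type d (G i))) * g i * real (centralizer_size \<beta>)
      = real (card (perms_of_type d (G i))) * (real (centralizer_size \<beta>) * g i)"
      by (simp only: mult_ac)
    also have "\<dots> = (real (card (perms_of_type d (G i))) * real (centralizer_size (G i))) * real (i * count \<beta> i)"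
      unfolding e by (simp only: mult.assoc)
    finally show ?thesis by (simp only: IH)
  qed
  have "real (card (perms_of_type ?n \<beta>)) * real (centralizer_size \<beta>) = (\<Sum>i\<in>set_mset \<beta>. fact d * real (i * count \<beta> i))"
    unfolding cnt sum_distrib_right by (intro sum.cong refl summand)
  also have "\<dots> = fact d * real (sum_mset \<beta>)"
    unfolding sums by (simp add: sum_distrib_left)
  finally show ?case using Suc.prems(2) by (simp add: mult.commute)
qed

section \<open>Monotone Hurwitz numbers in genus 1\<close>

definition trs :: "(nat \<times> nat) list \<Rightarrow> (nat \<Rightarrow> nat) list" where
  "trs ps = map (\<lambda>(a, b). transpose a b) ps"

lemma in_set_trsE:
  assumes "t \<in> set (trs ps)"
  obtains a b where "(a, b) \<in> set ps" "t = transpose a b"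
proof -
  obtain p where p: "p \<in> set ps" "t = (case p of (a, b) \<Rightarrow> transpose a b)"
    using assms unfolding trs_def set_map by (rule imageE)
  obtain a b where "p = (a, b)" by (rule prod.exhaust)
  with p that[of a b] show ?thesis by simp
qed

lemma in_set_trsI: "(a, b) \<in> set ps \<Longrightarrow> transpose a b \<in> set (trs ps)"
  unfolding trs_def set_map by (rule image_eqI[of _ _ "(a, b)"]) simp_all

lemma transpose_eq_iff_less:
  fixes a b c e :: nat
  assumes "a < b" "c < e" "transpose a b = transpose c e"
  shows "a = c \<and> b = e"
proof -
  have b: "transpose c e a = b" using assms(3) by (metis transpose_apply_first)
  consider "a = c" | "a = e" | "a \<noteq> c" "a \<noteq> e" by blast
  then show ?thesis
    using b assms(1,2) by cases (auto simp: transpose_def)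
qed

lemma foldr_trs: "foldr (\<circ>) (trs ps) id = prod_tr ps"
  by (induction ps) (auto simp: trs_def prod_tr_def)

lemma prod_tr_permutes: "(\<And>a b. (a, b) \<in> set ps \<Longrightarrow> a \<in> A \<and> b \<in> A) \<Longrightarrow> prod_tr ps permutes A"
proof (induction ps)
  case Nil
  show ?case unfolding prod_tr_Nil by (rule permutes_id)
next
  case (Cons p ps)
  obtain a b where p: "p = (a, b)" by (cases p)
  have "prod_tr ps permutes A" using Cons by auto
  moreover have "transpose a b permutes A" using Cons.prems[of a b] p by (intro permutes_swap_id) auto
  ultimately show ?case unfolding prod_tr_Cons p fst_conv snd_conv by (rule permutes_compose)
qed

lemma mono_seqs_permutes: "ps \<in> mono_seqs A r \<Longrightarrow> prod_tr ps permutes A"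
  by (rule prod_tr_permutes) (auto simp: mono_seqs_def)

lemma inj_on_trs: "inj_on trs (mono_seqs A r)"
proof (rule inj_onI)
  fix ps qs assume pq: "ps \<in> mono_seqs A r" "qs \<in> mono_seqs A r" "trs ps = trs qs"
  show "ps = qs"
  proof (rule nth_equalityI)
    show l: "length ps = length qs" using pq by (simp add: mono_seqs_def)
    fix i assume i: "i < length ps"
    obtain a b c e where p: "ps ! i = (a, b)" "qs ! i = (c, e)" by (metis surj_pair)
    have "(a, b) \<in> set ps" "(c, e) \<in> set qs" using i l p by (metis nth_mem)+
    then have "a < b" "c < e" using pq by (auto simp: mono_seqs_def)
    moreover have "transpose a b = transpose c e"
      using arg_cong[OF pq(3), of "\<lambda>xs. xs ! i"] i l p by (simp add: trs_def)
    ultimately show "ps ! i = qs ! i" using transpose_eq_iff_less p by simp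
  qed
qed

lemma trs_mono_seqs:
  "trs ` mono_seqs {1..d} r = {ts. length ts = r \<and> (\<forall>t\<in>set ts. is_transposition d t) \<and> monotone_transpositions ts}"
proof (intro subset_antisym subsetI)
  fix ts assume "ts \<in> trs ` mono_seqs {1..d} r"
  then obtain ps where ps: "ts = trs ps" "ps \<in> mono_seqs {1..d} r" by auto
  have t: "is_transposition d t" if "t \<in> set ts" for t
  proof -
    obtain a b where ab: "(a, b) \<in> set ps" "t = transpose a b" using \<open>t \<in> set ts\<close> unfolding ps(1) by (rule in_set_trsE)
    then have "a \<in> {1..d} \<and> b \<in> {1..d} \<and> a < b" using ps(2) unfolding mono_seqs_def by blast
    then show ?thesis using ab(2) unfolding is_transposition_def by blast
  qed
  have "monotone_transpositions ts"
    unfolding monotone_transpositions_def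
  proof (rule exI[of _ "\<lambda>i. fst (ps ! i)"], rule exI[of _ "\<lambda>i. snd (ps ! i)"], intro conjI allI impI)
    fix i assume i: "i < length ts"
    then have m: "ps ! i \<in> set ps" by (simp add: ps(1) trs_def)
    then show "fst (ps ! i) < snd (ps ! i)" using ps(2) by (auto simp: mono_seqs_def)
    show "ts ! i = transpose (fst (ps ! i)) (snd (ps ! i))"
      using i by (simp add: ps(1) trs_def case_prod_unfold)
  next
    fix i j assume "i \<le> j" "j < length ts"
    then show "snd (ps ! i) \<le> snd (ps ! j)"
      using ps(2) sorted_nth_mono[of "map snd ps" i j] by (simp add: mono_seqs_def ps(1) trs_def)
  qed
  then show "ts \<in> {ts. length ts = r \<and> (\<forall>t\<in>set ts. is_transposition d t) \<and> monotone_transpositions ts}"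
    using t ps by (auto simp: mono_seqs_def trs_def)
next
  fix ts assume ts: "ts \<in> {ts. length ts = r \<and> (\<forall>t\<in>set ts. is_transposition d t) \<and> monotone_transpositions ts}"
  then obtain a b :: "nat \<Rightarrow> nat" where ab: "\<forall>i < length ts. a i < b i \<and> ts ! i = transpose (a i) (b i)"
    "\<forall>i j. i \<le> j \<longrightarrow> j < length ts \<longrightarrow> b i \<le> b j" by (auto simp: monotone_transpositions_def)
  define ps where "ps = map (\<lambda>i. (a i, b i)) [0..<length ts]"
  have "trs ps = ts"
    by (rule nth_equalityI) (use ab(1) in \<open>auto simp: trs_def ps_def\<close>)
  moreover have "ps \<in> mono_seqs {1..d} r"
    unfolding mono_seqs_def
  proof (intro CollectI conjI)
    show "length ps = r" using ts by (simp add: ps_def)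
    show "sorted (map snd ps)" using ab(2) by (simp add: ps_def sorted_iff_nth_mono)
    \<comment> \<open>The witnesses of monotonicity are a priori arbitrary numbers; they lie in
      \<open>{1..d}\<close> because the ordered entries of a transposition are unique.\<close>
    have "a i \<in> {1..d} \<and> b i \<in> {1..d} \<and> a i < b i" if "i < length ts" for i
    proof -
      have "is_transposition d (ts ! i)" using ts that by auto
      then obtain x y where xy: "x \<in> {1..d}" "y \<in> {1..d}" "x < y" "ts ! i = transpose x y"
        unfolding is_transposition_def by blast
      then show ?thesis using ab(1) that transpose_eq_iff_less[of x y "a i" "b i"] by auto
    qed
    then show "\<forall>(a, b)\<in>set ps. a \<in> {1..d} \<and> b \<in> {1..d} \<and> a < b" unfolding ps_def by auto
  qed
  ultimately show "ts \<in> trs ` mono_seqs {1..d} r" by blast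
qed

text \<open>As the inverse of the product of the transpositions, \<rho> preserves every set that no
  edge leaves, so the whole group does. Conversely, no edge leaves the orbit of a point under the
  group.\<close>

lemma transitive_iff_connected:
  assumes ps: "ps \<in> mono_seqs {1..d} r" and \<rho>: "\<rho> permutes {1..d}" "prod_tr ps = inv' \<rho>"
  shows "transitive_on d (generate (sym_group d) ({\<rho>, id} \<union> set (trs ps))) \<longleftrightarrow> connected_seq {1..d} ps"
proof
  let ?H = "{\<rho>, id} \<union> set (trs ps)" and ?A = "{1..d}"
  have H: "h permutes ?A" if "h \<in> ?H" for h
  proof -
    have "h permutes ?A" if "h \<in> set (trs ps)"
    proof -
      obtain a b where "(a, b) \<in> set ps" "h = transpose a b" using \<open>h \<in> set (trs ps)\<close> by (rule in_set_trsE)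
      moreover from this(1) have "a \<in> ?A" "b \<in> ?A" using ps unfolding mono_seqs_def by blast+
      ultimately show ?thesis by (simp only: permutes_swap_id)
    qed
    then show ?thesis using that \<rho>(1) permutes_id[of ?A] by blast
  qed
  show "connected_seq ?A ps" if tr: "transitive_on d (generate (sym_group d) ?H)"
    unfolding connected_seq_def
  proof (intro allI impI)
    fix B assume B: "B \<subseteq> ?A" "B \<noteq> {}" "stable B ps"
    have prodB: "prod_tr ps x \<in> B \<longleftrightarrow> x \<in> B" for x
    proof (cases "x \<in> ?A")
      case True
      have "stable (?A - B) ps" using stable_Diff[OF stable_self[OF ps] B(3)] .
      then show ?thesis using prod_tr_stable[OF B(3), of x] prod_tr_stable[of "?A - B" ps x] True by blast
    next
      case False
      then have "prod_tr ps x = x" using mono_seqs_permutes[OF ps] by (metis permutes_not_in)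
      then show ?thesis by simp
    qed
    have rhoB: "\<rho> x \<in> B \<longleftrightarrow> x \<in> B" for x
      using prodB[of "\<rho> x"] permutes_inverses(2)[OF \<rho>(1), of x] by (simp add: \<rho>(2))
    have HB: "h x \<in> B \<longleftrightarrow> x \<in> B" if "h \<in> ?H" for h x
    proof -
      have tr: "h x \<in> B \<longleftrightarrow> x \<in> B" if "h \<in> set (trs ps)"
      proof -
        obtain a b where ab: "(a, b) \<in> set ps" "h = transpose a b" using \<open>h \<in> set (trs ps)\<close> by (rule in_set_trsE)
        then have "a \<in> B \<longleftrightarrow> b \<in> B" using B(3) unfolding stable_def by blast
        then show ?thesis unfolding ab(2) by (auto simp: transpose_def)
      qed
      from that consider "h = \<rho>" | "h = id" | "h \<in> set (trs ps)" by blast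
      then show ?thesis
      proof cases
        case 1
        then show ?thesis using rhoB by simp
      next
        case 2
        then show ?thesis by simp
      qed (rule tr)
    qed
    have G: "g permutes ?A \<and> (\<forall>x. g x \<in> B \<longleftrightarrow> x \<in> B)" if "g \<in> generate (sym_group d) ?H" for g
      using that
    proof induction
      case one
      show ?case unfolding sym_group_one by (intro conjI allI permutes_id) simp
    next
      case (incl h)
      then show ?case using H HB by blast
    next
      case (inv h)
      then have h: "h permutes ?A" by (rule H)
      then have e: "m_inv (sym_group d) h = inv' h" by (simp add: sym_group_carrier)
      have "inv' h x \<in> B \<longleftrightarrow> x \<in> B" for x
        using HB[OF inv, of "inv' h x"] permutes_inverses(1)[OF h, of x] by simp
      then show ?case unfolding e using permutes_inv[OF h] by simp
    next
      case (eng h1 h2)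
      then have c: "h1 \<circ> h2 permutes ?A" by (intro permutes_compose) auto
      show ?case unfolding sym_group_mult
        by (intro conjI allI c) (use eng in simp)
    qed
    obtain x where x: "x \<in> B" using B(2) by blast
    have "y \<in> B" if "y \<in> ?A" for y
    proof -
      have "x \<in> ?A" using x B(1) by (rule subsetD[rotated])
      from tr[unfolded transitive_on_def, rule_format, OF this that]
      obtain g where g: "g \<in> generate (sym_group d) ?H" "g x = y" ..
      show ?thesis using G[OF g(1)] x unfolding g(2)[symmetric] by simp
    qed
    then show "B = ?A" by (intro subset_antisym B(1) subsetI)
  qed
  show "transitive_on d (generate (sym_group d) ?H)" if con: "connected_seq ?A ps"
    unfolding transitive_on_def
  proof (intro ballI)
    fix x y assume x: "x \<in> ?A" and y: "y \<in> ?A"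
    let ?G = "generate (sym_group d) ?H"
    define B where "B = {z\<in>?A. \<exists>g\<in>?G. g x = z}"
    have one: "id \<in> ?G" using generate.one[of "sym_group d" ?H] by (simp add: sym_group_one)
    have step: "transpose a b z \<in> B" if "z \<in> B" "(a, b) \<in> set ps" for a b z
    proof -
      obtain g where g: "g \<in> ?G" "g x = z" "z \<in> ?A" using \<open>z \<in> B\<close> by (auto simp: B_def)
      have "transpose a b \<in> ?H" using in_set_trsI[OF that(2)] by blast
      then have "transpose a b \<circ> g \<in> ?G" using generate.eng[OF generate.incl g(1)] by (simp add: sym_group_mult)
      moreover have "transpose a b z \<in> ?A" using H[OF \<open>transpose a b \<in> ?H\<close>] g(3) by (metis permutes_in_image)
      moreover have "(transpose a b \<circ> g) x = transpose a b z" using g by simp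
      ultimately show ?thesis unfolding B_def by blast
    qed
    have "stable B ps"
      unfolding stable_def
    proof (rule ballI, clarify)
      fix a b assume ab: "(a, b) \<in> set ps"
      show "a \<in> B \<longleftrightarrow> b \<in> B" using step[OF _ ab, of a] step[OF _ ab, of b] by auto
    qed
    moreover have "x \<in> B" using one x unfolding B_def by (auto intro: bexI[of _ id])
    moreover have "B \<subseteq> ?A" by (auto simp: B_def)
    ultimately have "B = ?A" using con unfolding connected_seq_def by blast
    then show "\<exists>g\<in>?G. g x = y" using y unfolding B_def by blast
  qed
qed

lemma cycle_type_id_iff:
  assumes "\<sigma> permutes {1..d}"
  shows "cycle_type d \<sigma> = replicate_mset d 1 \<longleftrightarrow> \<sigma> = id"
proof
  assume c: "cycle_type d \<sigma> = replicate_mset d 1"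
  have "\<sigma> x = x" if "x \<in> {1..d}" for x
  proof -
    have "orbit \<sigma> x \<in># mset_set (orbs {1..d} \<sigma>)" using that by (simp add: orbs_def)
    then have "card (orbit \<sigma> x) \<in># cycle_type d \<sigma>" unfolding cycle_type_orbs by simp
    then have "card (orbit \<sigma> x) = 1" unfolding c by (simp split: if_splits)
    then obtain z where "orbit \<sigma> x = {z}" by (metis card_1_singletonE)
    moreover have "x \<in> orbit \<sigma> x"
      using assms by (intro permutation_self_in_orbit) (auto simp: permutation_permutes)
    ultimately have "orbit \<sigma> x = {x}" by auto
    then show ?thesis by (simp add: orbit_eq_singleton_iff)
  qed
  moreover have "\<sigma> x = x" if "x \<notin> {1..d}" for x using assms that by (metis permutes_not_in)
  ultimately show "\<sigma> = id" by (metis eq_id_iff ext)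
next
  assume "\<sigma> = id"
  have "orbit id x = {x}" for x :: nat by (simp add: orbit_eq_singleton_iff)
  then have "orbs {1..d} id = (\<lambda>x. {x}) ` {1..d}" by (simp add: orbs_def)
  then have "cycle_type d id = image_mset card (image_mset (\<lambda>x. {x}) (mset_set {1..d}))"
    unfolding cycle_type_orbs by (simp add: image_mset_mset_set inj_on_def)
  also have "\<dots> = image_mset (\<lambda>x. 1) (mset_set {1..d})"
    unfolding image_mset.compositionality comp_def by simp
  also have "\<dots> = replicate_mset d 1"
    by (simp only: image_mset_const_eq size_mset_set card_atLeastAtMost) simp
  finally show "cycle_type d \<sigma> = replicate_mset d 1" using \<open>\<sigma> = id\<close> by simp
qed

text \<open>With \<sigma> the identity, the product condition says that the transpositions multiply
  to the inverse of \<rho>. For g = 1 the prescribed length is length \<alpha> + d.\<close>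

lemma bij_betw_monotone_factorizations:
  assumes d: "sum_list \<alpha> = d"
  shows "bij_betw (\<lambda>(\<rho>, ps). (\<rho>, id, trs ps))
    (SIGMA \<rho>:perms_of_type d (mset \<alpha>). mono_facts {1..d} (inv' \<rho>) (length \<alpha> + d)) (monotone_factorizations 1 \<alpha>)"
    (is "bij_betw ?F ?X ?Y")
proof -
  let ?A = "{1..d}" and ?r = "length \<alpha> + d"
  have prod_eq: "(\<forall>x\<in>?A. prod_tr ps x = inv' \<rho> x) \<longleftrightarrow> prod_tr ps = inv' \<rho>"
    if "\<rho> permutes ?A" "ps \<in> mono_seqs ?A r" for \<rho> ps r
  proof -
    have "prod_tr ps x = inv' \<rho> x" if "x \<notin> ?A" for x
      using mono_seqs_permutes[OF \<open>ps \<in> mono_seqs ?A r\<close>] permutes_inv[OF \<open>\<rho> permutes ?A\<close>] that by (metis permutes_not_in)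
    then show ?thesis by (metis ext)
  qed
  have prod_id: "\<rho> \<circ> id \<circ> f = id \<longleftrightarrow> f = inv' \<rho>" if "\<rho> permutes ?A" for \<rho> f
  proof
    assume "\<rho> \<circ> id \<circ> f = id"
    then have "inv' \<rho> \<circ> (\<rho> \<circ> f) = inv' \<rho>" by simp
    then show "f = inv' \<rho>" using permutes_inv_o(2)[OF that] by (simp add: comp_assoc[symmetric])
  qed (use permutes_inv_o(1)[OF that] in simp)
  have len: "int n = 2 * int 1 - 2 + int (length \<alpha>) + int d \<longleftrightarrow> n = ?r" for n by auto
  have Y: "?Y = {(\<rho>, \<sigma>, ts). \<rho> \<in> perms_of_type d (mset \<alpha>) \<and> \<sigma> = id \<and> ts \<in> trs ` mono_seqs ?A ?r \<and>
      \<rho> \<circ> id \<circ> foldr (\<circ>) ts id = id \<and> transitive_on d (generate (sym_group d) ({\<rho>, id} \<union> set ts))}"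
    unfolding monotone_factorizations_def Let_def d trs_mono_seqs len perms_of_type_def sym_group_carrier
    using cycle_type_id_iff[of _ d] permutes_id[of ?A] by auto
  have inj: "inj_on ?F ?X"
  proof (rule inj_onI)
    fix u v assume "u \<in> ?X" "v \<in> ?X" "?F u = ?F v"
    then show "u = v"
      using inj_onD[OF inj_on_trs[of ?A ?r]] by (auto simp: mono_facts_def)
  qed
  have "?F ` ?X = ?Y"
  proof (intro subset_antisym subsetI)
    fix z assume "z \<in> ?F ` ?X"
    then obtain \<rho> ps where z: "z = (\<rho>, id, trs ps)" "\<rho> \<in> perms_of_type d (mset \<alpha>)" "ps \<in> mono_facts ?A (inv' \<rho>) ?r"
      by auto
    have \<rho>: "\<rho> permutes ?A" using z by (simp add: perms_of_type_def)
    have ps: "ps \<in> mono_seqs ?A ?r" "connected_seq ?A ps" using z by (auto simp: mono_facts_def)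
    have p: "prod_tr ps = inv' \<rho>" using z prod_eq[OF \<rho> ps(1)] by (simp add: mono_facts_def)
    have "\<rho> \<circ> id \<circ> prod_tr ps = id" using prod_id[OF \<rho>] p by blast
    then show "z \<in> ?Y"
      unfolding Y z(1) using z(2) ps transitive_iff_connected[OF ps(1) \<rho> p] by (simp add: foldr_trs)
  next
    fix z assume "z \<in> ?Y"
    then obtain \<rho> ps where z: "z = (\<rho>, id, trs ps)" "\<rho> \<in> perms_of_type d (mset \<alpha>)" "ps \<in> mono_seqs ?A ?r"
       "\<rho> \<circ> id \<circ> prod_tr ps = id" "transitive_on d (generate (sym_group d) ({\<rho>, id} \<union> set (trs ps)))"
      unfolding Y by (auto simp: foldr_trs)
    have \<rho>: "\<rho> permutes ?A" using z by (simp add: perms_of_type_def)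
    have p: "prod_tr ps = inv' \<rho>" using z(4) prod_id[OF \<rho>] by blast
    have "ps \<in> mono_facts ?A (inv' \<rho>) ?r"
      using z(3,5) transitive_iff_connected[OF z(3) \<rho> p] p by (simp add: mono_facts_def)
    then show "z \<in> ?F ` ?X" using z(1,2) by force
  qed
  then show ?thesis using inj by (simp add: bij_betw_def)
qed

section \<open>From orbits to the parts of the partition\<close>

lemma orbs_inv: "permutation \<rho> \<Longrightarrow> orbs A (inv' \<rho>) = orbs A \<rho>"
  unfolding orbs_def by (intro image_cong refl orbit_inv_eq)

lemma exists_list_with_image:
  "image_mset f (mset_set X) = mset ys \<Longrightarrow> finite X \<Longrightarrow> \<exists>xs. distinct xs \<and> set xs = X \<and> map f xs = ys"
proof (induction ys arbitrary: X)
  case Nil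
  then show ?case by (auto simp: mset_set_empty_iff)
next
  case (Cons y ys)
  have "y \<in># image_mset f (mset_set X)" using Cons.prems by simp
  then obtain x where x: "x \<in> X" "y = f x" using Cons.prems(2) by auto
  have "mset_set X = add_mset x (mset_set (X - {x}))"
    using mset_set.remove[OF Cons.prems(2) x(1)] .
  then have "image_mset f (mset_set (X - {x})) = mset ys" using Cons.prems(1) x by simp
  from Cons.IH[OF this] obtain xs where "distinct xs" "set xs = X - {x}" "map f xs = ys"
    using Cons.prems(2) by auto
  then show ?case using x by (intro exI[of _ "x # xs"]) auto
qed

lemma esym_elem_sym:
  assumes "distinct xs" shows "esym y m (set xs) = elem_sym m (map y xs)"
proof -
  let ?l = "length xs"
  have bij: "bij_betw ((!) xs) {..<?l} (set xs)" using assms by (intro bij_betw_nth) auto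
  then have inj: "inj_on ((!) xs) {..<?l}" and im: "(!) xs ` {..<?l} = set xs" by (auto simp: bij_betw_def)
  have "esym y m (set xs) = (\<Sum>I | I \<subseteq> {..<?l} \<and> card I = m. prod y ((!) xs ` I))"
    unfolding esym_def
  proof (rule sum.reindex_bij_betw[symmetric, where h="(`) ((!) xs)"])
    have b: "bij_betw ((`) ((!) xs)) (Pow {..<?l}) (Pow (set xs))" by (rule bij_betw_Pow[OF bij])
    have c: "card ((!) xs ` I) = card I" if "I \<subseteq> {..<?l}" for I
      using inj_on_subset[OF inj that] by (rule card_image)
    show "bij_betw ((`) ((!) xs)) {I. I \<subseteq> {..<?l} \<and> card I = m} {T. T \<subseteq> set xs \<and> card T = m}"
      unfolding bij_betw_def
    proof
      show "inj_on ((`) ((!) xs)) {I. I \<subseteq> {..<?l} \<and> card I = m}"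
        by (rule inj_on_subset[of _ "Pow {..<?l}"]) (use b in \<open>auto simp: bij_betw_def\<close>)
      show "(`) ((!) xs) ` {I. I \<subseteq> {..<?l} \<and> card I = m} = {T. T \<subseteq> set xs \<and> card T = m}"
      proof (intro subset_antisym subsetI)
        fix T assume "T \<in> {T. T \<subseteq> set xs \<and> card T = m}"
        moreover from this obtain I where "I \<subseteq> {..<?l}" "T = (!) xs ` I" by (metis im mem_Collect_eq subset_imageE)
        ultimately show "T \<in> (`) ((!) xs) ` {I. I \<subseteq> {..<?l} \<and> card I = m}" using c[of I] by auto
      qed (use c im in auto)
    qed
  qed
  also have "\<dots> = (\<Sum>I | I \<subseteq> {..<?l} \<and> card I = m. \<Prod>i\<in>I. map y xs ! i)"
  proof (rule sum.cong[OF refl])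
    fix I assume "I \<in> {I. I \<subseteq> {..<?l} \<and> card I = m}"
    then have I: "I \<subseteq> {..<?l}" by simp
    have "prod y ((!) xs ` I) = (\<Prod>i\<in>I. y (xs ! i))"
      using prod.reindex[OF inj_on_subset[OF inj I], of y] by (simp add: comp_def)
    also have "\<dots> = (\<Prod>i\<in>I. map y xs ! i)" using I by (intro prod.cong) auto
    finally show "prod y ((!) xs ` I) = (\<Prod>i\<in>I. map y xs ! i)" .
  qed
  finally show ?thesis by (simp add: elem_sym_def)
qed

lemma Phi1_eq_parts:
  assumes "finite X" "image_mset card (mset_set X) = mset \<alpha>" "sum_list \<alpha> = d"
  shows "Phi1 card X = (\<Prod>j<length \<alpha>. nbinom (\<alpha> ! j)) / 24 *
    (pochhammer (2 * real d + 1) (length \<alpha>) - 3 * pochhammer (2 * real d + 1) (length \<alpha> - 1)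
      - (\<Sum>k=2..length \<alpha>. fact (k - 2) * pochhammer (2 * real d + 1) (length \<alpha> - k)
           * elem_sym k (map (\<lambda>a. 2 * real a + 1) \<alpha>)))"
proof -
  obtain xs where xs: "distinct xs" "set xs = X" "map card xs = \<alpha>"
    using exists_list_with_image[OF assms(2,1)] by blast
  have len: "card X = length \<alpha>" using xs by (metis distinct_card length_map)
  have total: "total card X = real d"
  proof -
    have "total card X = real (\<Sum>Y\<in>X. card Y)" by (simp add: total_def)
    also have "(\<Sum>Y\<in>X. card Y) = sum_list \<alpha>"
      using xs sum_list_distinct_conv_sum_set[of xs card] by simp
    finally show ?thesis using assms(3) by simp
  qed
  have "bij_betw ((!) xs) {..<length xs} X" using xs by (intro bij_betw_nth) auto
  then have "(\<Prod>Y\<in>X. nbinom (card Y)) = (\<Prod>j<length xs. nbinom (card (xs ! j)))"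
    by (rule prod.reindex_bij_betw[symmetric])
  also have "\<dots> = (\<Prod>j<length \<alpha>. nbinom (\<alpha> ! j))"
    using xs(3) by (intro prod.cong) auto
  finally have p: "(\<Prod>Y\<in>X. nbinom (card Y)) = (\<Prod>j<length \<alpha>. nbinom (\<alpha> ! j))" .
  have "map (wt card) xs = map (\<lambda>a. 2 * real a + 1) \<alpha>"
    using xs(3) by (auto simp: wt_def)
  then have e: "esym (wt card) m X = elem_sym m (map (\<lambda>a. 2 * real a + 1) \<alpha>)" for m
    using esym_elem_sym[OF xs(1), of "wt card" m] xs(2) by simp
  show ?thesis unfolding Phi1_def len total p e ..
qed

lemma centralizer_size_mset:
  "real (centralizer_size (mset \<alpha>)) = (\<Prod>j<length \<alpha>. real (\<alpha> ! j)) * real (aut_size \<alpha>)"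
proof -
  have "prod_mset (mset \<alpha>) = (\<Prod>j<length \<alpha>. \<alpha> ! j)"
    by (simp add: prod_mset_prod_list prod.list_conv_set_nth atLeast0LessThan)
  then show ?thesis
    by (simp add: centralizer_size_def aut_size_def count_mset)
qed

theorem theorem1p3:
  fixes d :: nat and \<alpha> :: "nat list"
  assumes "d \<ge> 1" and "\<alpha> \<turnstile>\<^sub>p d"
  shows "real (monotone_hurwitz 1 \<alpha>) =
    1 / 24 * (fact d / real (aut_size \<alpha>)) *
    (\<Prod>j<length \<alpha>. real ((2 * \<alpha> ! j) choose (\<alpha> ! j))) *
    (pochhammer (2 * real d + 1) (length \<alpha>)
      - 3 * pochhammer (2 * real d + 1) (length \<alpha> - 1)
      - (\<Sum>k=2..length \<alpha>. fact (k - 2) * pochhammer (2 * real d + 1) (length \<alpha> - k)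
           * elem_sym k (map (\<lambda>a. 2 * real a + 1) \<alpha>)))"
    (is "_ = 1 / 24 * _ * _ * ?Q")
proof -
  let ?A = "{1..d}" and ?r = "length \<alpha> + d" and ?P = "perms_of_type d (mset \<alpha>)"
  have sum: "sum_list \<alpha> = d" and pos: "\<And>a. a \<in> set \<alpha> \<Longrightarrow> a \<ge> 1"
    using assms(2) by (auto simp: is_partition_def)
  \<comment> \<open>The count depends on \<rho> only through the orbits, which its inverse shares,
    and the length is \<open>min_len\<close> + 2, hence genus 1.\<close>
  have value_at: "real (card (mono_facts ?A (inv' \<rho>) ?r)) = (\<Prod>j<length \<alpha>. nbinom (\<alpha> ! j)) / 24 * ?Q" if "\<rho> \<in> ?P" for \<rho>
  proof -
    have \<rho>: "\<rho> permutes ?A" "image_mset card (mset_set (orbs ?A \<rho>)) = mset \<alpha>"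
      using that by (auto simp: perms_of_type_def cycle_type_orbs)
    have perm: "permutation \<rho>" using \<rho>(1) by (auto simp: permutation_permutes)
    have o: "orbs ?A (inv' \<rho>) = orbs ?A \<rho>" by (rule orbs_inv[OF perm])
    have fin: "finite (orbs ?A \<rho>)" by (rule finite_orbs) simp
    have c: "card (orbs ?A \<rho>) = length \<alpha>"
      using arg_cong[OF \<rho>(2), of size] by simp
    have A: "finite ?A" "?A \<noteq> {}" using assms(1) by auto
    have inv: "perm_inv ?A (inv' \<rho>)" by (rule perm_inv_permutes[OF permutes_inv[OF \<rho>(1)]])
    have l: "min_len ?A (inv' \<rho>) + 2 = ?r" using min_len_add[OF A, of "inv' \<rho>"] unfolding o c by simp
    have "count_facts ?A (inv' \<rho>) ?r = Phi1 card (orbs ?A \<rho>)"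
      using count_facts_eq[OF A inv, of ?r] unfolding l[symmetric] o Psi_def by simp
    then show ?thesis
      unfolding count_facts_def Phi1_eq_parts[OF fin \<rho>(2) sum] .
  qed
  have "real (monotone_hurwitz 1 \<alpha>) = (\<Sum>\<rho>\<in>?P. real (card (mono_facts ?A (inv' \<rho>) ?r)))"
    unfolding monotone_hurwitz_def bij_betw_same_card[OF bij_betw_monotone_factorizations[OF sum], symmetric]
    using finite_perms_of_type finite_mono_facts[of ?A] by (subst card_SigmaI) auto
  also have "\<dots> = real (card ?P) * ((\<Prod>j<length \<alpha>. nbinom (\<alpha> ! j)) / 24 * ?Q)"
    by (simp only: value_at sum_constant cong: sum.cong)
  also have "(\<Prod>j<length \<alpha>. nbinom (\<alpha> ! j)) = (\<Prod>j<length \<alpha>. real (\<alpha> ! j)) * (\<Prod>j<length \<alpha>. real ((2 * \<alpha> ! j) choose (\<alpha> ! j)))"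
    by (simp add: nbinom_def cbinom_def prod.distrib)
  finally have H: "real (monotone_hurwitz 1 \<alpha>) = real (card ?P) * (((\<Prod>j<length \<alpha>. real (\<alpha> ! j)) *
      (\<Prod>j<length \<alpha>. real ((2 * \<alpha> ! j) choose (\<alpha> ! j)))) / 24 * ?Q)" .
  have "0 \<notin># mset \<alpha>" using pos by fastforce
  then have "real (card ?P) * ((\<Prod>j<length \<alpha>. real (\<alpha> ! j)) * real (aut_size \<alpha>)) = fact d"
    using card_perms_of_type[of "mset \<alpha>" d] sum by (simp add: centralizer_size_mset sum_mset_sum_list)
  moreover have "aut_size \<alpha> > 0" by (simp add: aut_size_def)
  \<comment> \<open>The factors \<alpha>_j of \<open>nbinom\<close> cancel against those of the
    centralizer size; only the automorphisms of \<alpha> stay in the denominator.\<close>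
  ultimately have C: "real (card ?P) * (\<Prod>j<length \<alpha>. real (\<alpha> ! j)) = fact d / real (aut_size \<alpha>)"
    by (simp add: field_simps)
  show ?thesis unfolding H C[symmetric] by (simp add: algebra_simps)
qed

end
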